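(* Let $X$ be a Banach analytic manifold, let $\varphi:X\to[-\infty,\infty)$ be an upper semicontinuous function, and let $$\Omega_\varphi(X):=\{(z,w)\in X\times\mathbb C:\ |w|<e^{-\varphi(z)}\}$$ be the associated Hartogs domain. Then $\Omega_\varphi(X)$ has the strong Vitali property SVP (respectively, the weak Vitali property WVP) if and only if $\varphi$ is continuous plurisubharmonic on $X$ and $X$ has SVP (respectively, WVP).
   Context: A Banach analytic manifold is a connected topological space in which each point has a neighborhood homeomorphic to an open set in a Banach space, such that the transition maps are holomorphic between open sets of Banach spaces. For Banach analytic manifolds $A,Y$, $\mathrm{Hol}(A,Y)$ denotes the set of holomorphic mappings from $A$ into $Y$ with the compact-open topology. For a subset $S$ of a Banach analytic manifold $A$, $S^u$ is the set of all $z\in A\cap\overline S$ such that for every connected neighborhood $U$ of $z$ and every holomorphic function $f:U\to\mathbb C$, $f|_{U\cap S}=0$ implies $f|_U=0$. For a sequence $\{f_k\}\subset\mathrm{Hol}(A,Y)$, $Z_{\{f_k\}}$ is the set of $\lambda\in A$ such that $\{f_k(\lambda)\}$ is convergent in $Y$; $Z^u_{\{f_k\}}:=(Z_{\{f_k\}})^u$. A Banach analytic manifold $Y$ has the strong Vitali property (SVP) if for every (connected) Banach analytic manifold $A$, every sequence $\{f_k\}_{k\ge1}\subset\mathrm{Hol}(A,Y)$ with $Z^u_{\{f_k\}}\neq\emptyset$ is convergent in $\mathrm{Hol}(A,Y)$. $Y$ has the weak Vitali property (WVP) if for every (connected) Banach analytic manifold $A$, every sequence $\{f_k\}_{k\ge1}\subset\mathrm{Hol}(A,Y)$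 with $Z_{\{f_k\}}\cap Z^u_{\{f_k\}}\neq\emptyset$ is convergent in $\mathrm{Hol}(A,Y)$. A function $\varphi:X\to[-\infty,\infty)$ is plurisubharmonic if every point of $X$ has a neighborhood isomorphic to a ball $B$ in a Banach space $E$ on which $\varphi$, regarded as a function on $B$, is upper semicontinuous and has subharmonic restriction to the intersection of $B$ with each complex line in $E$; the function identically equal to $-\infty$ is allowed to be plurisubharmonic.
   Formalization: "Continuous" is taken to mean finite real-valued and continuous, since for φ ≡ −∞ on the disc the equivalence fails; manifolds are assumed Hausdorff, and the test manifolds A range over an arbitrary fixed universe containing the complex numbers. *)

theory Defs
  imports "HOL-Analysis.Analysis" "HOL-Algebra.Module"
begin

section \<open>Complex Banach spaces\<close>

text \<open>
  The Vitali properties quantify over all Banach analytic manifolds, hence over all Banach spaces.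
  As HOL cannot quantify over types inside a formula, Banach spaces and manifolds are structures
  carried by sets. A Banach space is a module over the ring of complex numbers with a complete
  norm; the ring multiplication and unit that the library's module record also contains are
  irrelevant.
\<close>

definition complex_ring :: "complex ring" where
  "complex_ring = \<lparr>carrier = UNIV, mult = (*), one = 1, zero = 0, add = (+)\<rparr>"

record 'v cnormed_space = "(complex, 'v) module" +
  vnorm :: "'v \<Rightarrow> real"

text \<open>The guard makes the distance nonnegative and symmetric on the whole type, as the locale
  \<^locale>\<open>Metric_space\<close> demands.\<close>

definition vdist :: "'v cnormed_space \<Rightarrow> 'v \<Rightarrow> 'v \<Rightarrow> real" where
  "vdist E x y = (if x \<in> carrier E \<and> y \<in> carrier E then vnorm E (x \<ominus>\<^bsub>E\<^esub> y) else 0)"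

locale complex_banach_space = module complex_ring E
  for E :: "'v cnormed_space" (structure) +
  assumes vnorm_nonneg: "x \<in> carrier E \<Longrightarrow> 0 \<le> vnorm E x"
    and vnorm_eq_zero: "x \<in> carrier E \<Longrightarrow> vnorm E x = 0 \<longleftrightarrow> x = \<zero>\<^bsub>E\<^esub>"
    and vnorm_triangle:
      "x \<in> carrier E \<Longrightarrow> y \<in> carrier E \<Longrightarrow> vnorm E (x \<oplus>\<^bsub>E\<^esub> y) \<le> vnorm E x + vnorm E y"
    and vnorm_smult: "x \<in> carrier E \<Longrightarrow> vnorm E (c \<odot>\<^bsub>E\<^esub> x) = cmod c * vnorm E x"
    and complete: "Metric_space.mcomplete (carrier E) (vdist E)"

definition vtop :: "'v cnormed_space \<Rightarrow> 'v topology" where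
  "vtop E = Metric_space.mtopology (carrier E) (vdist E)"

definition vball :: "'v cnormed_space \<Rightarrow> 'v \<Rightarrow> real \<Rightarrow> 'v set" where
  "vball E a r = Metric_space.mball (carrier E) (vdist E) a r"

definition complex_space :: "complex cnormed_space" where
  "complex_space = \<lparr>carrier = UNIV, mult = (*), one = 1, zero = 0, add = (+), smult = (*), vnorm = cmod\<rparr>"

definition prod_space :: "'v cnormed_space \<Rightarrow> 'w cnormed_space \<Rightarrow> ('v \<times> 'w) cnormed_space" where
  "prod_space E F =
    \<lparr>carrier = carrier E \<times> carrier F,
     mult = (\<lambda>(x, y) (x', y'). (x \<otimes>\<^bsub>E\<^esub> x', y \<otimes>\<^bsub>F\<^esub> y')),
     one = (\<one>\<^bsub>E\<^esub>, \<one>\<^bsub>F\<^esub>),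
     zero = (\<zero>\<^bsub>E\<^esub>, \<zero>\<^bsub>F\<^esub>),
     add = (\<lambda>(x, y) (x', y'). (x \<oplus>\<^bsub>E\<^esub> x', y \<oplus>\<^bsub>F\<^esub> y')),
     smult = (\<lambda>c (x, y). (c \<odot>\<^bsub>E\<^esub> x, c \<odot>\<^bsub>F\<^esub> y)),
     vnorm = (\<lambda>(x, y). sqrt ((vnorm E x)\<^sup>2 + (vnorm F y)\<^sup>2))\<rparr>"

definition bounded_clinear :: "'v cnormed_space \<Rightarrow> 'w cnormed_space \<Rightarrow> ('v \<Rightarrow> 'w) \<Rightarrow> bool" where
  "bounded_clinear E F D \<longleftrightarrow>
     D \<in> carrier E \<rightarrow> carrier F \<and>
     (\<forall>x\<in>carrier E. \<forall>y\<in>carrier E. D (x \<oplus>\<^bsub>E\<^esub> y) = D x \<oplus>\<^bsub>F\<^esub> D y) \<and>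
     (\<forall>c. \<forall>x\<in>carrier E. D (c \<odot>\<^bsub>E\<^esub> x) = c \<odot>\<^bsub>F\<^esub> D x) \<and>
     (\<exists>K. \<forall>x\<in>carrier E. vnorm F (D x) \<le> K * vnorm E x)"

text \<open>Holomorphy on an open set is complex Frechet differentiability at each of its points.\<close>

definition has_cderivative_at ::
  "'v cnormed_space \<Rightarrow> 'w cnormed_space \<Rightarrow> 'v set \<Rightarrow> ('v \<Rightarrow> 'w) \<Rightarrow> ('v \<Rightarrow> 'w) \<Rightarrow> 'v \<Rightarrow> bool" where
  "has_cderivative_at E F U f D x \<longleftrightarrow>
     bounded_clinear E F D \<and>
     (\<forall>\<epsilon>>0. \<exists>\<delta>>0. \<forall>y\<in>U. vdist E y x < \<delta> \<longrightarrow>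
        vnorm F ((f y \<ominus>\<^bsub>F\<^esub> f x) \<ominus>\<^bsub>F\<^esub> D (y \<ominus>\<^bsub>E\<^esub> x)) \<le> \<epsilon> * vdist E y x)"

definition vholomorphic_on ::
  "'v cnormed_space \<Rightarrow> 'w cnormed_space \<Rightarrow> 'v set \<Rightarrow> ('v \<Rightarrow> 'w) \<Rightarrow> bool" where
  "vholomorphic_on E F U f \<longleftrightarrow>
     openin (vtop E) U \<and> f \<in> U \<rightarrow> carrier F \<and> (\<forall>x\<in>U. \<exists>D. has_cderivative_at E F U f D x)"


section \<open>Banach analytic manifolds\<close>

record ('p, 'v) chart =
  cdom :: "'p set"
  cmodel :: "'v cnormed_space"
  cmap :: "'p \<Rightarrow> 'v"

record ('p, 'v) banach_mfd =
  mtop :: "'p topology"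
  atlas :: "('p, 'v) chart set"

abbreviation points :: "('p, 'v) banach_mfd \<Rightarrow> 'p set" where
  "points M \<equiv> topspace (mtop M)"

abbreviation cinv :: "('p, 'v) chart \<Rightarrow> 'v \<Rightarrow> 'p" where
  "cinv c \<equiv> inv_into (cdom c) (cmap c)"

text \<open>Different charts may be modelled on different Banach spaces. As usual for manifolds, the
  topology is understood to be Hausdorff.\<close>

locale banach_manifold =
  fixes M :: "('p, 'v) banach_mfd"
  assumes connected: "connected_space (mtop M)"
    and Hausdorff: "Hausdorff_space (mtop M)"
    and covering: "points M = (\<Union>c\<in>atlas M. cdom c)"
    and model: "c \<in> atlas M \<Longrightarrow> complex_banach_space (cmodel c)"
    and open_cdom: "c \<in> atlas M \<Longrightarrow> openin (mtop M) (cdom c)"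
    and open_range: "c \<in> atlas M \<Longrightarrow> openin (vtop (cmodel c)) (cmap c ` cdom c)"
    and chart_homeomorphic: "c \<in> atlas M \<Longrightarrow>
      homeomorphic_map (subtopology (mtop M) (cdom c))
        (subtopology (vtop (cmodel c)) (cmap c ` cdom c)) (cmap c)"
    and transition: "c \<in> atlas M \<Longrightarrow> d \<in> atlas M \<Longrightarrow>
      vholomorphic_on (cmodel c) (cmodel d) (cmap c ` (cdom c \<inter> cdom d)) (cmap d \<circ> cinv c)"

definition space_mfd :: "'v cnormed_space \<Rightarrow> ('v, 'v) banach_mfd" where
  "space_mfd E = \<lparr>mtop = vtop E, atlas = {\<lparr>cdom = carrier E, cmodel = E, cmap = id\<rparr>}\<rparr>"

abbreviation complex_plane :: "(complex, complex) banach_mfd" where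
  "complex_plane \<equiv> space_mfd complex_space"

definition open_submfd :: "('p, 'v) banach_mfd \<Rightarrow> 'p set \<Rightarrow> ('p, 'v) banach_mfd" where
  "open_submfd M U =
    \<lparr>mtop = subtopology (mtop M) U, atlas = (\<lambda>c. c\<lparr>cdom := cdom c \<inter> U\<rparr>) ` atlas M\<rparr>"

definition prod_chart ::
  "('p, 'v) chart \<Rightarrow> ('q, 'w) chart \<Rightarrow> ('p \<times> 'q, 'v \<times> 'w) chart" where
  "prod_chart c d =
    \<lparr>cdom = cdom c \<times> cdom d, cmodel = prod_space (cmodel c) (cmodel d),
     cmap = map_prod (cmap c) (cmap d)\<rparr>"

definition prod_mfd ::
  "('p, 'v) banach_mfd \<Rightarrow> ('q, 'w) banach_mfd \<Rightarrow> ('p \<times> 'q, 'v \<times> 'w) banach_mfd" where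
  "prod_mfd M N =
    \<lparr>mtop = prod_topology (mtop M) (mtop N),
     atlas = (\<lambda>(c, d). prod_chart c d) ` (atlas M \<times> atlas N)\<rparr>"

definition mholomorphic ::
  "('p, 'v) banach_mfd \<Rightarrow> ('q, 'w) banach_mfd \<Rightarrow> ('p \<Rightarrow> 'q) \<Rightarrow> bool" where
  "mholomorphic M N f \<longleftrightarrow>
     continuous_map (mtop M) (mtop N) f \<and>
     (\<forall>c\<in>atlas M. \<forall>d\<in>atlas N.
        vholomorphic_on (cmodel c) (cmodel d) (cmap c ` (cdom c \<inter> f -` cdom d)) (cmap d \<circ> f \<circ> cinv c))"

definition biholomorphic ::
  "('p, 'v) banach_mfd \<Rightarrow> ('q, 'w) banach_mfd \<Rightarrow> ('p \<Rightarrow> 'q) \<Rightarrow> ('q \<Rightarrow> 'p) \<Rightarrow> bool" where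
  "biholomorphic M N f g \<longleftrightarrow>
     mholomorphic M N f \<and> mholomorphic N M g \<and>
     (\<forall>x\<in>points M. g (f x) = x) \<and> (\<forall>y\<in>points N. f (g y) = y)"


section \<open>The space of holomorphic maps\<close>

text \<open>Maps are total functions in HOL; \<^const>\<open>extensional\<close> fixes their irrelevant values off the source.\<close>

definition Hol :: "('p, 'v) banach_mfd \<Rightarrow> ('q, 'w) banach_mfd \<Rightarrow> ('p \<Rightarrow> 'q) set" where
  "Hol A Y = {f \<in> extensional (points A). mholomorphic A Y f}"

definition compact_open ::
  "('p, 'v) banach_mfd \<Rightarrow> ('q, 'w) banach_mfd \<Rightarrow> ('p \<Rightarrow> 'q) topology" where
  "compact_open A Y =
     topology_generated_by
       {{f \<in> Hol A Y. f ` K \<subseteq> V} |K V. compactin (mtop A) K \<and> openin (mtop Y) V}"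


section \<open>The Vitali properties\<close>

text \<open>The set $S^u$. Neighborhoods on which functions are to be holomorphic are taken open.\<close>

definition uniq_set :: "('p, 'v) banach_mfd \<Rightarrow> 'p set \<Rightarrow> 'p set" where
  "uniq_set A S =
     {z \<in> points A \<inter> Abstract_Topology.closure_of (mtop A) S.
        \<forall>U f. openin (mtop A) U \<and> connectedin (mtop A) U \<and> z \<in> U \<and>
              mholomorphic (open_submfd A U) complex_plane f \<and> (\<forall>x\<in>U \<inter> S. f x = 0) \<longrightarrow>
              (\<forall>x\<in>U. f x = 0)}"

definition conv_set ::
  "('p, 'v) banach_mfd \<Rightarrow> ('q, 'w) banach_mfd \<Rightarrow> (nat \<Rightarrow> 'p \<Rightarrow> 'q) \<Rightarrow> 'p set" where
  "conv_set A Y f = {x \<in> points A. \<exists>y. limitin (mtop Y) (\<lambda>k. f k x) y sequentially}"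

text \<open>The type argument \<open>'u\<close> is the universe of the test manifolds: \<open>A\<close> ranges over all Banach
  analytic manifolds whose points, and whose model spaces, form subsets of \<open>'u\<close>. A universe in
  which the complex numbers do not embed carries no test manifold of positive dimension.\<close>

definition strong_vitali :: "'u itself \<Rightarrow> ('q, 'w) banach_mfd \<Rightarrow> bool" where
  "strong_vitali _ Y \<longleftrightarrow>
     (\<forall>(A :: ('u, 'u) banach_mfd) f.
        banach_manifold A \<and> (\<forall>k. f k \<in> Hol A Y) \<and>
        uniq_set A (conv_set A Y f) \<noteq> {} \<longrightarrow>
        (\<exists>g. limitin (compact_open A Y) f g sequentially))"

definition weak_vitali :: "'u itself \<Rightarrow> ('q, 'w) banach_mfd \<Rightarrow> bool" where
  "weak_vitali _ Y \<longleftrightarrow>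
     (\<forall>(A :: ('u, 'u) banach_mfd) f.
        banach_manifold A \<and> (\<forall>k. f k \<in> Hol A Y) \<and>
        conv_set A Y f \<inter> uniq_set A (conv_set A Y f) \<noteq> {} \<longrightarrow>
        (\<exists>g. limitin (compact_open A Y) f g sequentially))"


section \<open>Plurisubharmonic functions\<close>

text \<open>Functions into $[-\infty,\infty)$ are \<^typ>\<open>ereal\<close>-valued functions that avoid \<open>\<infinity>\<close>.\<close>

definition usc :: "'a topology \<Rightarrow> ('a \<Rightarrow> ereal) \<Rightarrow> bool" where
  "usc T u \<longleftrightarrow>
     (\<forall>x\<in>topspace T. u x < \<infinity>) \<and> (\<forall>c. openin T {x \<in> topspace T. u x < c})"

text \<open>The mean over the circle of a function that is bounded above there, as the integral of the
  positive part minus that of the negative part; it may be \<open>-\<infinity>\<close>.\<close>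

definition circle_mean :: "(complex \<Rightarrow> ereal) \<Rightarrow> complex \<Rightarrow> real \<Rightarrow> ereal" where
  "circle_mean u a r =
     (enn2ereal (\<integral>\<^sup>+t\<in>{0..2*pi}. e2ennreal (u (a + of_real r * cis t)) \<partial>lborel) -
      enn2ereal (\<integral>\<^sup>+t\<in>{0..2*pi}. e2ennreal (- u (a + of_real r * cis t)) \<partial>lborel)) / ereal (2*pi)"

definition subharmonic_on :: "complex set \<Rightarrow> (complex \<Rightarrow> ereal) \<Rightarrow> bool" where
  "subharmonic_on D u \<longleftrightarrow>
     open D \<and> usc (top_of_set D) u \<and>
     (\<forall>a r. 0 < r \<and> cball a r \<subseteq> D \<longrightarrow> u a \<le> circle_mean u a r)"

definition plurisubharmonic :: "('p, 'v) banach_mfd \<Rightarrow> ('p \<Rightarrow> ereal) \<Rightarrow> bool" where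
  "plurisubharmonic X \<phi> \<longleftrightarrow>
     (\<forall>z\<in>points X. \<exists>U (E :: 'v cnormed_space) a r h g.
        openin (mtop X) U \<and> z \<in> U \<and>
        complex_banach_space E \<and> a \<in> carrier E \<and> 0 < r \<and>
        biholomorphic (open_submfd X U) (open_submfd (space_mfd E) (vball E a r)) h g \<and>
        usc (subtopology (vtop E) (vball E a r)) (\<phi> \<circ> g) \<and>
        (\<forall>p\<in>carrier E. \<forall>v\<in>carrier E. v \<noteq> \<zero>\<^bsub>E\<^esub> \<longrightarrow>
           subharmonic_on {\<zeta>. p \<oplus>\<^bsub>E\<^esub> \<zeta> \<odot>\<^bsub>E\<^esub> v \<in> vball E a r}
             (\<lambda>\<zeta>. \<phi> (g (p \<oplus>\<^bsub>E\<^esub> \<zeta> \<odot>\<^bsub>E\<^esub> v)))))"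

text \<open>Continuity of a function on \<open>X\<close> means continuity as a real-valued function. With the value
  \<open>-\<infinity>\<close> admitted, the constant \<open>-\<infinity>\<close> on a one-point \<open>X\<close> would be continuous plurisubharmonic,
  and its Hartogs domain is the complex plane, which has neither Vitali property.\<close>

definition continuous_real :: "('p, 'v) banach_mfd \<Rightarrow> ('p \<Rightarrow> ereal) \<Rightarrow> bool" where
  "continuous_real X \<phi> \<longleftrightarrow>
     (\<forall>z\<in>points X. \<bar>\<phi> z\<bar> \<noteq> \<infinity>) \<and> continuous_map (mtop X) euclideanreal (real_of_ereal \<circ> \<phi>)"


section \<open>Hartogs domains\<close>

definition exp_ereal :: "ereal \<Rightarrow> ereal" where
  "exp_ereal x = (case x of ereal r \<Rightarrow> ereal (exp r) | PInfty \<Rightarrow> \<infinity> | MInfty \<Rightarrow> 0)"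

definition hartogs_domain ::
  "('p, 'v) banach_mfd \<Rightarrow> ('p \<Rightarrow> ereal) \<Rightarrow> ('p \<times> complex, 'v \<times> complex) banach_mfd" where
  "hartogs_domain X \<phi> =
     open_submfd (prod_mfd X complex_plane)
       {(z, w). z \<in> points X \<and> ereal (cmod w) < exp_ereal (- \<phi> z)}"

end

theory Submission
  imports Defs "HOL-Complex_Analysis.Complex_Analysis"
begin

text \<open>
  Necessity. If \<open>\<Omega>\<close> has the weak Vitali property and holomorphic maps from a plane domain to \<open>\<Omega>\<close>
  converge on an open subset, then they converge everywhere. Apply this to \<open>t \<mapsto> (z, exp (k t))\<close> if
  \<open>\<phi> z = -\<infinity>\<close>, to \<open>t \<mapsto> (z\<^sub>k, t)\<close> with \<open>z\<^sub>k \<rightarrow> z\<close> if \<open>\<phi>\<close> is not lower semicontinuous at \<open>z\<close>, and to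
  \<open>t \<mapsto> (\<gamma> t, (1 - 1/k) exp (-P t))\<close> if the submean inequality fails on a disc \<open>\<gamma>\<close>, where \<open>Re P\<close> touches
  \<open>\<phi> \<circ> \<gamma>\<close> from above inside the disc but not on its boundary: the limits leave \<open>\<Omega>\<close>.

  Sufficiency. For a sequence \<open>(g\<^sub>k, h\<^sub>k)\<close> of maps to \<open>\<Omega>\<close>, the maps \<open>g\<^sub>k\<close> converge to some \<open>g\<close> since \<open>X\<close> has
  the Vitali property, so the \<open>h\<^sub>k\<close> are locally bounded because \<open>\<phi>\<close> is continuous, and they converge to
  some \<open>h\<close> by a Vitali theorem for bounded functions. Then \<open>log |h| + \<phi> \<circ> g \<le> 0\<close>, with strict inequality
  somewhere, hence everywhere by the maximum principle. The latter needs that \<open>\<phi>\<close>, subharmonic on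
  complex lines, is subharmonic along holomorphic curves; this follows from polynomial
  approximation of the curve and a doubling of variables, without smoothing \<open>\<phi>\<close>.
\<close>

section \<open>Complex Banach spaces and their dual\<close>

text \<open>Infinite dimension is the obstacle: a bounded sequence of holomorphic functions on a
  Banach ball need have no pointwise convergent subsequence, and there is no Lebesgue measure with
  which to regularize \<phi>. Hahn-Banach reduces vectors to one complex variable: the functionals
  in \<open>unit_dual\<close> recover the norm, so scalar estimates that are uniform over them give
  norm estimates, Cauchy sequences and even vector identities. The Schwarz lemma supplies the basic
  constant. Dividing a function bounded by M on a disc of radius \<rho> by z, after subtracting its
  value at 0, costs a factor 3/\<rho>. Iterated, this bounds Taylor remainders on the unit disc by
  (3/\<rho>)^n M, which tends to 0 for \<rho> > 3; hence the discs of radius 8. Necessity uses only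
  the weak property, which the strong one implies, so it serves both equivalences. In the
  sufficiency proof the two properties differ only in how convergence of the first components is
  obtained. The Vitali property passes from the Hartogs domain to X through the zero
  section.\<close>

lemma complex_ring_simps [simp]:
  "carrier complex_ring = UNIV" "a \<oplus>\<^bsub>complex_ring\<^esub> b = a + b" "a \<otimes>\<^bsub>complex_ring\<^esub> b = a * b"
  "\<one>\<^bsub>complex_ring\<^esub> = 1" "\<zero>\<^bsub>complex_ring\<^esub> = 0"
  by (simp_all add: complex_ring_def)

lemma cring_complex_ring: "cring complex_ring"
proof (rule cringI)
  show "abelian_group complex_ring"
    by (rule abelian_groupI) (auto intro: exI [of _ "- x" for x])
  show "comm_monoid complex_ring"
    by (rule comm_monoidI) auto
qed (auto simp: algebra_simps)

context complex_banach_space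
begin

lemma smult_closedE [simp, intro]: "x \<in> carrier E \<Longrightarrow> c \<odot> x \<in> carrier E"
  using smult_closed by simp

lemma smult_add_left: "x \<in> carrier E \<Longrightarrow> (a + b) \<odot> x = a \<odot> x \<oplus> b \<odot> x"
  using smult_l_distr [of a b x] by simp

lemma smult_add_right: "x \<in> carrier E \<Longrightarrow> y \<in> carrier E \<Longrightarrow> a \<odot> (x \<oplus> y) = a \<odot> x \<oplus> a \<odot> y"
  using smult_r_distr [of a x y] by simp

lemma smult_smult: "x \<in> carrier E \<Longrightarrow> a \<odot> (b \<odot> x) = (a * b) \<odot> x"
  using smult_assoc1 [of a b x] by simp

lemma smult_1 [simp]: "x \<in> carrier E \<Longrightarrow> 1 \<odot> x = x"
  using smult_one [of x] by simp

lemma smult_0 [simp]: "x \<in> carrier E \<Longrightarrow> 0 \<odot> x = \<zero>"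
  using smult_l_null [of x] by simp

lemma smult_zero [simp]: "c \<odot> \<zero> = \<zero>"
  using smult_r_null [of c] by simp

lemma minus_eq_smult: assumes "x \<in> carrier E" shows "\<ominus> x = (-1) \<odot> x"
proof (rule minus_equality)
  show "(-1) \<odot> x \<oplus> x = \<zero>"
    using smult_add_left [of x "-1" 1] assms by simp
qed (use assms in auto)

lemma vnorm_zero [simp]: "vnorm E \<zero> = 0"
  using vnorm_eq_zero by blast

lemma vnorm_uminus [simp]: "x \<in> carrier E \<Longrightarrow> vnorm E (\<ominus> x) = vnorm E x"
  by (simp add: minus_eq_smult vnorm_smult)

lemma vdist_eq: "x \<in> carrier E \<Longrightarrow> y \<in> carrier E \<Longrightarrow> vdist E x y = vnorm E (x \<ominus> y)"
  by (simp add: vdist_def)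

section \<open>Sublinear functionals and the Hahn-Banach theorem\<close>

definition sublin :: "('v \<Rightarrow> real) \<Rightarrow> bool" where
  "sublin q \<longleftrightarrow> (\<forall>x\<in>carrier E. \<forall>y\<in>carrier E. q (x \<oplus> y) \<le> q x + q y) \<and>
     (\<forall>t>0. \<forall>x\<in>carrier E. q (of_real t \<odot> x) \<le> t * q x) \<and> q \<zero> = 0"

lemma sublin_add: "sublin q \<Longrightarrow> x \<in> carrier E \<Longrightarrow> y \<in> carrier E \<Longrightarrow> q (x \<oplus> y) \<le> q x + q y"
  and sublin_zero: "sublin q \<Longrightarrow> q \<zero> = 0"
  by (auto simp: sublin_def)

text \<open>The inequality for 1/t, applied to \<open>of_real t \<odot> x\<close>, is the reverse of
  the one for t. Demanding only the inequality in \<open>sublin\<close> makes it easy to verify for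
  infima.\<close>

lemma sublin_scale:
  assumes q: "sublin q" and t: "t \<ge> 0" and x: "x \<in> carrier E"
  shows "q (of_real t \<odot> x) = t * q x"
proof (cases "t = 0")
  case False
  then have t: "t > 0" using t by simp
  have 1: "q (of_real s \<odot> y) \<le> s * q y" if "s > 0" "y \<in> carrier E" for s y
    using q that by (auto simp: sublin_def)
  have "q (of_real (1/t) \<odot> (of_real t \<odot> x)) \<le> (1/t) * q (of_real t \<odot> x)"
    using 1 [of "1/t"] t x by simp
  then have "q x \<le> (1/t) * q (of_real t \<odot> x)"
    using t x by (simp add: smult_smult)
  then have "t * q x \<le> q (of_real t \<odot> x)" using t by (simp add: field_simps)
  with 1 [OF t x] show ?thesis by simp
qed (use q x in \<open>simp add: sublin_zero\<close>)

lemma sublin_lower: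
  assumes q: "sublin q" and x: "x \<in> carrier E"
  shows "- q (\<ominus> x) \<le> q x"
  using sublin_add [OF q x, of "\<ominus> x"] x sublin_zero [OF q] by (simp add: r_neg)

lemma sublin_vnorm: "sublin (vnorm E)"
  by (auto simp: sublin_def vnorm_triangle vnorm_smult)

text \<open>Lowering a sublinear functional \<open>q\<close> in the direction \<open>x0\<close>: a minimal \<open>q\<close> equals the result,
  which makes it additive.\<close>

definition sublin_dir :: "('v \<Rightarrow> real) \<Rightarrow> 'v \<Rightarrow> 'v \<Rightarrow> real" where
  "sublin_dir q x0 x = (INF t\<in>{0..}. q (x \<oplus> of_real t \<odot> x0) - t * q x0)"

text \<open>The bound does not depend on t, so the infimum in \<open>sublin_dir\<close> is taken
  over a set that is bounded below.\<close>

lemma sublin_dir_bdd: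
  assumes q: "sublin q" and x0: "x0 \<in> carrier E" and x: "x \<in> carrier E" and t: "t \<ge> 0"
  shows "- q (\<ominus> x) \<le> q (x \<oplus> of_real t \<odot> x0) - t * q x0"
proof -
  have "t * q x0 = q (of_real t \<odot> x0)" using sublin_scale [OF q t x0] by simp
  also have "of_real t \<odot> x0 = (x \<oplus> of_real t \<odot> x0) \<oplus> \<ominus> x"
    using x x0 by (smt (verit) a_comm a_inv_closed add.inv_solve_right add.m_closed smult_closedE)
  also have "q \<dots> \<le> q (x \<oplus> of_real t \<odot> x0) + q (\<ominus> x)"
    using x x0 by (intro sublin_add [OF q]) auto
  finally show ?thesis by simp
qed

lemma sublin_dir_le:
  assumes q: "sublin q" and x0: "x0 \<in> carrier E" and x: "x \<in> carrier E" and t: "t \<ge> 0"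
  shows "sublin_dir q x0 x \<le> q (x \<oplus> of_real t \<odot> x0) - t * q x0"
  unfolding sublin_dir_def
proof (rule cINF_lower)
  show "bdd_below ((\<lambda>t. q (x \<oplus> of_real t \<odot> x0) - t * q x0) ` {0..})"
    by (rule bdd_belowI2 [of _ "- q (\<ominus> x)"]) (use sublin_dir_bdd [OF q x0 x] in auto)
qed (use t in auto)

lemma sublin_dir_ge:
  assumes "\<And>t. t \<ge> 0 \<Longrightarrow> b \<le> q (x \<oplus> of_real t \<odot> x0) - t * q x0"
  shows "b \<le> sublin_dir q x0 x"
  unfolding sublin_dir_def by (rule cINF_greatest) (use assms in auto)

lemma sublin_dir_le_self:
  assumes q: "sublin q" and x0: "x0 \<in> carrier E" and x: "x \<in> carrier E"
  shows "sublin_dir q x0 x \<le> q x"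
  using sublin_dir_le [OF q x0 x, of 0] x x0 by simp

lemma sublin_sublin_dir:
  assumes q: "sublin q" and x0: "x0 \<in> carrier E"
  shows "sublin (sublin_dir q x0)"
  unfolding sublin_def
proof (intro conjI ballI allI impI)
  fix x y assume x: "x \<in> carrier E" and y: "y \<in> carrier E"
  \<comment> \<open>Parameters s for x and t for y combine to the parameter s + t for the
    sum.\<close>
  have *: "sublin_dir q x0 (x \<oplus> y) \<le> (q (x \<oplus> of_real s \<odot> x0) - s * q x0) + (q (y \<oplus> of_real t \<odot> x0) - t * q x0)"
    if s: "s \<ge> 0" and t: "t \<ge> 0" for s t
  proof -
    have "(x \<oplus> y) \<oplus> of_real (s + t) \<odot> x0 = (x \<oplus> of_real s \<odot> x0) \<oplus> (y \<oplus> of_real t \<odot> x0)"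
      using x y x0 by (simp add: smult_add_left a_ac)
    then have "q ((x \<oplus> y) \<oplus> of_real (s + t) \<odot> x0) \<le> q (x \<oplus> of_real s \<odot> x0) + q (y \<oplus> of_real t \<odot> x0)"
      using sublin_add [OF q] x y x0 by simp
    then show ?thesis
      using sublin_dir_le [OF q x0, of "x \<oplus> y" "s + t"] x y s t by (simp add: algebra_simps)
  qed
  \<comment> \<open>The infima over s and over t are taken one after the other, each time with the
    remaining terms moved to the left.\<close>
  have "sublin_dir q x0 (x \<oplus> y) - (q (y \<oplus> of_real t \<odot> x0) - t * q x0) \<le> sublin_dir q x0 x" if "t \<ge> 0" for t
    by (rule sublin_dir_ge) (use * that in \<open>force simp: algebra_simps\<close>)
  then have "sublin_dir q x0 (x \<oplus> y) - sublin_dir q x0 x \<le> sublin_dir q x0 y"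
    by (intro sublin_dir_ge) (force simp: algebra_simps)
  then show "sublin_dir q x0 (x \<oplus> y) \<le> sublin_dir q x0 x + sublin_dir q x0 y" by simp
next
  fix t :: real and x assume t: "t > 0" and x: "x \<in> carrier E"
  have "sublin_dir q x0 (of_real t \<odot> x) / t \<le> sublin_dir q x0 x"
  proof (rule sublin_dir_ge)
    fix s :: real assume s: "s \<ge> 0"
    have "of_real t \<odot> x \<oplus> of_real (t * s) \<odot> x0 = of_real t \<odot> (x \<oplus> of_real s \<odot> x0)"
      using x x0 by (simp add: smult_add_right smult_smult)
    then have "q (of_real t \<odot> x \<oplus> of_real (t * s) \<odot> x0) = t * q (x \<oplus> of_real s \<odot> x0)"
      using sublin_scale [OF q, of t] t x x0 by simp
    then have "sublin_dir q x0 (of_real t \<odot> x) \<le> t * (q (x \<oplus> of_real s \<odot> x0) - s * q x0)"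
      using sublin_dir_le [OF q x0, of "of_real t \<odot> x" "t * s"] t s x by (simp add: algebra_simps)
    then show "sublin_dir q x0 (of_real t \<odot> x) / t \<le> q (x \<oplus> of_real s \<odot> x0) - s * q x0"
      using t by (simp add: field_simps)
  qed
  then show "sublin_dir q x0 (of_real t \<odot> x) \<le> t * sublin_dir q x0 x"
    using t by (simp add: field_simps)
next
  have "sublin_dir q x0 \<zero> \<le> 0"
    using sublin_dir_le_self [OF q x0, of \<zero>] sublin_zero [OF q] by simp
  moreover have "0 \<le> sublin_dir q x0 \<zero>"
    by (rule sublin_dir_ge) (use sublin_scale [OF q] x0 in simp)
  ultimately show "sublin_dir q x0 \<zero> = 0" by simp
qed

text \<open>The parameter t = 1 cancels x0 against its negative. This is what later makes the
  functional attain the norm of x0.\<close>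

lemma sublin_dir_neg:
  assumes q: "sublin q" and x0: "x0 \<in> carrier E"
  shows "sublin_dir q x0 (\<ominus> x0) \<le> - q x0"
  using sublin_dir_le [OF q x0, of "\<ominus> x0" 1] x0 sublin_zero [OF q] by (simp add: l_neg)

text \<open>Zorn's lemma for the reversed pointwise order: the infimum of a chain of sublinear
  functionals is sublinear.\<close>

lemma sublin_minimal:
  assumes p: "sublin p"
  obtains q where "sublin q" "\<And>x. x \<in> carrier E \<Longrightarrow> q x \<le> p x"
    "\<And>q' x. sublin q' \<Longrightarrow> (\<And>x. x \<in> carrier E \<Longrightarrow> q' x \<le> q x) \<Longrightarrow> x \<in> carrier E \<Longrightarrow> q' x = q x"
proof -
  \<comment> \<open>Extensionality makes the pointwise order antisymmetric, as
    \<open>predicate_Zorn\<close> requires; only values on the carrier matter.\<close>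
  define S where "S = {q. sublin q \<and> q \<in> extensional (carrier E) \<and> (\<forall>x\<in>carrier E. q x \<le> p x)}"
  define P where "P = (\<lambda>q q' :: 'v \<Rightarrow> real. \<forall>x\<in>carrier E. q' x \<le> q x)"
  have "partial_order_on S (relation_of P S)"
  proof (rule partial_order_on_relation_ofI)
    show "\<And>a b. a \<in> S \<Longrightarrow> b \<in> S \<Longrightarrow> P a b \<Longrightarrow> P b a \<Longrightarrow> a = b"
      unfolding S_def P_def by (rule extensionalityI [of _ "carrier E"]) (auto intro: order.antisym)
  qed (auto simp: P_def intro: order_trans)
  then have "\<exists>m\<in>S. \<forall>a\<in>S. P m a \<longrightarrow> a = m"
  proof (rule predicate_Zorn)
    fix C assume C: "C \<in> Chains (relation_of P S)"
    then have CS: "C \<subseteq> S" and chain: "\<And>a b. a \<in> C \<Longrightarrow> b \<in> C \<Longrightarrow> P a b \<or> P b a"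
      unfolding Chains_def relation_of_def by auto
    show "\<exists>u\<in>S. \<forall>a\<in>C. P a u"
    proof (cases "C = {}")
      case True
      have "restrict p (carrier E) \<in> S"
        using p by (auto simp: S_def sublin_def)
      with True show ?thesis by auto
    next
      case False
      then obtain q0 where q0: "q0 \<in> C" by auto
      have sub: "sublin q" if "q \<in> C" for q using that CS by (auto simp: S_def)
      define u where "u = restrict (\<lambda>x. INF q\<in>C. q x) (carrier E)"
      \<comment> \<open>Every q below p satisfies - p (-x) \<le> - q (-x) \<le> q x, so the infimum
        over the chain is finite.\<close>
      have bdd: "bdd_below ((\<lambda>q. q x) ` C)" if x: "x \<in> carrier E" for x
      proof (rule bdd_belowI2)
        fix q assume "q \<in> C"
        then have "- q (\<ominus> x) \<le> q x" "q (\<ominus> x) \<le> p (\<ominus> x)"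
          using sublin_lower sub x CS by (auto simp: S_def)
        then show "- p (\<ominus> x) \<le> q x" by simp
      qed
      have u_le: "u x \<le> q x" if "x \<in> carrier E" "q \<in> C" for x q
        using that bdd by (auto simp: u_def intro: cINF_lower)
      have u_ge: "b \<le> u x" if "x \<in> carrier E" "\<And>q. q \<in> C \<Longrightarrow> b \<le> q x" for x b
        using that False by (auto simp: u_def intro: cINF_greatest)
      have "sublin u"
        unfolding sublin_def
      proof (intro conjI ballI allI impI)
        fix x y assume x: "x \<in> carrier E" and y: "y \<in> carrier E"
        \<comment> \<open>Of two members of the chain the smaller one bounds both values at once,
          which reduces the claim to the subadditivity of a single q.\<close>
        have *: "u (x \<oplus> y) \<le> q1 x + q2 y" if "q1 \<in> C" "q2 \<in> C" for q1 q2
        proof -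
          obtain q where q: "q \<in> C" "q x \<le> q1 x" "q y \<le> q2 y"
            using chain [of q1 q2] \<open>q1 \<in> C\<close> \<open>q2 \<in> C\<close> x y unfolding P_def by blast
          have "u (x \<oplus> y) \<le> q (x \<oplus> y)" using u_le x y q by auto
          also have "\<dots> \<le> q x + q y" using sublin_add sub q x y by auto
          finally show ?thesis using q by linarith
        qed
        have "u (x \<oplus> y) - q2 y \<le> u x" if "q2 \<in> C" for q2
          by (rule u_ge) (use * that x in \<open>force simp: algebra_simps\<close>)+
        then have "u (x \<oplus> y) - u x \<le> u y"
          by (intro u_ge) (use y in \<open>force simp: algebra_simps\<close>)+
        then show "u (x \<oplus> y) \<le> u x + u y" by simp
      next
        fix t :: real and x assume t: "t > 0" and x: "x \<in> carrier E"
        have "u (of_real t \<odot> x) / t \<le> u x"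
        proof (rule u_ge [OF x])
          fix q assume q: "q \<in> C"
          have "u (of_real t \<odot> x) \<le> t * q x"
            using u_le [OF _ q, of "of_real t \<odot> x"] x sublin_scale [OF sub [OF q], of t x] t by simp
          then show "u (of_real t \<odot> x) / t \<le> q x" using t by (simp add: field_simps)
        qed
        then show "u (of_real t \<odot> x) \<le> t * u x" using t by (simp add: field_simps)
      next
        show "u \<zero> = 0"
          using u_le [OF _ q0, of \<zero>] u_ge [of \<zero> 0] sub q0 sublin_zero by force
      qed
      moreover have "\<forall>x\<in>carrier E. u x \<le> p x"
        using u_le [OF _ q0] q0 CS by (force simp: S_def)
      ultimately have "u \<in> S" by (auto simp: S_def u_def)
      moreover have "\<forall>a\<in>C. P a u" using u_le by (auto simp: P_def)
      ultimately show ?thesis by blast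
    qed
  qed
  then obtain q where q: "q \<in> S" "\<And>q'. q' \<in> S \<Longrightarrow> P q q' \<Longrightarrow> q' = q" by blast
  show ?thesis
  proof
    show "sublin q" "\<And>x. x \<in> carrier E \<Longrightarrow> q x \<le> p x" using q by (auto simp: S_def)
    fix q' x assume q': "sublin q'" "\<And>x. x \<in> carrier E \<Longrightarrow> q' x \<le> q x" and x: "x \<in> carrier E"
    have "restrict q' (carrier E) \<in> S"
    proof -
      have "q' y \<le> p y" if "y \<in> carrier E" for y
        using q'(2) [OF that] q(1) that by (force simp: S_def)
      with q' show ?thesis by (auto simp: S_def sublin_def)
    qed
    then have "restrict q' (carrier E) = q"
      by (rule q(2)) (use q' in \<open>auto simp: P_def\<close>)
    then show "q' x = q x" using x by auto
  qed
qed

text \<open>The closed unit ball of the dual space, with values off the carrier left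
  arbitrary.\<close>

definition unit_dual :: "('v \<Rightarrow> complex) set" where
  "unit_dual = {l. (\<forall>x\<in>carrier E. \<forall>y\<in>carrier E. l (x \<oplus> y) = l x + l y) \<and>
     (\<forall>c. \<forall>x\<in>carrier E. l (c \<odot> x) = c * l x) \<and> (\<forall>x\<in>carrier E. cmod (l x) \<le> vnorm E x)}"

lemma unit_dualD:
  assumes "l \<in> unit_dual"
  shows "x \<in> carrier E \<Longrightarrow> y \<in> carrier E \<Longrightarrow> l (x \<oplus> y) = l x + l y"
    "x \<in> carrier E \<Longrightarrow> l (c \<odot> x) = c * l x"
    "x \<in> carrier E \<Longrightarrow> cmod (l x) \<le> vnorm E x"
    "l \<zero> = 0"
    "x \<in> carrier E \<Longrightarrow> l (\<ominus> x) = - l x"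
    "x \<in> carrier E \<Longrightarrow> y \<in> carrier E \<Longrightarrow> l (x \<ominus> y) = l x - l y"
proof -
  show add: "l (x \<oplus> y) = l x + l y" if "x \<in> carrier E" "y \<in> carrier E" for x y
    using assms that by (auto simp: unit_dual_def)
  show sm: "l (c \<odot> x) = c * l x" if "x \<in> carrier E" for c x
    using assms that by (auto simp: unit_dual_def)
  show "cmod (l x) \<le> vnorm E x" if "x \<in> carrier E" for x
    using assms that by (auto simp: unit_dual_def)
  show "l \<zero> = 0" using sm [of \<zero> 0] by simp
  show neg: "l (\<ominus> x) = - l x" if "x \<in> carrier E" for x
    using sm [OF that, of "-1"] that by (simp add: minus_eq_smult)
  show "l (x \<ominus> y) = l x - l y" if "x \<in> carrier E" "y \<in> carrier E" for x y
    using that by (simp add: a_minus_def add neg)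
qed

text \<open>Instead of extending a functional from the line through x0, the norm is first lowered in
  the direction x0. Every sublinear q below the result has q (-x0) \<le> -
  \<open>vnorm E x0\<close>, so a minimal q is linear and norming at once.\<close>

theorem Hahn_Banach_norming:
  assumes x0: "x0 \<in> carrier E"
  obtains l where "l \<in> unit_dual" "l x0 = vnorm E x0"
proof -
  let ?p = "sublin_dir (vnorm E) x0"
  have p: "sublin ?p" by (rule sublin_sublin_dir [OF sublin_vnorm x0])
  obtain q where q: "sublin q" and qp: "\<And>x. x \<in> carrier E \<Longrightarrow> q x \<le> ?p x"
    and qmin: "\<And>q' x. sublin q' \<Longrightarrow> (\<And>x. x \<in> carrier E \<Longrightarrow> q' x \<le> q x) \<Longrightarrow> x \<in> carrier E \<Longrightarrow> q' x = q x"
    using sublin_minimal [OF p] by blast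
  have qn: "q x \<le> vnorm E x" if "x \<in> carrier E" for x
    using qp [OF that] sublin_dir_le_self [OF sublin_vnorm x0 that] by simp
  \<comment> \<open>By minimality, lowering q in the direction y changes nothing; evaluating the
    infimum at t = 1 gives the superadditive half.\<close>
  have add: "q (x \<oplus> y) = q x + q y" if x: "x \<in> carrier E" and y: "y \<in> carrier E" for x y
  proof -
    have "sublin_dir q y x = q x"
      by (rule qmin [OF sublin_sublin_dir [OF q y] _ x]) (rule sublin_dir_le_self [OF q y])
    then have "q x \<le> q (x \<oplus> y) - q y"
      using sublin_dir_le [OF q y x, of 1] y by simp
    with sublin_add [OF q x y] show ?thesis by simp
  qed
  have neg: "q (\<ominus> x) = - q x" if "x \<in> carrier E" for x
    using add [OF that, of "\<ominus> x"] that sublin_zero [OF q] by (simp add: r_neg)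
  have real_scale: "q (of_real t \<odot> x) = t * q x" if x: "x \<in> carrier E" for t x
  proof (cases "t \<ge> 0")
    case False
    have "of_real t \<odot> x = \<ominus> (of_real (-t) \<odot> x)"
      using x by (simp add: minus_eq_smult smult_smult)
    then show ?thesis using sublin_scale [OF q, of "-t" x] False x neg by simp
  qed (use sublin_scale [OF q] x in auto)
  \<comment> \<open>The unique complex linear functional with real part q is q x - i q (i
    x).\<close>
  define l where "l x = Complex (q x) (- q (\<i> \<odot> x))" for x
  have ladd: "l (x \<oplus> y) = l x + l y" if "x \<in> carrier E" "y \<in> carrier E" for x y
    using that by (simp add: l_def smult_add_right add complex_eq_iff)
  have lscale: "l (c \<odot> x) = c * l x" if x: "x \<in> carrier E" for c x
  proof -
    have c: "c \<odot> x = of_real (Re c) \<odot> x \<oplus> of_real (Im c) \<odot> (\<i> \<odot> x)"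
      using x by (metis complex_eq mult.commute smult_add_left smult_smult)
    have ic: "\<i> \<odot> (c \<odot> x) = of_real (Re c) \<odot> (\<i> \<odot> x) \<oplus> of_real (- Im c) \<odot> x"
      using x by (simp add: smult_smult flip: smult_add_left)
        (rule arg_cong [where f = "\<lambda>a. a \<odot> x"], simp add: complex_eq_iff)
    have 1: "q (c \<odot> x) = Re c * q x + Im c * q (\<i> \<odot> x)"
      unfolding c using x by (subst add) (auto simp: real_scale)
    have 2: "q (\<i> \<odot> (c \<odot> x)) = Re c * q (\<i> \<odot> x) - Im c * q x"
      unfolding ic using x by (subst add) (auto simp: real_scale simp del: of_real_minus)
    show ?thesis using 1 2 by (simp add: l_def complex_eq_iff)
  qed
  have lnorm: "cmod (l x) \<le> vnorm E x" if x: "x \<in> carrier E" for x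
  proof (cases "l x = 0")
    case False
    \<comment> \<open>A unimodular factor that rotates l x onto the positive real axis, where l
      agrees with its real part q.\<close>
    define e where "e = cnj (l x) / cmod (l x)"
    have "cmod e = 1" using False by (simp add: e_def norm_divide)
    have "e * l x = cmod (l x)"
      using False complex_norm_square [of "l x"] by (simp add: e_def field_simps power2_eq_square)
    then have "cmod (l x) = Re (l (e \<odot> x))" using lscale [OF x] by simp
    also have "\<dots> \<le> vnorm E (e \<odot> x)" using qn x by (simp add: l_def)
    also have "\<dots> = vnorm E x" using x \<open>cmod e = 1\<close> by (simp add: vnorm_smult)
    finally show ?thesis .
  qed (use vnorm_nonneg x in auto)
  have "l \<in> unit_dual" using ladd lscale lnorm by (auto simp: unit_dual_def)
  moreover have "l x0 = vnorm E x0"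
  proof -
    have "q (\<ominus> x0) \<le> - vnorm E x0"
      using qp [of "\<ominus> x0"] sublin_dir_neg [OF sublin_vnorm x0] x0 by force
    then have "Re (l x0) \<ge> vnorm E x0" using neg x0 by (simp add: l_def)
    with lnorm [OF x0] show ?thesis
      by (smt (verit) abs_Re_le_cmod complex_Re_le_cmod cmod_power2 complex_eq_iff Re_complex_of_real Im_complex_of_real
           power2_eq_iff_nonneg zero_eq_power2 norm_ge_zero vnorm_nonneg [OF x0])
  qed
  ultimately show ?thesis using that by blast
qed

lemma vnorm_le_dual:
  assumes "x \<in> carrier E" "\<And>l. l \<in> unit_dual \<Longrightarrow> cmod (l x) \<le> B"
  shows "vnorm E x \<le> B"
  using Hahn_Banach_norming [OF assms(1)] assms(2) by (metis abs_of_nonneg assms(1) norm_of_real vnorm_nonneg)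

text \<open>Functionals separate points. Vector identities are proved below by applying an arbitrary
  l and computing in the complex numbers.\<close>

lemma eq_dual:
  assumes "x \<in> carrier E" "y \<in> carrier E" "\<And>l. l \<in> unit_dual \<Longrightarrow> l x = l y"
  shows "x = y"
proof -
  have "vnorm E (x \<ominus> y) \<le> 0"
    by (rule vnorm_le_dual) (use assms in \<open>auto simp: unit_dualD\<close>)
  then have "x \<ominus> y = \<zero>"
    using assms vnorm_nonneg [of "x \<ominus> y"] vnorm_eq_zero [of "x \<ominus> y"] by simp
  then show ?thesis using assms minus_equality [of x "\<ominus> y"] by (simp add: a_minus_def)
qed

section \<open>The norm metric and its topology\<close>

lemma metric: "Metric_space (carrier E) (vdist E)"
proof
  show "0 \<le> vdist E x y" for x y by (simp add: vdist_def vnorm_nonneg)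
  show "vdist E x y = vdist E y x" for x y
  proof (cases "x \<in> carrier E \<and> y \<in> carrier E")
    case True
    then have "y \<ominus> x = \<ominus> (x \<ominus> y)" by (intro eq_dual) (auto simp: unit_dualD)
    with True show ?thesis by (simp add: vdist_def)
  qed (auto simp: vdist_def)
  fix x y assume xy: "x \<in> carrier E" "y \<in> carrier E"
  show "vdist E x y = 0 \<longleftrightarrow> x = y"
    using xy vnorm_eq_zero [of "x \<ominus> y"] minus_equality [of x "\<ominus> y"]
    by (auto simp: vdist_def a_minus_def r_neg)
  fix z assume z: "z \<in> carrier E"
  have "x \<ominus> z = (x \<ominus> y) \<oplus> (y \<ominus> z)"
    using xy z by (intro eq_dual) (auto simp: unit_dualD)
  then show "vdist E x z \<le> vdist E x y + vdist E y z"
    using xy z vnorm_triangle [of "x \<ominus> y" "y \<ominus> z"] by (simp add: vdist_def)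
qed

lemma vdist_nonneg [simp]: "0 \<le> vdist E x y"
  using metric by (simp add: Metric_space.nonneg)

lemma vdist_commute: "vdist E x y = vdist E y x"
  using metric by (simp add: Metric_space.commute)

lemma vdist_self [simp]: "x \<in> carrier E \<Longrightarrow> vdist E x x = 0"
  using metric by (simp add: Metric_space.zero)

lemma vdist_triangle: "x \<in> carrier E \<Longrightarrow> y \<in> carrier E \<Longrightarrow> z \<in> carrier E \<Longrightarrow> vdist E x z \<le> vdist E x y + vdist E y z"
  using metric Metric_space.triangle by metis

lemma in_vball [simp]: "y \<in> vball E x r \<longleftrightarrow> x \<in> carrier E \<and> y \<in> carrier E \<and> vdist E x y < r"
  by (simp add: vball_def Metric_space.in_mball [OF metric])

lemma openin_vtop: "openin (vtop E) U \<longleftrightarrow> U \<subseteq> carrier E \<and> (\<forall>x\<in>U. \<exists>r>0. vball E x r \<subseteq> U)"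
  unfolding vtop_def vball_def Metric_space.openin_mtopology [OF metric] by blast

lemma topspace_vtop [simp]: "topspace (vtop E) = carrier E"
  by (simp add: vtop_def Metric_space.topspace_mtopology [OF metric])

lemma openin_vball [simp, intro]: "openin (vtop E) (vball E x r)"
  by (simp add: vtop_def vball_def Metric_space.openin_mball [OF metric])

lemma vdist_line:
  assumes "p \<in> carrier E" "v \<in> carrier E"
  shows "vdist E (p \<oplus> s \<odot> v) (p \<oplus> t \<odot> v) = cmod (s - t) * vnorm E v"
proof -
  have "(p \<oplus> s \<odot> v) \<ominus> (p \<oplus> t \<odot> v) = (s - t) \<odot> v"
    using assms by (intro eq_dual) (auto simp: unit_dualD algebra_simps)
  then show ?thesis using assms by (simp add: vdist_eq vnorm_smult)
qed

end

section \<open>Complex Frechet derivatives\<close>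

lemma bounded_clinear_bound:
  assumes "bounded_clinear E F D"
  obtains K where "K > 0" "\<And>x. x \<in> carrier E \<Longrightarrow> 0 \<le> vnorm E x \<Longrightarrow> vnorm F (D x) \<le> K * vnorm E x"
proof -
  obtain K where K: "\<forall>x\<in>carrier E. vnorm F (D x) \<le> K * vnorm E x"
    using assms by (auto simp: bounded_clinear_def)
  show ?thesis
  proof
    show "max K 1 > 0" by simp
    fix x assume "x \<in> carrier E" "0 \<le> vnorm E x"
    then show "vnorm F (D x) \<le> max K 1 * vnorm E x"
      using K by (meson dual_order.trans max.cobounded1 mult_right_mono)
  qed
qed

lemma bounded_clinear_simps:
  assumes "complex_banach_space E" "complex_banach_space F" "bounded_clinear E F D"
  shows "x \<in> carrier E \<Longrightarrow> D x \<in> carrier F"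
    "x \<in> carrier E \<Longrightarrow> y \<in> carrier E \<Longrightarrow> D (x \<oplus>\<^bsub>E\<^esub> y) = D x \<oplus>\<^bsub>F\<^esub> D y"
    "x \<in> carrier E \<Longrightarrow> D (c \<odot>\<^bsub>E\<^esub> x) = c \<odot>\<^bsub>F\<^esub> D x"
    "x \<in> carrier E \<Longrightarrow> y \<in> carrier E \<Longrightarrow> D (x \<ominus>\<^bsub>E\<^esub> y) = D x \<ominus>\<^bsub>F\<^esub> D y"
proof -
  interpret E: complex_banach_space E by fact
  interpret F: complex_banach_space F by fact
  show 1: "D x \<in> carrier F" if "x \<in> carrier E" for x
    using assms(3) that by (auto simp: bounded_clinear_def)
  show 2: "D (x \<oplus>\<^bsub>E\<^esub> y) = D x \<oplus>\<^bsub>F\<^esub> D y" if "x \<in> carrier E" "y \<in> carrier E" for x y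
    using assms(3) that by (auto simp: bounded_clinear_def)
  show 3: "D (c \<odot>\<^bsub>E\<^esub> x) = c \<odot>\<^bsub>F\<^esub> D x" if "x \<in> carrier E" for x c
    using assms(3) that by (auto simp: bounded_clinear_def)
  show "D (x \<ominus>\<^bsub>E\<^esub> y) = D x \<ominus>\<^bsub>F\<^esub> D y" if "x \<in> carrier E" "y \<in> carrier E" for x y
    using that 1 by (simp add: a_minus_def E.minus_eq_smult F.minus_eq_smult 2 3)
qed

lemma cderivative_subset:
  "has_cderivative_at E F U f D x \<Longrightarrow> V \<subseteq> U \<Longrightarrow> has_cderivative_at E F V f D x"
  unfolding has_cderivative_at_def by (meson subsetD)

lemma cderivative_cong:
  assumes "has_cderivative_at E F U f D x" "x \<in> U" "\<And>y. y \<in> U \<Longrightarrow> f y = g y"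
  shows "has_cderivative_at E F U g D x"
  using assms unfolding has_cderivative_at_def by simp

text \<open>The remainder estimate concerns only points near x, and these lie in the open set V;
  hence the set can be enlarged as well as shrunk.\<close>

lemma cderivative_local:
  assumes "complex_banach_space E" "has_cderivative_at E F V f D x" "openin (vtop E) V" "x \<in> V" "U \<subseteq> carrier E"
  shows "has_cderivative_at E F U f D x"
  unfolding has_cderivative_at_def
proof (intro conjI allI impI)
  interpret E: complex_banach_space E by fact
  show "bounded_clinear E F D" using assms by (simp add: has_cderivative_at_def)
  obtain r where r: "r > 0" "vball E x r \<subseteq> V" using assms E.openin_vtop by blast
  fix \<epsilon> :: real assume "\<epsilon> > 0"
  then obtain \<delta> where d: "\<delta> > 0" "\<And>y. y \<in> V \<Longrightarrow> vdist E y x < \<delta> \<Longrightarrow>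
        vnorm F ((f y \<ominus>\<^bsub>F\<^esub> f x) \<ominus>\<^bsub>F\<^esub> D (y \<ominus>\<^bsub>E\<^esub> x)) \<le> \<epsilon> * vdist E y x"
    using assms(2) unfolding has_cderivative_at_def by blast
  have "y \<in> V" if "y \<in> U" "vdist E y x < r" for y
  proof -
    have "x \<in> carrier E" using assms(3,4) E.openin_vtop [of V] by blast
    then have "y \<in> vball E x r" using that assms(5) E.vdist_commute [of y x] by auto
    then show ?thesis using r by blast
  qed
  then show "\<exists>\<delta>>0. \<forall>y\<in>U. vdist E y x < \<delta> \<longrightarrow>
        vnorm F ((f y \<ominus>\<^bsub>F\<^esub> f x) \<ominus>\<^bsub>F\<^esub> D (y \<ominus>\<^bsub>E\<^esub> x)) \<le> \<epsilon> * vdist E y x"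
    using d r by (intro exI [of _ "min \<delta> r"]) auto
qed

lemma cderivative_chain:
  assumes E: "complex_banach_space E" and F: "complex_banach_space F" and G: "complex_banach_space G"
    and f: "has_cderivative_at E F U f D x" and g: "has_cderivative_at F G V g D' (f x)"
    and x: "x \<in> U" and U: "U \<subseteq> carrier E" and V: "V \<subseteq> carrier F" and fU: "f ` U \<subseteq> V" and gV: "g ` V \<subseteq> carrier G"
  shows "has_cderivative_at E G U (g \<circ> f) (D' \<circ> D) x"
  unfolding has_cderivative_at_def
proof (intro conjI allI impI)
  interpret E: complex_banach_space E by fact
  interpret F: complex_banach_space F by fact
  interpret G: complex_banach_space G by fact
  have D: "bounded_clinear E F D" and D': "bounded_clinear F G D'"
    using f g by (auto simp: has_cderivative_at_def)
  note Ds = bounded_clinear_simps [OF E F D] and D's = bounded_clinear_simps [OF F G D']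
  obtain K where K: "K > 0" "\<And>x. x \<in> carrier E \<Longrightarrow> vnorm F (D x) \<le> K * vnorm E x"
    using bounded_clinear_bound [OF D] E.vnorm_nonneg by metis
  obtain K' where K': "K' > 0" "\<And>x. x \<in> carrier F \<Longrightarrow> vnorm G (D' x) \<le> K' * vnorm F x"
    using bounded_clinear_bound [OF D'] F.vnorm_nonneg by metis
  have bd: "vnorm G ((D' \<circ> D) x) \<le> (K' * K) * vnorm E x" if "x \<in> carrier E" for x
  proof -
    have "vnorm G ((D' \<circ> D) x) \<le> K' * vnorm F (D x)" using K' Ds that by simp
    also have "\<dots> \<le> K' * (K * vnorm E x)" using K K' that by simp
    finally show ?thesis by (simp add: mult.assoc)
  qed
  then show "bounded_clinear E G (D' \<circ> D)"
    unfolding bounded_clinear_def by (auto simp: Ds D's)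
  fix \<epsilon> :: real assume e: "\<epsilon> > 0"
  \<comment> \<open>Half of \<epsilon> goes to the remainder of g, scaled by the local Lipschitz
    constant K + 1 of f, and half to D' applied to the remainder of f. The bound e1 \<le> 1 is what
    makes K + 1 a Lipschitz constant.\<close>
  define e2 where "e2 = \<epsilon> / (2 * (K + 1))"
  define e1 where "e1 = min 1 (\<epsilon> / (2 * K'))"
  have e12: "e1 > 0" "e2 > 0" using e K K' by (auto simp: e1_def e2_def)
  obtain d1 where d1: "d1 > 0" "\<And>y. y \<in> U \<Longrightarrow> vdist E y x < d1 \<Longrightarrow>
        vnorm F ((f y \<ominus>\<^bsub>F\<^esub> f x) \<ominus>\<^bsub>F\<^esub> D (y \<ominus>\<^bsub>E\<^esub> x)) \<le> e1 * vdist E y x"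
    using f e12 unfolding has_cderivative_at_def by blast
  obtain d2 where d2: "d2 > 0" "\<And>y. y \<in> V \<Longrightarrow> vdist F y (f x) < d2 \<Longrightarrow>
        vnorm G ((g y \<ominus>\<^bsub>G\<^esub> g (f x)) \<ominus>\<^bsub>G\<^esub> D' (y \<ominus>\<^bsub>F\<^esub> f x)) \<le> e2 * vdist F y (f x)"
    using g e12 unfolding has_cderivative_at_def by blast
  show "\<exists>\<delta>>0. \<forall>y\<in>U. vdist E y x < \<delta> \<longrightarrow>
      vnorm G ((g \<circ> f) y \<ominus>\<^bsub>G\<^esub> (g \<circ> f) x \<ominus>\<^bsub>G\<^esub> (D' \<circ> D) (y \<ominus>\<^bsub>E\<^esub> x)) \<le> \<epsilon> * vdist E y x"
  proof (intro exI [of _ "min d1 (d2 / (K + 1))"] conjI ballI impI)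
    show "0 < min d1 (d2 / (K + 1))" using d1 d2 K by auto
    fix y assume y: "y \<in> U" and lt: "vdist E y x < min d1 (d2 / (K + 1))"
    have C: "x \<in> carrier E" "y \<in> carrier E" "f x \<in> carrier F" "f y \<in> carrier F" "g (f x) \<in> carrier G" "g (f y) \<in> carrier G"
      "f y \<in> V"
      using x y U V fU gV by (auto simp: image_subset_iff subset_iff)
    let ?u = "y \<ominus>\<^bsub>E\<^esub> x" and ?w = "f y \<ominus>\<^bsub>F\<^esub> f x"
    have nu: "vnorm E ?u = vdist E y x" using C by (simp add: E.vdist_eq)
    have r1: "vnorm F (?w \<ominus>\<^bsub>F\<^esub> D ?u) \<le> e1 * vdist E y x" using d1 y lt by simp
    have w_eq: "(?w \<ominus>\<^bsub>F\<^esub> D ?u) \<oplus>\<^bsub>F\<^esub> D ?u = ?w"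
      using C by (intro F.eq_dual) (auto simp: F.unit_dualD Ds)
    have "vnorm F ?w \<le> vnorm F (?w \<ominus>\<^bsub>F\<^esub> D ?u) + vnorm F (D ?u)"
      using F.vnorm_triangle [of "?w \<ominus>\<^bsub>F\<^esub> D ?u" "D ?u"] C unfolding w_eq by (simp add: Ds)
    also have "\<dots> \<le> 1 * vdist E y x + K * vdist E y x"
    proof (rule add_mono)
      have "e1 * vdist E y x \<le> 1 * vdist E y x" by (intro mult_right_mono) (auto simp: e1_def)
      with r1 show "vnorm F (?w \<ominus>\<^bsub>F\<^esub> D ?u) \<le> 1 * vdist E y x" by linarith
      show "vnorm F (D ?u) \<le> K * vdist E y x" using K C nu by (metis E.minus_closed)
    qed
    finally have w: "vdist F (f y) (f x) \<le> (K + 1) * vdist E y x"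
      using C by (simp add: F.vdist_eq algebra_simps)
    also have "\<dots> < d2" using lt K by (simp add: field_simps)
    finally have "vnorm G ((g (f y) \<ominus>\<^bsub>G\<^esub> g (f x)) \<ominus>\<^bsub>G\<^esub> D' ?w) \<le> e2 * vdist F (f y) (f x)"
      using d2 C by simp
    also have "\<dots> \<le> e2 * ((K + 1) * vdist E y x)" using w e12 by simp
    also have "\<dots> = \<epsilon> / 2 * vdist E y x" using K by (simp add: e2_def field_simps)
    finally have A: "vnorm G ((g (f y) \<ominus>\<^bsub>G\<^esub> g (f x)) \<ominus>\<^bsub>G\<^esub> D' ?w) \<le> \<epsilon> / 2 * vdist E y x" .
    have "vnorm G (D' (?w \<ominus>\<^bsub>F\<^esub> D ?u)) \<le> K' * vnorm F (?w \<ominus>\<^bsub>F\<^esub> D ?u)"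
      using K' C by (simp add: Ds)
    also have "\<dots> \<le> K' * (e1 * vdist E y x)" using r1 K' by simp
    also have "\<dots> \<le> K' * (\<epsilon> / (2 * K') * vdist E y x)"
      using K' by (intro mult_left_mono mult_right_mono) (auto simp: e1_def)
    also have "\<dots> = \<epsilon> / 2 * vdist E y x" using K' by (simp add: field_simps)
    finally have B: "vnorm G (D' (?w \<ominus>\<^bsub>F\<^esub> D ?u)) \<le> \<epsilon> / 2 * vdist E y x" .
    have tot: "((g (f y) \<ominus>\<^bsub>G\<^esub> g (f x)) \<ominus>\<^bsub>G\<^esub> D' ?w) \<oplus>\<^bsub>G\<^esub> D' (?w \<ominus>\<^bsub>F\<^esub> D ?u) =
      g (f y) \<ominus>\<^bsub>G\<^esub> g (f x) \<ominus>\<^bsub>G\<^esub> D' (D ?u)"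
      using C by (intro G.eq_dual) (auto simp: G.unit_dualD Ds D's)
    have "vnorm G (g (f y) \<ominus>\<^bsub>G\<^esub> g (f x) \<ominus>\<^bsub>G\<^esub> D' (D ?u)) \<le>
      vnorm G ((g (f y) \<ominus>\<^bsub>G\<^esub> g (f x)) \<ominus>\<^bsub>G\<^esub> D' ?w) + vnorm G (D' (?w \<ominus>\<^bsub>F\<^esub> D ?u))"
      unfolding tot [symmetric] using C by (intro G.vnorm_triangle) (auto simp: Ds D's)
    with A B show "vnorm G ((g \<circ> f) y \<ominus>\<^bsub>G\<^esub> (g \<circ> f) x \<ominus>\<^bsub>G\<^esub> (D' \<circ> D) (y \<ominus>\<^bsub>E\<^esub> x)) \<le> \<epsilon> * vdist E y x"
      by simp
  qed
qed

lemma cderivative_affine: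
  assumes E: "complex_banach_space E" and F: "complex_banach_space F"
    and D: "bounded_clinear E F D" and p: "p \<in> carrier F" and x: "x \<in> U" and U: "U \<subseteq> carrier E"
  shows "has_cderivative_at E F U (\<lambda>y. p \<oplus>\<^bsub>F\<^esub> D y) D x"
  unfolding has_cderivative_at_def
proof (intro conjI allI impI D)
  interpret E: complex_banach_space E by fact
  interpret F: complex_banach_space F by fact
  note Ds = bounded_clinear_simps [OF E F D]
  fix \<epsilon> :: real assume e: "\<epsilon> > 0"
  have "vnorm F ((p \<oplus>\<^bsub>F\<^esub> D y) \<ominus>\<^bsub>F\<^esub> (p \<oplus>\<^bsub>F\<^esub> D x) \<ominus>\<^bsub>F\<^esub> D (y \<ominus>\<^bsub>E\<^esub> x)) = 0" if y: "y \<in> U" for y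
  proof -
    have "y \<in> carrier E" "x \<in> carrier E" using x y U by auto
    then have "(p \<oplus>\<^bsub>F\<^esub> D y) \<ominus>\<^bsub>F\<^esub> (p \<oplus>\<^bsub>F\<^esub> D x) \<ominus>\<^bsub>F\<^esub> D (y \<ominus>\<^bsub>E\<^esub> x) = \<zero>\<^bsub>F\<^esub>"
      using p by (intro F.eq_dual) (auto simp: F.unit_dualD Ds)
    then show ?thesis by simp
  qed
  then show "\<exists>\<delta>>0. \<forall>y\<in>U. vdist E y x < \<delta> \<longrightarrow>
      vnorm F ((p \<oplus>\<^bsub>F\<^esub> D y) \<ominus>\<^bsub>F\<^esub> (p \<oplus>\<^bsub>F\<^esub> D x) \<ominus>\<^bsub>F\<^esub> D (y \<ominus>\<^bsub>E\<^esub> x)) \<le> \<epsilon> * vdist E y x"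
    using e by (intro exI [of _ 1]) auto
qed

subsection \<open>The complex line\<close>

lemma complex_space_simps [simp]:
  "carrier complex_space = UNIV" "a \<oplus>\<^bsub>complex_space\<^esub> b = a + b" "\<zero>\<^bsub>complex_space\<^esub> = 0"
  "c \<odot>\<^bsub>complex_space\<^esub> a = c * a" "vnorm complex_space a = cmod a"
  by (simp_all add: complex_space_def)

lemma abelian_group_complex_space: "abelian_group complex_space"
  by (rule abelian_groupI) (auto intro: exI [of _ "- x" for x])

lemma complex_space_minus [simp]: "a \<ominus>\<^bsub>complex_space\<^esub> b = a - b"
proof -
  have "\<ominus>\<^bsub>complex_space\<^esub> b = - b"
    by (rule abelian_group.minus_equality [OF abelian_group_complex_space]) auto
  then show ?thesis by (simp add: a_minus_def)
qed

lemma vdist_complex_space [simp]: "vdist complex_space = dist"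
  by (auto simp: vdist_def dist_norm fun_eq_iff)

lemma complex_banach_space_complex_space: "complex_banach_space complex_space"
proof (intro complex_banach_space.intro complex_banach_space_axioms.intro)
  show "module complex_ring complex_space"
    by (rule moduleI [OF cring_complex_ring abelian_group_complex_space]) (auto simp: algebra_simps)
  show "Metric_space.mcomplete (carrier complex_space) (vdist complex_space)"
    by (simp add: complete_UNIV mcomplete_iff_complete)
qed (auto simp: norm_triangle_ineq norm_mult)

interpretation complex_space: complex_banach_space complex_space
  by (rule complex_banach_space_complex_space)

lemma vtop_complex_space [simp]: "vtop complex_space = euclidean"
  by (simp add: vtop_def)

text \<open>The passage from Frechet derivatives to one-variable complex analysis, for which the
  scalar theorems are available.\<close>

lemma cderivative_line:
  assumes E: "complex_banach_space E" and U: "openin (vtop E) U" and p: "p \<in> carrier E" and v: "v \<in> carrier E"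
    and z: "p \<oplus>\<^bsub>E\<^esub> z \<odot>\<^bsub>E\<^esub> v \<in> U"
    and f: "has_cderivative_at E complex_space U f D (p \<oplus>\<^bsub>E\<^esub> z \<odot>\<^bsub>E\<^esub> v)"
  shows "((\<lambda>t. f (p \<oplus>\<^bsub>E\<^esub> t \<odot>\<^bsub>E\<^esub> v)) has_field_derivative D v) (at z)"
  unfolding has_field_derivative_def has_derivative_within_alt
proof (intro conjI allI impI)
  interpret E: complex_banach_space E by fact
  show "bounded_linear ((*) (D v))" by (rule bounded_linear_mult_right)
  let ?l = "\<lambda>t. p \<oplus>\<^bsub>E\<^esub> t \<odot>\<^bsub>E\<^esub> v"
  have D: "bounded_clinear E complex_space D" using f by (auto simp: has_cderivative_at_def)
  note Ds = bounded_clinear_simps [OF E complex_banach_space_complex_space D]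
  \<comment> \<open>The added 1 allows division also when v is zero.\<close>
  let ?n = "vnorm E v + 1"
  have n: "?n > 0" using E.vnorm_nonneg [OF v] by simp
  have dl: "vdist E (?l t) (?l z) \<le> norm (t - z) * ?n" for t
    using p v by (simp add: E.vdist_line algebra_simps)
  obtain r where r: "r > 0" "vball E (?l z) r \<subseteq> U" using U z E.openin_vtop by blast
  fix e :: real assume e: "e > 0"
  then obtain d where d: "d > 0" "\<And>y. y \<in> U \<Longrightarrow> vdist E y (?l z) < d \<Longrightarrow>
      norm (f y - f (?l z) - D (y \<ominus>\<^bsub>E\<^esub> ?l z)) \<le> e / ?n * vdist E y (?l z)"
    using f n unfolding has_cderivative_at_def by (auto dest: spec [of _ "e / ?n"])
  show "\<exists>d>0. \<forall>t\<in>UNIV. norm (t - z) < d \<longrightarrow> norm (f (?l t) - f (?l z) - D v * (t - z)) \<le> e * norm (t - z)"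
  proof (intro exI [of _ "min d r / ?n"] conjI ballI impI)
    show "min d r / ?n > 0" using d r n by auto
    fix t assume "norm (t - z) < min d r / ?n"
    then have "norm (t - z) * ?n < min d r" using n by (simp add: field_simps)
    with dl [of t] have lt: "vdist E (?l t) (?l z) < min d r" by linarith
    then have "?l t \<in> U" using r p v by (auto simp: E.vdist_commute)
    then have "norm (f (?l t) - f (?l z) - D (?l t \<ominus>\<^bsub>E\<^esub> ?l z)) \<le> e / ?n * vdist E (?l t) (?l z)"
      using d lt by auto
    also have "\<dots> \<le> e / ?n * (norm (t - z) * ?n)" using dl e n by (intro mult_left_mono) auto
    also have "\<dots> = e * norm (t - z)" using n by simp
    also have "?l t \<ominus>\<^bsub>E\<^esub> ?l z = (t - z) \<odot>\<^bsub>E\<^esub> v"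
      using p v by (intro E.eq_dual) (auto simp: E.unit_dualD algebra_simps)
    finally show "norm (f (?l t) - f (?l z) - D v * (t - z)) \<le> e * norm (t - z)"
      using v by (simp add: Ds mult.commute)
  qed
qed

lemma cderivative_of_field_derivative:
  assumes f: "(f has_field_derivative d) (at x)"
  shows "has_cderivative_at complex_space complex_space U f ((*) d) x"
proof -
  have "bounded_clinear complex_space complex_space ((*) d)"
    by (auto simp: bounded_clinear_def algebra_simps norm_mult intro!: exI [of _ "norm d"])
  then show ?thesis
    using f unfolding has_field_derivative_def has_derivative_within_alt has_cderivative_at_def
    by (simp add: dist_norm) blast
qed

lemma bounded_clinear_line:
  assumes E: "complex_banach_space E" and v: "v \<in> carrier E"
  shows "bounded_clinear complex_space E (\<lambda>t. t \<odot>\<^bsub>E\<^esub> v)"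
proof -
  interpret E: complex_banach_space E by fact
  show ?thesis
    using v by (auto simp: bounded_clinear_def E.smult_add_left E.smult_smult E.vnorm_smult mult.commute
        intro!: exI [of _ "vnorm E v"])
qed

subsection \<open>Products\<close>

lemma prod_space_simps [simp]:
  "carrier (prod_space E F) = carrier E \<times> carrier F"
  "(x, y) \<oplus>\<^bsub>prod_space E F\<^esub> (x', y') = (x \<oplus>\<^bsub>E\<^esub> x', y \<oplus>\<^bsub>F\<^esub> y')"
  "\<zero>\<^bsub>prod_space E F\<^esub> = (\<zero>\<^bsub>E\<^esub>, \<zero>\<^bsub>F\<^esub>)"
  "c \<odot>\<^bsub>prod_space E F\<^esub> (x, y) = (c \<odot>\<^bsub>E\<^esub> x, c \<odot>\<^bsub>F\<^esub> y)"
  "vnorm (prod_space E F) (x, y) = sqrt ((vnorm E x)\<^sup>2 + (vnorm F y)\<^sup>2)"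
  by (simp_all add: prod_space_def)

text \<open>Remainders of derivatives refer to the target only through its group structure and norm,
  so checking that the product is an abelian group suffices.\<close>

lemma prod_space_minus:
  assumes E: "complex_banach_space E" and F: "complex_banach_space F"
    and "x \<in> carrier E" "x' \<in> carrier E" "y \<in> carrier F" "y' \<in> carrier F"
  shows "(x, y) \<ominus>\<^bsub>prod_space E F\<^esub> (x', y') = (x \<ominus>\<^bsub>E\<^esub> x', y \<ominus>\<^bsub>F\<^esub> y')"
proof -
  interpret E: complex_banach_space E by fact
  interpret F: complex_banach_space F by fact
  have "abelian_group (prod_space E F)"
  proof (rule abelian_groupI)
    fix x assume "x \<in> carrier (prod_space E F)"
    then show "\<exists>y\<in>carrier (prod_space E F). y \<oplus>\<^bsub>prod_space E F\<^esub> x = \<zero>\<^bsub>prod_space E F\<^esub>"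
      by (intro bexI [of _ "(\<ominus>\<^bsub>E\<^esub> fst x, \<ominus>\<^bsub>F\<^esub> snd x)"]) (auto simp: E.l_neg F.l_neg)
  qed (auto simp: E.a_ac F.a_ac)
  then have "\<ominus>\<^bsub>prod_space E F\<^esub> (x', y') = (\<ominus>\<^bsub>E\<^esub> x', \<ominus>\<^bsub>F\<^esub> y')"
    using assms by (intro abelian_group.minus_equality) (auto simp: E.l_neg F.l_neg)
  then show ?thesis by (simp add: a_minus_def)
qed

text \<open>The product norm dominates each component norm and is at most their sum, so smallness of
  the remainder can be tested componentwise.\<close>

lemma cderivative_prod:
  assumes E: "complex_banach_space E" and F: "complex_banach_space F" and G: "complex_banach_space G"
    and f: "f ` U \<subseteq> carrier F" and g: "g ` U \<subseteq> carrier G" and x: "x \<in> U" and U: "U \<subseteq> carrier E"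
  shows "(\<exists>D. has_cderivative_at E (prod_space F G) U (\<lambda>y. (f y, g y)) D x) \<longleftrightarrow>
    (\<exists>D. has_cderivative_at E F U f D x) \<and> (\<exists>D. has_cderivative_at E G U g D x)" (is "?L \<longleftrightarrow> ?R")
proof -
  interpret E: complex_banach_space E by fact
  interpret F: complex_banach_space F by fact
  interpret G: complex_banach_space G by fact
  have rem: "(f y, g y) \<ominus>\<^bsub>prod_space F G\<^esub> (f x, g x) \<ominus>\<^bsub>prod_space F G\<^esub> (a, b) =
      (f y \<ominus>\<^bsub>F\<^esub> f x \<ominus>\<^bsub>F\<^esub> a, g y \<ominus>\<^bsub>G\<^esub> g x \<ominus>\<^bsub>G\<^esub> b)"
    if "y \<in> U" "a \<in> carrier F" "b \<in> carrier G" for y a b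
    using that f g x by (simp add: prod_space_minus [OF F G] image_subset_iff)
  have n1: "vnorm F a \<le> vnorm (prod_space F G) (a, b)" "vnorm G b \<le> vnorm (prod_space F G) (a, b)" for a b
    by (auto intro: real_le_rsqrt)
  have n2: "vnorm (prod_space F G) (a, b) \<le> vnorm F a + vnorm G b" if "a \<in> carrier F" "b \<in> carrier G" for a b
    using that by (simp add: F.vnorm_nonneg G.vnorm_nonneg sqrt_sum_squares_le_sum)
  have uE: "y \<ominus>\<^bsub>E\<^esub> x \<in> carrier E" if "y \<in> U" for y using that x U by auto
  show ?thesis
  proof
    assume ?L
    then obtain D where D: "has_cderivative_at E (prod_space F G) U (\<lambda>y. (f y, g y)) D x" ..
    define D1 where "D1 = fst \<circ> D"
    define D2 where "D2 = snd \<circ> D"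
    have Deq: "D h = (D1 h, D2 h)" for h by (simp add: D1_def D2_def)
    have bl: "bounded_clinear E (prod_space F G) D" using D by (simp add: has_cderivative_at_def)
    then obtain K where K: "\<And>x. x \<in> carrier E \<Longrightarrow> vnorm (prod_space F G) (D x) \<le> K * vnorm E x"
      unfolding bounded_clinear_def by blast
    have DC: "D1 h \<in> carrier F" "D2 h \<in> carrier G" if "h \<in> carrier E" for h
      using bl that Deq [of h] unfolding bounded_clinear_def by (auto simp: Pi_iff)
    have DK: "vnorm F (D1 h) \<le> K * vnorm E h" "vnorm G (D2 h) \<le> K * vnorm E h" if "h \<in> carrier E" for h
      using K [OF that] n1 [where a = "D1 h" and b = "D2 h"] unfolding Deq [symmetric] by auto
    have DA: "(D1 (h \<oplus>\<^bsub>E\<^esub> k), D2 (h \<oplus>\<^bsub>E\<^esub> k)) = (D1 h \<oplus>\<^bsub>F\<^esub> D1 k, D2 h \<oplus>\<^bsub>G\<^esub> D2 k)"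
      if "h \<in> carrier E" "k \<in> carrier E" for h k
      using bl that unfolding bounded_clinear_def by (simp flip: Deq prod_space_simps(2))
    have DS: "(D1 (c \<odot>\<^bsub>E\<^esub> h), D2 (c \<odot>\<^bsub>E\<^esub> h)) = (c \<odot>\<^bsub>F\<^esub> D1 h, c \<odot>\<^bsub>G\<^esub> D2 h)"
      if "h \<in> carrier E" for c h
      using bl that unfolding bounded_clinear_def by (simp flip: Deq prod_space_simps(4))
    have "bounded_clinear E F D1" "bounded_clinear E G D2"
      unfolding bounded_clinear_def using DC DK DA DS by (auto intro!: exI [of _ K])
    moreover have "\<exists>\<delta>>0. \<forall>y\<in>U. vdist E y x < \<delta> \<longrightarrow>
        vnorm F (f y \<ominus>\<^bsub>F\<^esub> f x \<ominus>\<^bsub>F\<^esub> D1 (y \<ominus>\<^bsub>E\<^esub> x)) \<le> \<epsilon> * vdist E y x \<and>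
        vnorm G (g y \<ominus>\<^bsub>G\<^esub> g x \<ominus>\<^bsub>G\<^esub> D2 (y \<ominus>\<^bsub>E\<^esub> x)) \<le> \<epsilon> * vdist E y x" if e: "\<epsilon> > 0" for \<epsilon>
    proof -
      obtain \<delta> where d: "\<delta> > 0" "\<And>y. y \<in> U \<Longrightarrow> vdist E y x < \<delta> \<Longrightarrow>
         vnorm (prod_space F G) ((f y, g y) \<ominus>\<^bsub>prod_space F G\<^esub> (f x, g x) \<ominus>\<^bsub>prod_space F G\<^esub> D (y \<ominus>\<^bsub>E\<^esub> x)) \<le> \<epsilon> * vdist E y x"
        using D [unfolded has_cderivative_at_def, THEN conjunct2, THEN spec, THEN mp, OF e] by auto
      show ?thesis
      proof (intro exI [of _ \<delta>] conjI ballI impI)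
        fix y assume y: "y \<in> U" "vdist E y x < \<delta>"
        have "vnorm (prod_space F G) (f y \<ominus>\<^bsub>F\<^esub> f x \<ominus>\<^bsub>F\<^esub> D1 (y \<ominus>\<^bsub>E\<^esub> x), g y \<ominus>\<^bsub>G\<^esub> g x \<ominus>\<^bsub>G\<^esub> D2 (y \<ominus>\<^bsub>E\<^esub> x)) \<le> \<epsilon> * vdist E y x"
          using d(2) [OF y] unfolding Deq rem [OF y(1) DC(1) DC(2), OF uE uE, OF y(1) y(1)] .
        then show "vnorm F (f y \<ominus>\<^bsub>F\<^esub> f x \<ominus>\<^bsub>F\<^esub> D1 (y \<ominus>\<^bsub>E\<^esub> x)) \<le> \<epsilon> * vdist E y x"
          "vnorm G (g y \<ominus>\<^bsub>G\<^esub> g x \<ominus>\<^bsub>G\<^esub> D2 (y \<ominus>\<^bsub>E\<^esub> x)) \<le> \<epsilon> * vdist E y x"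
          by (rule order_trans [OF n1(1)], rule order_trans [OF n1(2)])
      qed (use d in auto)
    qed
    ultimately have "has_cderivative_at E F U f D1 x \<and> has_cderivative_at E G U g D2 x"
      unfolding has_cderivative_at_def by (simp add: all_conj_distrib) blast
    then show ?R by blast
  next
    assume ?R
    then obtain D1 D2 where D1: "has_cderivative_at E F U f D1 x" and D2: "has_cderivative_at E G U g D2 x" by blast
    have bl: "bounded_clinear E F D1" "bounded_clinear E G D2"
      using D1 D2 by (auto simp: has_cderivative_at_def)
    obtain K1 where K1: "\<And>x. x \<in> carrier E \<Longrightarrow> vnorm F (D1 x) \<le> K1 * vnorm E x"
      using bl unfolding bounded_clinear_def by blast
    obtain K2 where K2: "\<And>x. x \<in> carrier E \<Longrightarrow> vnorm G (D2 x) \<le> K2 * vnorm E x"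
      using bl unfolding bounded_clinear_def by blast
    have DC: "D1 h \<in> carrier F" "D2 h \<in> carrier G" if "h \<in> carrier E" for h
      using bl that by (auto simp: bounded_clinear_def)
    have "vnorm (prod_space F G) (D1 h, D2 h) \<le> (K1 + K2) * vnorm E h" if h: "h \<in> carrier E" for h
      using n2 [OF DC [OF h]] K1 [OF h] K2 [OF h] by (simp add: algebra_simps)
    then have "bounded_clinear E (prod_space F G) (\<lambda>h. (D1 h, D2 h))"
      using bl unfolding bounded_clinear_def by (auto simp del: prod_space_simps(5))
    moreover have "\<exists>\<delta>>0. \<forall>y\<in>U. vdist E y x < \<delta> \<longrightarrow>
        vnorm (prod_space F G) ((f y, g y) \<ominus>\<^bsub>prod_space F G\<^esub> (f x, g x) \<ominus>\<^bsub>prod_space F G\<^esub> (D1 (y \<ominus>\<^bsub>E\<^esub> x), D2 (y \<ominus>\<^bsub>E\<^esub> x)))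
          \<le> \<epsilon> * vdist E y x" if e: "\<epsilon> > 0" for \<epsilon>
    proof -
      obtain d1 where d1: "d1 > 0" "\<And>y. y \<in> U \<Longrightarrow> vdist E y x < d1 \<Longrightarrow>
         vnorm F (f y \<ominus>\<^bsub>F\<^esub> f x \<ominus>\<^bsub>F\<^esub> D1 (y \<ominus>\<^bsub>E\<^esub> x)) \<le> \<epsilon> / 2 * vdist E y x"
        using D1 [unfolded has_cderivative_at_def, THEN conjunct2, THEN spec, THEN mp, of "\<epsilon> / 2"] e by auto
      obtain d2 where d2: "d2 > 0" "\<And>y. y \<in> U \<Longrightarrow> vdist E y x < d2 \<Longrightarrow>
         vnorm G (g y \<ominus>\<^bsub>G\<^esub> g x \<ominus>\<^bsub>G\<^esub> D2 (y \<ominus>\<^bsub>E\<^esub> x)) \<le> \<epsilon> / 2 * vdist E y x"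
        using D2 [unfolded has_cderivative_at_def, THEN conjunct2, THEN spec, THEN mp, of "\<epsilon> / 2"] e by auto
      show ?thesis
      proof (intro exI [of _ "min d1 d2"] conjI ballI impI)
        fix y assume y: "y \<in> U" and lt: "vdist E y x < min d1 d2"
        let ?a = "f y \<ominus>\<^bsub>F\<^esub> f x \<ominus>\<^bsub>F\<^esub> D1 (y \<ominus>\<^bsub>E\<^esub> x)" and ?b = "g y \<ominus>\<^bsub>G\<^esub> g x \<ominus>\<^bsub>G\<^esub> D2 (y \<ominus>\<^bsub>E\<^esub> x)"
        have "vnorm (prod_space F G) (?a, ?b) \<le> vnorm F ?a + vnorm G ?b"
          using f g x y by (intro n2) (auto simp: DC uE image_subset_iff)
        then show "vnorm (prod_space F G) ((f y, g y) \<ominus>\<^bsub>prod_space F G\<^esub> (f x, g x) \<ominus>\<^bsub>prod_space F G\<^esub> (D1 (y \<ominus>\<^bsub>E\<^esub> x), D2 (y \<ominus>\<^bsub>E\<^esub> x)))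
          \<le> \<epsilon> * vdist E y x"
          using d1(2) [OF y] d2(2) [OF y] lt by (simp add: rem y DC uE del: prod_space_simps(5))
      qed (use d1 d2 in auto)
    qed
    ultimately show ?L unfolding has_cderivative_at_def by (intro exI [of _ "\<lambda>h. (D1 h, D2 h)"]) simp
  qed
qed

section \<open>Charts and holomorphic maps\<close>

text \<open>Open subsets of a manifold need not be connected, so connectedness is dropped here.\<close>

locale atlas_manifold =
  fixes M :: "('p, 'v) banach_mfd"
  assumes covering: "points M = (\<Union>c\<in>atlas M. cdom c)"
    and model: "c \<in> atlas M \<Longrightarrow> complex_banach_space (cmodel c)"
    and open_cdom: "c \<in> atlas M \<Longrightarrow> openin (mtop M) (cdom c)"
    and open_range: "c \<in> atlas M \<Longrightarrow> openin (vtop (cmodel c)) (cmap c ` cdom c)"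
    and chart_homeomorphic: "c \<in> atlas M \<Longrightarrow>
      homeomorphic_map (subtopology (mtop M) (cdom c))
        (subtopology (vtop (cmodel c)) (cmap c ` cdom c)) (cmap c)"
    and transition: "c \<in> atlas M \<Longrightarrow> d \<in> atlas M \<Longrightarrow>
      vholomorphic_on (cmodel c) (cmodel d) (cmap c ` (cdom c \<inter> cdom d)) (cmap d \<circ> cinv c)"

lemma (in banach_manifold) atlas_manifold: "atlas_manifold M"
  by (rule atlas_manifold.intro) (fact covering model open_cdom open_range chart_homeomorphic transition)+

context atlas_manifold
begin

lemma cdom_subset: "c \<in> atlas M \<Longrightarrow> cdom c \<subseteq> points M"
  using open_cdom openin_subset by blast

lemma inj_cmap: assumes "c \<in> atlas M" shows "inj_on (cmap c) (cdom c)"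
  using homeomorphic_imp_injective_map [OF chart_homeomorphic [OF assms]] cdom_subset [OF assms]
  by (simp add: inf.absorb2)

lemma cmap_carrier: assumes "c \<in> atlas M" shows "cmap c ` cdom c \<subseteq> carrier (cmodel c)"
  using openin_subset [OF open_range [OF assms]] complex_banach_space.topspace_vtop [OF model [OF assms]] by simp

lemma cmap_in_carrier: "c \<in> atlas M \<Longrightarrow> x \<in> cdom c \<Longrightarrow> cmap c x \<in> carrier (cmodel c)"
  using cmap_carrier by blast

lemma cinv_cmap: "c \<in> atlas M \<Longrightarrow> x \<in> cdom c \<Longrightarrow> cinv c (cmap c x) = x"
  using inj_cmap by simp

lemma openin_cmap_image:
  assumes c: "c \<in> atlas M" and W: "openin (mtop M) W"
  shows "openin (vtop (cmodel c)) (cmap c ` (cdom c \<inter> W))"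
proof -
  have "openin (subtopology (mtop M) (cdom c)) (cdom c \<inter> W)"
    using W by (simp add: openin_subtopology_Int2)
  then have "openin (subtopology (vtop (cmodel c)) (cmap c ` cdom c)) (cmap c ` (cdom c \<inter> W))"
    using homeomorphic_imp_open_map [OF chart_homeomorphic [OF c]] unfolding open_map_def by blast
  then show ?thesis
    using openin_trans_full open_range [OF c] by blast
qed

lemma openin_cmap_vimage:
  assumes c: "c \<in> atlas M" and V: "openin (vtop (cmodel c)) V"
  shows "openin (mtop M) {x \<in> cdom c. cmap c x \<in> V}"
proof -
  have "continuous_map (subtopology (mtop M) (cdom c)) (vtop (cmodel c)) (cmap c)"
    using homeomorphic_imp_continuous_map [OF chart_homeomorphic [OF c]] continuous_map_in_subtopology by blast
  then have "openin (subtopology (mtop M) (cdom c)) {x \<in> topspace (subtopology (mtop M) (cdom c)). cmap c x \<in> V}"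
    using V openin_continuous_map_preimage by blast
  moreover have "topspace (subtopology (mtop M) (cdom c)) = cdom c"
    using cdom_subset [OF c] by auto
  ultimately show ?thesis using openin_trans_full open_cdom [OF c] by metis
qed

lemma continuous_map_cinv:
  assumes c: "c \<in> atlas M"
  shows "continuous_map (subtopology (vtop (cmodel c)) (cmap c ` cdom c)) (mtop M) (cinv c)"
  unfolding continuous_map_def
proof (intro conjI allI impI)
  let ?S = "subtopology (vtop (cmodel c)) (cmap c ` cdom c)"
  have tS: "topspace ?S = cmap c ` cdom c"
    using openin_subset [OF open_range [OF c]] by auto
  show "cinv c \<in> topspace ?S \<rightarrow> points M"
    unfolding tS using cinv_cmap [OF c] cdom_subset [OF c] by auto
  fix W assume W: "openin (mtop M) W"
  have "{x \<in> topspace ?S. cinv c x \<in> W} = cmap c ` (cdom c \<inter> W)"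
    unfolding tS using cinv_cmap [OF c] by auto
  then show "openin ?S {x \<in> topspace ?S. cinv c x \<in> W}"
    using openin_cmap_image [OF c W] openin_open_subtopology [OF open_range [OF c]] by (simp add: image_mono)
qed

section \<open>Chart balls as a neighbourhood base\<close>

definition chart_ball :: "('p, 'v) chart \<Rightarrow> 'p \<Rightarrow> real \<Rightarrow> 'p set" where
  "chart_ball c x r = {y \<in> cdom c. cmap c y \<in> vball (cmodel c) (cmap c x) r}"

lemma openin_chart_ball: "c \<in> atlas M \<Longrightarrow> openin (mtop M) (chart_ball c x r)"
  unfolding chart_ball_def
  by (intro openin_cmap_vimage complex_banach_space.openin_vball model)

lemma chart_ball_self: "c \<in> atlas M \<Longrightarrow> x \<in> cdom c \<Longrightarrow> r > 0 \<Longrightarrow> x \<in> chart_ball c x r"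
  using cmap_in_carrier model
  by (simp add: chart_ball_def complex_banach_space.in_vball complex_banach_space.vdist_self)

lemma chart_ball_mono:
  assumes c: "c \<in> atlas M" and rs: "r \<le> s" shows "chart_ball c x r \<subseteq> chart_ball c x s"
  using rs by (auto simp: chart_ball_def complex_banach_space.in_vball [OF model [OF c]])

lemma chart_ball_small:
  assumes c: "c \<in> atlas M" and x: "x \<in> cdom c" and W: "openin (mtop M) W" "x \<in> W"
  obtains r where "r > 0" "vball (cmodel c) (cmap c x) r \<subseteq> cmap c ` (cdom c \<inter> W)" "chart_ball c x r \<subseteq> W"
proof -
  have "cmap c x \<in> cmap c ` (cdom c \<inter> W)" using x W by blast
  then obtain r where r: "r > 0" "vball (cmodel c) (cmap c x) r \<subseteq> cmap c ` (cdom c \<inter> W)"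
    using openin_cmap_image [OF c W(1)] complex_banach_space.openin_vtop [OF model [OF c]] by meson
  have "y \<in> W" if "y \<in> chart_ball c x r" for y
    using that r inj_cmap [OF c] by (auto simp: chart_ball_def subset_iff inj_on_def image_iff; blast)
  then show ?thesis using r that by blast
qed

end

text \<open>Chart balls of radius 1/(n + 1) make a manifold first countable, so topological failures
  can be witnessed by sequences.\<close>

lemma (in atlas_manifold) sequence_at:
  assumes x: "x \<in> points M" and P: "\<And>U n. openin (mtop M) U \<Longrightarrow> x \<in> U \<Longrightarrow> \<exists>y\<in>U. P n y"
  obtains s where "\<And>n::nat. P n (s n)" "limitin (mtop M) s x sequentially"
proof -
  obtain c where c: "c \<in> atlas M" "x \<in> cdom c" using x covering by auto
  define B where "B n = chart_ball c x (1 / (real n + 1))" for n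
  have "\<exists>y\<in>B n. P n y" for n
    unfolding B_def by (rule P [OF openin_chart_ball [OF c(1)] chart_ball_self [OF c]]) simp
  then obtain s where s: "\<And>n. s n \<in> B n" "\<And>n. P n (s n)" by metis
  have "limitin (mtop M) s x sequentially"
    unfolding limitin_def
  proof (intro conjI allI impI x)
    fix U assume U: "openin (mtop M) U \<and> x \<in> U"
    then obtain r where r: "r > 0" "chart_ball c x r \<subseteq> U" using chart_ball_small [OF c] by metis
    have lim: "(\<lambda>n. 1 / (real n + 1)) \<longlonglongrightarrow> 0" by real_asymp
    have "\<forall>\<^sub>F n in sequentially. 1 / (real n + 1) < r" by (rule order_tendstoD(2) [OF lim r(1)])
    then show "\<forall>\<^sub>F n in sequentially. s n \<in> U"
    proof eventually_elim
      case (elim n)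
      then have "B n \<subseteq> chart_ball c x r" unfolding B_def by (intro chart_ball_mono [OF c(1)]) simp
      then show ?case using s(1) [of n] r(2) by blast
    qed
  qed
  then show ?thesis using that s(2) by blast
qed

text \<open>What \<open>mholomorphic_iff\<close> asks of a target. Products and Hartogs domains
  occur only as targets, so this replaces a proof that they are manifolds.\<close>

locale chart_target =
  fixes N :: "('p, 'v) banach_mfd"
  assumes open_cdom: "d \<in> atlas N \<Longrightarrow> openin (mtop N) (cdom d)"
    and cmap_carrier: "d \<in> atlas N \<Longrightarrow> cmap d ` cdom d \<subseteq> carrier (cmodel d)"

lemma (in atlas_manifold) chart_target: "chart_target M"
  by (rule chart_target.intro) (fact open_cdom cmap_carrier)+

section \<open>Pointwise differentiability in charts\<close>

definition mdiff :: "('p, 'v) banach_mfd \<Rightarrow> ('q, 'w) banach_mfd \<Rightarrow> ('p \<Rightarrow> 'q) \<Rightarrow> 'p \<Rightarrow> bool" where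
  "mdiff M N f x \<longleftrightarrow> (\<forall>c\<in>atlas M. \<forall>d\<in>atlas N. x \<in> cdom c \<longrightarrow> f x \<in> cdom d \<longrightarrow>
     (\<exists>V D. openin (vtop (cmodel c)) V \<and> cmap c x \<in> V \<and> V \<subseteq> cmap c ` (cdom c \<inter> f -` cdom d) \<and>
        has_cderivative_at (cmodel c) (cmodel d) V (cmap d \<circ> f \<circ> cinv c) D (cmap c x)))"

lemma mdiffE:
  assumes "mdiff M N f x" "c \<in> atlas M" "d \<in> atlas N" "x \<in> cdom c" "f x \<in> cdom d"
  obtains V D where "openin (vtop (cmodel c)) V" "cmap c x \<in> V" "V \<subseteq> cmap c ` (cdom c \<inter> f -` cdom d)"
    "has_cderivative_at (cmodel c) (cmodel d) V (cmap d \<circ> f \<circ> cinv c) D (cmap c x)"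
proof -
  have "\<exists>V D. openin (vtop (cmodel c)) V \<and> cmap c x \<in> V \<and> V \<subseteq> cmap c ` (cdom c \<inter> f -` cdom d) \<and>
      has_cderivative_at (cmodel c) (cmodel d) V (cmap d \<circ> f \<circ> cinv c) D (cmap c x)"
    using assms(1) [unfolded mdiff_def, THEN bspec, OF assms(2), THEN bspec, OF assms(3), THEN mp, OF assms(4), THEN mp, OF assms(5)] .
  then show ?thesis using that by (elim exE conjE)
qed

lemma mdiff_cong:
  assumes M: "atlas_manifold M" and f: "mdiff M N f x" and W: "openin (mtop M) W" "x \<in> W"
    and eq: "\<And>y. y \<in> W \<Longrightarrow> f y = g y"
  shows "mdiff M N g x"
  unfolding mdiff_def
proof (intro ballI impI)
  interpret M: atlas_manifold M by fact
  fix c d assume c: "c \<in> atlas M" and d: "d \<in> atlas N" and x: "x \<in> cdom c" "g x \<in> cdom d"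
  then obtain V D where V: "openin (vtop (cmodel c)) V" "cmap c x \<in> V" "V \<subseteq> cmap c ` (cdom c \<inter> f -` cdom d)"
    "has_cderivative_at (cmodel c) (cmodel d) V (cmap d \<circ> f \<circ> cinv c) D (cmap c x)"
    using mdiffE [OF f c d] W eq by metis
  let ?V = "V \<inter> cmap c ` (cdom c \<inter> W)"
  have "openin (vtop (cmodel c)) ?V" using V M.openin_cmap_image [OF c W(1)] by blast
  moreover have "cmap c x \<in> ?V" using V x W by blast
  moreover have "?V \<subseteq> cmap c ` (cdom c \<inter> g -` cdom d)"
  proof
    fix y assume "y \<in> ?V"
    then obtain p q where "p \<in> cdom c" "f p \<in> cdom d" "y = cmap c p" "q \<in> cdom c" "q \<in> W" "y = cmap c q"
      using V by blast
    then have "y = cmap c p" "p \<in> cdom c" "g p \<in> cdom d"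
      using M.inj_cmap [OF c] eq by (auto simp: inj_on_def)
    then show "y \<in> cmap c ` (cdom c \<inter> g -` cdom d)" by blast
  qed
  moreover have "has_cderivative_at (cmodel c) (cmodel d) ?V (cmap d \<circ> g \<circ> cinv c) D (cmap c x)"
    by (rule cderivative_cong [OF cderivative_subset [OF V(4)]])
      (use \<open>cmap c x \<in> ?V\<close> eq M.cinv_cmap [OF c] in auto)
  ultimately show "\<exists>V D. openin (vtop (cmodel c)) V \<and> cmap c x \<in> V \<and> V \<subseteq> cmap c ` (cdom c \<inter> g -` cdom d) \<and>
        has_cderivative_at (cmodel c) (cmodel d) V (cmap d \<circ> g \<circ> cinv c) D (cmap c x)" by blast
qed

text \<open>Continuity alone makes the domain of each chart expression open; what then remains of
  holomorphy is a condition at single points, which restricts and composes easily.\<close>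

lemma mholomorphic_iff:
  assumes M: "atlas_manifold M" and N: "chart_target N"
  shows "mholomorphic M N f \<longleftrightarrow> continuous_map (mtop M) (mtop N) f \<and> (\<forall>x\<in>points M. mdiff M N f x)"
proof -
  interpret M: atlas_manifold M by fact
  interpret N: chart_target N by fact
  have "(\<forall>c\<in>atlas M. \<forall>d\<in>atlas N.
        vholomorphic_on (cmodel c) (cmodel d) (cmap c ` (cdom c \<inter> f -` cdom d)) (cmap d \<circ> f \<circ> cinv c)) \<longleftrightarrow>
      (\<forall>x\<in>points M. mdiff M N f x)" (is "?L \<longleftrightarrow> ?R") if cont: "continuous_map (mtop M) (mtop N) f"
  proof
    assume L: ?L
    show ?R unfolding mdiff_def
    proof (intro ballI impI)
      fix x c d assume c: "c \<in> atlas M" and d: "d \<in> atlas N" and x: "x \<in> cdom c" "f x \<in> cdom d"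
      let ?V = "cmap c ` (cdom c \<inter> f -` cdom d)"
      have "vholomorphic_on (cmodel c) (cmodel d) ?V (cmap d \<circ> f \<circ> cinv c)"
        using L c d by blast
      moreover have "cmap c x \<in> ?V" using x by blast
      ultimately show "\<exists>V D. openin (vtop (cmodel c)) V \<and> cmap c x \<in> V \<and> V \<subseteq> ?V \<and>
        has_cderivative_at (cmodel c) (cmodel d) V (cmap d \<circ> f \<circ> cinv c) D (cmap c x)"
        unfolding vholomorphic_on_def by blast
    qed
  next
    assume R: ?R
    show ?L
    proof (intro ballI)
      fix c d assume c: "c \<in> atlas M" and d: "d \<in> atlas N"
      let ?V = "cmap c ` (cdom c \<inter> f -` cdom d)"
      have "cdom c \<inter> f -` cdom d = cdom c \<inter> {x \<in> points M. f x \<in> cdom d}"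
        using M.cdom_subset [OF c] by auto
      moreover have "openin (mtop M) {x \<in> points M. f x \<in> cdom d}"
        using cont N.open_cdom [OF d] by (rule openin_continuous_map_preimage)
      ultimately have V: "openin (vtop (cmodel c)) ?V" using M.openin_cmap_image [OF c] by metis
      show "vholomorphic_on (cmodel c) (cmodel d) ?V (cmap d \<circ> f \<circ> cinv c)"
        unfolding vholomorphic_on_def
      proof (intro conjI ballI V)
        show "cmap d \<circ> f \<circ> cinv c \<in> ?V \<rightarrow> carrier (cmodel d)"
          using N.cmap_carrier [OF d] M.cinv_cmap [OF c] by auto
        fix y assume "y \<in> ?V"
        then obtain x where x: "x \<in> cdom c" "f x \<in> cdom d" "y = cmap c x" by auto
        then have "x \<in> points M" using M.cdom_subset [OF c] by blast
        then obtain W D where W: "openin (vtop (cmodel c)) W" "cmap c x \<in> W" "W \<subseteq> ?V"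
            "has_cderivative_at (cmodel c) (cmodel d) W (cmap d \<circ> f \<circ> cinv c) D (cmap c x)"
          using mdiffE [OF R [rule_format, OF \<open>x \<in> points M\<close>] c d x(1,2)] by metis
        have "has_cderivative_at (cmodel c) (cmodel d) ?V (cmap d \<circ> f \<circ> cinv c) D (cmap c x)"
          by (rule cderivative_local [OF M.model [OF c] W(4,1,2)]) (use M.cmap_carrier [OF c] in blast)
        then show "\<exists>D. has_cderivative_at (cmodel c) (cmodel d) ?V (cmap d \<circ> f \<circ> cinv c) D y"
          using x by blast
      qed
    qed
  qed
  then show ?thesis unfolding mholomorphic_def by blast
qed

lemma mdiff_comp:
  assumes M: "atlas_manifold M" and N: "atlas_manifold N" and P: "atlas_manifold P"
    and cont: "continuous_map (mtop M) (mtop N) f"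
    and f: "mdiff M N f x" and g: "mdiff N P g (f x)" and x: "x \<in> points M"
  shows "mdiff M P (g \<circ> f) x"
  unfolding mdiff_def
proof (intro ballI impI)
  interpret M: atlas_manifold M by fact
  interpret N: atlas_manifold N by fact
  interpret P: atlas_manifold P by fact
  fix c e assume c: "c \<in> atlas M" and e: "e \<in> atlas P" and xc: "x \<in> cdom c" and gfx: "(g \<circ> f) x \<in> cdom e"
  have "f x \<in> points N" using cont x by (auto simp: continuous_map_def)
  then obtain d where d: "d \<in> atlas N" "f x \<in> cdom d" using N.covering by auto
  obtain V1 D1 where V1: "openin (vtop (cmodel c)) V1" "cmap c x \<in> V1" "V1 \<subseteq> cmap c ` (cdom c \<inter> f -` cdom d)"
    "has_cderivative_at (cmodel c) (cmodel d) V1 (cmap d \<circ> f \<circ> cinv c) D1 (cmap c x)"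
    using mdiffE [OF f c d(1) xc d(2)] by metis
  obtain V2 D2 where V2: "openin (vtop (cmodel d)) V2" "cmap d (f x) \<in> V2" "V2 \<subseteq> cmap d ` (cdom d \<inter> g -` cdom e)"
    "has_cderivative_at (cmodel d) (cmodel e) V2 (cmap e \<circ> g \<circ> cinv d) D2 (cmap d (f x))"
    using mdiffE [OF g d(1) e d(2)] gfx by (metis comp_apply)
  \<comment> \<open>Shrinking the source to W makes the chart expression of f land in V2, where the
    derivative of g is available.\<close>
  define W where "W = {y \<in> points M. f y \<in> {z \<in> cdom d. cmap d z \<in> V2}}"
  have W: "openin (mtop M) W"
    unfolding W_def by (rule openin_continuous_map_preimage [OF cont N.openin_cmap_vimage [OF d(1) V2(1)]])
  let ?V = "V1 \<inter> cmap c ` (cdom c \<inter> W)"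
  have oV: "openin (vtop (cmodel c)) ?V" using V1 M.openin_cmap_image [OF c W] by blast
  have xV: "cmap c x \<in> ?V" using V1 V2 xc x d by (auto simp: W_def)
  have Wd: "g (f y) \<in> cdom e \<and> f y \<in> cdom d \<and> cmap d (f y) \<in> V2" if "y \<in> W" for y
  proof -
    have y: "f y \<in> cdom d" "cmap d (f y) \<in> V2" using that by (auto simp: W_def)
    then obtain z where "z \<in> cdom d" "g z \<in> cdom e" "cmap d (f y) = cmap d z" using V2 by blast
    then show ?thesis using y N.inj_cmap [OF d(1)] by (metis inj_onD)
  qed
  have sub: "?V \<subseteq> cmap c ` (cdom c \<inter> (g \<circ> f) -` cdom e)" using Wd by auto
  have D1: "has_cderivative_at (cmodel c) (cmodel d) ?V (cmap d \<circ> f \<circ> cinv c) D1 (cmap c x)"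
    by (rule cderivative_subset [OF V1(4)]) blast
  have D2: "has_cderivative_at (cmodel d) (cmodel e) V2 (cmap e \<circ> g \<circ> cinv d) D2 ((cmap d \<circ> f \<circ> cinv c) (cmap c x))"
    using V2 M.cinv_cmap [OF c xc] by simp
  have "has_cderivative_at (cmodel c) (cmodel e) ?V ((cmap e \<circ> g \<circ> cinv d) \<circ> (cmap d \<circ> f \<circ> cinv c)) (D2 \<circ> D1) (cmap c x)"
  proof (rule cderivative_chain [OF M.model [OF c] N.model [OF d(1)] P.model [OF e] D1 D2 xV])
    show "?V \<subseteq> carrier (cmodel c)" using M.cmap_carrier [OF c] by blast
    show "V2 \<subseteq> carrier (cmodel d)" using N.cmap_carrier [OF d(1)] V2 by blast
    show "(cmap d \<circ> f \<circ> cinv c) ` ?V \<subseteq> V2" using Wd M.cinv_cmap [OF c] by auto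
    show "(cmap e \<circ> g \<circ> cinv d) ` V2 \<subseteq> carrier (cmodel e)"
    proof
      fix y assume "y \<in> (cmap e \<circ> g \<circ> cinv d) ` V2"
      then obtain z where "z \<in> cdom d" "g z \<in> cdom e" "y = cmap e (g (cinv d (cmap d z)))" using V2(3) by auto
      then show "y \<in> carrier (cmodel e)" using P.cmap_carrier [OF e] N.cinv_cmap [OF d(1)] by auto
    qed
  qed
  then have "has_cderivative_at (cmodel c) (cmodel e) ?V (cmap e \<circ> (g \<circ> f) \<circ> cinv c) (D2 \<circ> D1) (cmap c x)"
    by (rule cderivative_cong [OF _ xV]) (use Wd M.cinv_cmap [OF c] N.cinv_cmap [OF d(1)] in auto)
  with oV xV sub show "\<exists>V D. openin (vtop (cmodel c)) V \<and> cmap c x \<in> V \<and> V \<subseteq> cmap c ` (cdom c \<inter> (g \<circ> f) -` cdom e) \<and>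
        has_cderivative_at (cmodel c) (cmodel e) V (cmap e \<circ> (g \<circ> f) \<circ> cinv c) D (cmap c x)" by blast
qed

lemma mholomorphic_comp:
  assumes M: "atlas_manifold M" and N: "atlas_manifold N" and P: "atlas_manifold P"
    and f: "mholomorphic M N f" and g: "mholomorphic N P g"
  shows "mholomorphic M P (g \<circ> f)"
proof -
  note iffs = mholomorphic_iff [OF M atlas_manifold.chart_target [OF N]] mholomorphic_iff [OF N atlas_manifold.chart_target [OF P]]
    mholomorphic_iff [OF M atlas_manifold.chart_target [OF P]]
  have cont: "continuous_map (mtop M) (mtop N) f" using f iffs by blast
  then have "f x \<in> points N" if "x \<in> points M" for x using that by (auto simp: continuous_map_def)
  then show ?thesis
    using f g mdiff_comp [OF M N P cont] unfolding iffs by (auto intro: continuous_map_compose)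
qed

subsection \<open>Open submanifolds\<close>

lemma open_submfd_simps [simp]:
  "mtop (open_submfd M U) = subtopology (mtop M) U"
  "atlas (open_submfd M U) = (\<lambda>c. c\<lparr>cdom := cdom c \<inter> U\<rparr>) ` atlas M"
  by (simp_all add: open_submfd_def)

lemma open_submfd_open_submfd:
  "U \<subseteq> V \<Longrightarrow> open_submfd (open_submfd M V) U = open_submfd M U"
  unfolding open_submfd_def by (simp add: subtopology_subtopology image_image Int_assoc inf.absorb2)

context atlas_manifold
begin

text \<open>The function \<open>inv_into\<close> depends on the domain, so a restricted chart has
  formally another inverse; it agrees with the old one where it matters.\<close>

lemma cinv_restrict:
  assumes "c \<in> atlas M" "x \<in> cdom c" "x \<in> U"
  shows "inv_into (cdom c \<inter> U) (cmap c) (cmap c x) = x"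
  using assms inj_cmap [OF assms(1)] by (intro inv_into_f_f) (auto intro: inj_on_subset)

lemma atlas_manifold_open_submfd:
  assumes U: "openin (mtop M) U"
  shows "atlas_manifold (open_submfd M U)"
proof (rule atlas_manifold.intro)
  show "points (open_submfd M U) = (\<Union>c\<in>atlas (open_submfd M U). cdom c)"
    using covering by auto
  fix c' assume "c' \<in> atlas (open_submfd M U)"
  then obtain c where c: "c \<in> atlas M" and c': "c' = c\<lparr>cdom := cdom c \<inter> U\<rparr>" by auto
  show "complex_banach_space (cmodel c')" using model c c' by simp
  show "openin (mtop (open_submfd M U)) (cdom c')"
    using open_cdom [OF c] c' by (simp add: openin_subtopology_Int)
  show "openin (vtop (cmodel c')) (cmap c' ` cdom c')"
    using openin_cmap_image [OF c U] c' by simp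
  have "homeomorphic_map (subtopology (subtopology (mtop M) (cdom c)) (cdom c \<inter> U))
      (subtopology (subtopology (vtop (cmodel c)) (cmap c ` cdom c)) (cmap c ` (cdom c \<inter> U))) (cmap c)"
    by (rule homeomorphic_map_subtopologies [OF chart_homeomorphic [OF c]])
      (use cdom_subset [OF c] openin_subset [OF open_range [OF c]] inj_cmap [OF c] in \<open>auto simp: inj_on_def\<close>)
  then show "homeomorphic_map (subtopology (mtop (open_submfd M U)) (cdom c'))
      (subtopology (vtop (cmodel c')) (cmap c' ` cdom c')) (cmap c')"
    using c' by (simp add: subtopology_subtopology Int_ac inf.absorb2 image_mono)
  fix d' assume "d' \<in> atlas (open_submfd M U)"
  then obtain d where d: "d \<in> atlas M" and d': "d' = d\<lparr>cdom := cdom d \<inter> U\<rparr>" by auto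
  let ?V = "cmap c ` (cdom c \<inter> cdom d)" and ?V' = "cmap c ` (cdom c \<inter> U \<inter> (cdom d \<inter> U))"
  have t: "vholomorphic_on (cmodel c) (cmodel d) ?V (cmap d \<circ> cinv c)" by (rule transition [OF c d])
  have eq: "(cmap d \<circ> cinv c) y = (cmap d \<circ> inv_into (cdom c \<inter> U) (cmap c)) y" if "y \<in> ?V'" for y
    using that cinv_cmap [OF c] cinv_restrict [OF c] by auto
  have "openin (vtop (cmodel c)) ?V'"
    using openin_cmap_image [OF c, of "U \<inter> cdom d"] U open_cdom [OF d] by (simp add: Int_ac openin_Int)
  moreover have "\<exists>D. has_cderivative_at (cmodel c) (cmodel d) ?V' (cmap d \<circ> inv_into (cdom c \<inter> U) (cmap c)) D y" if "y \<in> ?V'" for y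
  proof -
    have "y \<in> ?V" using that by auto
    then obtain D where "has_cderivative_at (cmodel c) (cmodel d) ?V (cmap d \<circ> cinv c) D y"
      using t unfolding vholomorphic_on_def by blast
    then have "has_cderivative_at (cmodel c) (cmodel d) ?V' (cmap d \<circ> cinv c) D y"
      by (rule cderivative_subset) auto
    then have "has_cderivative_at (cmodel c) (cmodel d) ?V' (cmap d \<circ> inv_into (cdom c \<inter> U) (cmap c)) D y"
      by (rule cderivative_cong [OF _ that]) (rule eq)
    then show "\<exists>D. has_cderivative_at (cmodel c) (cmodel d) ?V' (cmap d \<circ> inv_into (cdom c \<inter> U) (cmap c)) D y" by (rule exI [of _ D])
  qed
  moreover have "(cmap d \<circ> inv_into (cdom c \<inter> U) (cmap c)) \<in> ?V' \<rightarrow> carrier (cmodel d)"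
    using cmap_in_carrier [OF d] cinv_restrict [OF c] by auto
  ultimately show "vholomorphic_on (cmodel c') (cmodel d') (cmap c' ` (cdom c' \<inter> cdom d')) (cmap d' \<circ> cinv c')"
    unfolding c' d' vholomorphic_on_def by simp
qed

lemma mdiff_open_source:
  assumes U: "openin (mtop M) U" and x: "x \<in> U"
  shows "mdiff (open_submfd M U) N f x \<longleftrightarrow> mdiff M N f x"
proof
  assume L: "mdiff (open_submfd M U) N f x"
  show "mdiff M N f x" unfolding mdiff_def
  proof (intro ballI impI)
    fix c d assume c: "c \<in> atlas M" and d: "d \<in> atlas N" and xc: "x \<in> cdom c" "f x \<in> cdom d"
    have "c\<lparr>cdom := cdom c \<inter> U\<rparr> \<in> atlas (open_submfd M U)" using c by auto
    from mdiffE [OF L this d] xc x obtain V D where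
      V: "openin (vtop (cmodel c)) V" "cmap c x \<in> V" "V \<subseteq> cmap c ` (cdom c \<inter> U \<inter> f -` cdom d)"
      "has_cderivative_at (cmodel c) (cmodel d) V (cmap d \<circ> f \<circ> inv_into (cdom c \<inter> U) (cmap c)) D (cmap c x)"
      by auto
    have "has_cderivative_at (cmodel c) (cmodel d) V (cmap d \<circ> f \<circ> cinv c) D (cmap c x)"
    proof (rule cderivative_cong [OF V(4,2)])
      fix y assume "y \<in> V"
      then obtain z where "z \<in> cdom c" "z \<in> U" "y = cmap c z" using V(3) by blast
      then show "(cmap d \<circ> f \<circ> inv_into (cdom c \<inter> U) (cmap c)) y = (cmap d \<circ> f \<circ> cinv c) y"
        using cinv_cmap [OF c] cinv_restrict [OF c] by simp
    qed
    then show "\<exists>V D. openin (vtop (cmodel c)) V \<and> cmap c x \<in> V \<and> V \<subseteq> cmap c ` (cdom c \<inter> f -` cdom d) \<and>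
        has_cderivative_at (cmodel c) (cmodel d) V (cmap d \<circ> f \<circ> cinv c) D (cmap c x)" using V by blast
  qed
next
  assume R: "mdiff M N f x"
  show "mdiff (open_submfd M U) N f x" unfolding mdiff_def
  proof (intro ballI impI)
    fix c' d assume "c' \<in> atlas (open_submfd M U)" and d: "d \<in> atlas N" and xc: "x \<in> cdom c'" "f x \<in> cdom d"
    then obtain c where c: "c \<in> atlas M" and c': "c' = c\<lparr>cdom := cdom c \<inter> U\<rparr>" by auto
    from mdiffE [OF R c d] xc c' obtain V D where
      V: "openin (vtop (cmodel c)) V" "cmap c x \<in> V" "V \<subseteq> cmap c ` (cdom c \<inter> f -` cdom d)"
      "has_cderivative_at (cmodel c) (cmodel d) V (cmap d \<circ> f \<circ> cinv c) D (cmap c x)"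
      by auto
    let ?V = "V \<inter> cmap c ` (cdom c \<inter> U)"
    have o: "openin (vtop (cmodel c)) ?V" using V openin_cmap_image [OF c U] by blast
    have xV: "cmap c x \<in> ?V" using V x xc c' by auto
    have "has_cderivative_at (cmodel c) (cmodel d) ?V (cmap d \<circ> f \<circ> inv_into (cdom c \<inter> U) (cmap c)) D (cmap c x)"
      by (rule cderivative_cong [OF cderivative_subset [OF V(4)] xV])
        (use cinv_cmap [OF c] cinv_restrict [OF c] in auto)
    moreover have "?V \<subseteq> cmap c ` (cdom c \<inter> U \<inter> f -` cdom d)"
    proof
      fix y assume "y \<in> ?V"
      then obtain z w where "z \<in> cdom c" "z \<in> U" "y = cmap c z" "w \<in> cdom c" "f w \<in> cdom d" "y = cmap c w" using V(3) by blast
      then show "y \<in> cmap c ` (cdom c \<inter> U \<inter> f -` cdom d)" using inj_cmap [OF c] by (auto simp: inj_on_def)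
    qed
    ultimately show "\<exists>V D. openin (vtop (cmodel c')) V \<and> cmap c' x \<in> V \<and> V \<subseteq> cmap c' ` (cdom c' \<inter> f -` cdom d) \<and>
        has_cderivative_at (cmodel c') (cmodel d) V (cmap d \<circ> f \<circ> cinv c') D (cmap c' x)"
      using o xV c' by auto
  qed
qed

lemma mdiff_open_target:
  assumes cont: "continuous_map (mtop M) (mtop N) f" and U: "openin (mtop N) U" and fx: "f x \<in> U"
  shows "mdiff M (open_submfd N U) f x \<longleftrightarrow> mdiff M N f x"
proof
  assume L: "mdiff M (open_submfd N U) f x"
  show "mdiff M N f x" unfolding mdiff_def
  proof (intro ballI impI)
    fix c d assume c: "c \<in> atlas M" and d: "d \<in> atlas N" and xc: "x \<in> cdom c" "f x \<in> cdom d"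
    have "d\<lparr>cdom := cdom d \<inter> U\<rparr> \<in> atlas (open_submfd N U)" using d by auto
    from mdiffE [OF L c this xc(1)] xc fx obtain V D where
      V: "openin (vtop (cmodel c)) V" "cmap c x \<in> V" "V \<subseteq> cmap c ` (cdom c \<inter> f -` (cdom d \<inter> U))"
      "has_cderivative_at (cmodel c) (cmodel d) V (cmap d \<circ> f \<circ> cinv c) D (cmap c x)"
      by auto
    have "V \<subseteq> cmap c ` (cdom c \<inter> f -` cdom d)" using V(3) by blast
    with V show "\<exists>V D. openin (vtop (cmodel c)) V \<and> cmap c x \<in> V \<and> V \<subseteq> cmap c ` (cdom c \<inter> f -` cdom d) \<and>
        has_cderivative_at (cmodel c) (cmodel d) V (cmap d \<circ> f \<circ> cinv c) D (cmap c x)" by (intro exI [of _ V] exI [of _ D] conjI)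
  qed
next
  assume R: "mdiff M N f x"
  show "mdiff M (open_submfd N U) f x" unfolding mdiff_def
  proof (intro ballI impI)
    fix c d' assume c: "c \<in> atlas M" and d': "d' \<in> atlas (open_submfd N U)" and xc: "x \<in> cdom c" "f x \<in> cdom d'"
    then obtain d where d: "d \<in> atlas N" and d': "d' = d\<lparr>cdom := cdom d \<inter> U\<rparr>" by auto
    from mdiffE [OF R c d] xc d' obtain V D where
      V: "openin (vtop (cmodel c)) V" "cmap c x \<in> V" "V \<subseteq> cmap c ` (cdom c \<inter> f -` cdom d)"
      "has_cderivative_at (cmodel c) (cmodel d) V (cmap d \<circ> f \<circ> cinv c) D (cmap c x)"
      by auto
    let ?W = "{y \<in> points M. f y \<in> U}"
    have W: "openin (mtop M) ?W" by (rule openin_continuous_map_preimage [OF cont U])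
    let ?V = "V \<inter> cmap c ` (cdom c \<inter> ?W)"
    have o: "openin (vtop (cmodel c)) ?V" using V openin_cmap_image [OF c W] by blast
    have xV: "cmap c x \<in> ?V" using V xc d' cdom_subset [OF c] by auto
    have "has_cderivative_at (cmodel c) (cmodel d) ?V (cmap d \<circ> f \<circ> cinv c) D (cmap c x)"
      by (rule cderivative_subset [OF V(4)]) blast
    moreover have "?V \<subseteq> cmap c ` (cdom c \<inter> f -` (cdom d \<inter> U))"
    proof
      fix y assume "y \<in> ?V"
      then obtain z w where "z \<in> cdom c" "f z \<in> U" "y = cmap c z" "w \<in> cdom c" "f w \<in> cdom d" "y = cmap c w" using V(3) by blast
      then show "y \<in> cmap c ` (cdom c \<inter> f -` (cdom d \<inter> U))" using inj_cmap [OF c] by (auto simp: inj_on_def)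
    qed
    ultimately show "\<exists>V D. openin (vtop (cmodel c)) V \<and> cmap c x \<in> V \<and> V \<subseteq> cmap c ` (cdom c \<inter> f -` cdom d') \<and>
        has_cderivative_at (cmodel c) (cmodel d') V (cmap d' \<circ> f \<circ> cinv c) D (cmap c x)"
      using o xV d' by auto
  qed
qed

end

lemma chart_target_open_submfd:
  assumes "chart_target N" "openin (mtop N) U" shows "chart_target (open_submfd N U)"
  using assms unfolding chart_target_def by (fastforce simp: openin_subtopology_Int image_subset_iff)

lemma mholomorphic_open_source:
  assumes M: "atlas_manifold M" and N: "chart_target N" and U: "openin (mtop M) U" and f: "mholomorphic M N f"
  shows "mholomorphic (open_submfd M U) N f"
  using f openin_subset [OF U]
  unfolding mholomorphic_iff [OF M N] mholomorphic_iff [OF atlas_manifold.atlas_manifold_open_submfd [OF M U] N]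
  by (auto simp: continuous_map_from_subtopology atlas_manifold.mdiff_open_source [OF M U])

lemma mholomorphic_open_target:
  assumes M: "atlas_manifold M" and N: "chart_target N" and U: "openin (mtop N) U"
  shows "mholomorphic M (open_submfd N U) f \<longleftrightarrow> mholomorphic M N f \<and> f \<in> points M \<rightarrow> U"
  unfolding mholomorphic_iff [OF M N] mholomorphic_iff [OF M chart_target_open_submfd [OF N U]]
  by (auto simp: continuous_map_in_subtopology atlas_manifold.mdiff_open_target [OF M _ U] Pi_iff)

lemma mholomorphic_cong:
  assumes M: "atlas_manifold M" and N: "chart_target N" and f: "mholomorphic M N f"
    and eq: "\<And>x. x \<in> points M \<Longrightarrow> f x = g x"
  shows "mholomorphic M N g"
  using f mdiff_cong [OF M, where W = "points M" and f = f and g = g and N = N] eq continuous_map_eq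
  unfolding mholomorphic_iff [OF M N] by (metis openin_topspace)

subsection \<open>Spaces and charts as holomorphic maps\<close>

lemma space_mfd_simps [simp]:
  "mtop (space_mfd E) = vtop E" "atlas (space_mfd E) = {\<lparr>cdom = carrier E, cmodel = E, cmap = id\<rparr>}"
  by (simp_all add: space_mfd_def)

lemma inv_into_id [simp]: "x \<in> S \<Longrightarrow> inv_into S id x = x"
  using inv_into_f_f [of id S x] by simp

lemma cderivative_id:
  assumes "complex_banach_space E" "U \<subseteq> carrier E" "x \<in> U"
  shows "has_cderivative_at E E U id id x"
proof -
  interpret E: complex_banach_space E by fact
  have "bounded_clinear E E id" by (auto simp: bounded_clinear_def intro!: exI [of _ 1])
  from cderivative_affine [OF assms(1,1) this E.zero_closed assms(3,2)]
  show ?thesis by (rule cderivative_cong) (use assms in auto)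
qed

lemma atlas_manifold_space_mfd:
  assumes E: "complex_banach_space E" shows "atlas_manifold (space_mfd E)"
proof -
  interpret E: complex_banach_space E by fact
  have "has_cderivative_at E E (carrier E) (inv_into (carrier E) id) id x" if "x \<in> carrier E" for x
    by (rule cderivative_cong [OF cderivative_id [OF E _ that]]) (use that in auto)
  moreover have "openin (vtop E) (carrier E)" using openin_topspace [of "vtop E"] by simp
  ultimately show ?thesis
    by (intro atlas_manifold.intro) (auto simp: E vholomorphic_on_def homeomorphic_map_id)
qed

lemma mholomorphic_space_iff:
  assumes E: "complex_banach_space E" and F: "complex_banach_space F" and U: "openin (vtop E) U"
  shows "mholomorphic (open_submfd (space_mfd E) U) (space_mfd F) f \<longleftrightarrow>
    continuous_map (subtopology (vtop E) U) (vtop F) f \<and> vholomorphic_on E F U f"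
proof -
  interpret E: complex_banach_space E by fact
  interpret F: complex_banach_space F by fact
  have UE: "U \<subseteq> carrier E" using openin_subset [OF U] by simp
  have S: "(carrier E \<inter> U \<inter> f -` carrier F) = U" if "continuous_map (subtopology (vtop E) U) (vtop F) f"
    using that UE by (auto simp: continuous_map_def)
  have "has_cderivative_at E F U (f \<circ> inv_into U id) D x \<longleftrightarrow> has_cderivative_at E F U f D x" if "x \<in> U" for D x
    using cderivative_cong [OF _ that, of E F "f \<circ> inv_into U id" D f] cderivative_cong [OF _ that, of E F f D "f \<circ> inv_into U id"] by auto
  moreover have "(f \<circ> inv_into U id) \<in> U \<rightarrow> carrier F \<longleftrightarrow> f \<in> U \<rightarrow> carrier F" by (simp add: Pi_iff)
  ultimately have "vholomorphic_on E F U (f \<circ> inv_into U id) \<longleftrightarrow> vholomorphic_on E F U f"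
    unfolding vholomorphic_on_def by metis
  then show ?thesis
    using S UE by (auto simp: mholomorphic_def inf.absorb2)
qed

context atlas_manifold
begin

text \<open>Read in the charts of M, the inverse of a chart is a transition map.\<close>

lemma mholomorphic_cinv:
  assumes c: "c \<in> atlas M"
  shows "mholomorphic (open_submfd (space_mfd (cmodel c)) (cmap c ` cdom c)) M (cinv c)"
proof -
  let ?R = "cmap c ` cdom c"
  have E: "atlas_manifold (space_mfd (cmodel c))" by (rule atlas_manifold_space_mfd [OF model [OF c]])
  have R: "openin (mtop (space_mfd (cmodel c))) ?R" using open_range [OF c] by simp
  note ER = atlas_manifold.atlas_manifold_open_submfd [OF E R]
  have "mdiff (space_mfd (cmodel c)) M (cinv c) y" if y: "y \<in> ?R" for y
    unfolding mdiff_def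
  proof (intro ballI impI, goal_cases)
    case (1 e d)
    then have e: "e = \<lparr>cdom = carrier (cmodel c), cmodel = cmodel c, cmap = id\<rparr>" by simp
    let ?V = "cmap c ` (cdom c \<inter> cdom d)"
    have V: "vholomorphic_on (cmodel c) (cmodel d) ?V (cmap d \<circ> cinv c)" by (rule transition [OF c 1(2)])
    have yV: "y \<in> ?V" using y 1(4) cinv_cmap [OF c] by auto
    have VC: "?V \<subseteq> carrier (cmodel c)" using cmap_carrier [OF c] by blast
    obtain D where D: "has_cderivative_at (cmodel c) (cmodel d) ?V (cmap d \<circ> cinv c) D y"
      using V yV unfolding vholomorphic_on_def by blast
    have "has_cderivative_at (cmodel c) (cmodel d) ?V (cmap d \<circ> cinv c \<circ> inv_into (carrier (cmodel c)) id) D y"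
      by (rule cderivative_cong [OF D yV]) (use VC in auto)
    moreover have "?V \<subseteq> carrier (cmodel c) \<inter> cinv c -` cdom d" using VC cinv_cmap [OF c] by auto
    ultimately show ?case using V yV unfolding vholomorphic_on_def e by auto
  qed
  then show ?thesis
    using continuous_map_cinv [OF c]
    unfolding mholomorphic_iff [OF ER chart_target] by (auto simp: atlas_manifold.mdiff_open_source [OF E R])
qed

lemma mholomorphic_cmap:
  assumes c: "c \<in> atlas M"
  shows "mholomorphic (open_submfd M (cdom c)) (space_mfd (cmodel c)) (cmap c)"
proof -
  have E: "atlas_manifold (space_mfd (cmodel c))" by (rule atlas_manifold_space_mfd [OF model [OF c]])
  note MR = atlas_manifold_open_submfd [OF open_cdom [OF c]]
  have "mdiff M (space_mfd (cmodel c)) (cmap c) x" if x: "x \<in> cdom c" for x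
    unfolding mdiff_def
  proof (intro ballI impI, goal_cases)
    case (1 d e)
    then have e: "e = \<lparr>cdom = carrier (cmodel c), cmodel = cmodel c, cmap = id\<rparr>" by simp
    let ?V = "cmap d ` (cdom d \<inter> cdom c)"
    have V: "vholomorphic_on (cmodel d) (cmodel c) ?V (cmap c \<circ> cinv d)" by (rule transition [OF 1(1) c])
    have xV: "cmap d x \<in> ?V" using x 1 by auto
    obtain D where D: "has_cderivative_at (cmodel d) (cmodel c) ?V (cmap c \<circ> cinv d) D (cmap d x)"
      using V xV unfolding vholomorphic_on_def by blast
    moreover have "?V \<subseteq> cmap d ` (cdom d \<inter> cmap c -` carrier (cmodel c))" using cmap_in_carrier [OF c] by auto
    ultimately show ?case using V xV unfolding vholomorphic_on_def e by auto
  qed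
  moreover have "continuous_map (subtopology (mtop M) (cdom c)) (vtop (cmodel c)) (cmap c)"
    using homeomorphic_imp_continuous_map [OF chart_homeomorphic [OF c]] continuous_map_in_subtopology by blast
  ultimately show ?thesis
    unfolding mholomorphic_iff [OF MR atlas_manifold.chart_target [OF E]]
    by (auto simp: mdiff_open_source [OF open_cdom [OF c]])
qed

end

subsection \<open>Products and Hartogs domains\<close>

lemma prod_mfd_simps [simp]:
  "mtop (prod_mfd X Y) = prod_topology (mtop X) (mtop Y)"
  "atlas (prod_mfd X Y) = (\<lambda>(c, d). prod_chart c d) ` (atlas X \<times> atlas Y)"
  by (simp_all add: prod_mfd_def)

lemma prod_chart_simps [simp]:
  "cdom (prod_chart c d) = cdom c \<times> cdom d" "cmodel (prod_chart c d) = prod_space (cmodel c) (cmodel d)"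
  "cmap (prod_chart c d) = map_prod (cmap c) (cmap d)"
  by (simp_all add: prod_chart_def)

lemma chart_target_prod_mfd:
  assumes "chart_target X" "chart_target Y" shows "chart_target (prod_mfd X Y)"
  using assms unfolding chart_target_def by (fastforce simp: openin_prod_Times_iff image_subset_iff)

lemma mdiff_prod:
  assumes M: "atlas_manifold M" and X: "atlas_manifold X" and Y: "atlas_manifold Y"
    and fx: "f x \<in> points X \<times> points Y"
  shows "mdiff M (prod_mfd X Y) f x \<longleftrightarrow> mdiff M X (fst \<circ> f) x \<and> mdiff M Y (snd \<circ> f) x"
proof -
  interpret M: atlas_manifold M by fact
  interpret X: atlas_manifold X by fact
  interpret Y: atlas_manifold Y by fact
  have iff: "(\<exists>D. has_cderivative_at (cmodel c) (prod_space (cmodel d) (cmodel e)) V (map_prod (cmap d) (cmap e) \<circ> f \<circ> cinv c) D (cmap c x)) \<longleftrightarrow>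
     (\<exists>D. has_cderivative_at (cmodel c) (cmodel d) V (cmap d \<circ> (fst \<circ> f) \<circ> cinv c) D (cmap c x)) \<and>
     (\<exists>D. has_cderivative_at (cmodel c) (cmodel e) V (cmap e \<circ> (snd \<circ> f) \<circ> cinv c) D (cmap c x))"
    if c: "c \<in> atlas M" and d: "d \<in> atlas X" and e: "e \<in> atlas Y" and V: "V \<subseteq> cmap c ` (cdom c \<inter> f -` (cdom d \<times> cdom e))" and xV: "cmap c x \<in> V"
    for c d e V
  proof -
    have *: "map_prod (cmap d) (cmap e) \<circ> f \<circ> cinv c = (\<lambda>y. ((cmap d \<circ> (fst \<circ> f) \<circ> cinv c) y, (cmap e \<circ> (snd \<circ> f) \<circ> cinv c) y))"
      by (auto simp: fun_eq_iff map_prod_def split: prod.splits)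
    have **: "f (cinv c y) \<in> cdom d \<times> cdom e" if "y \<in> V" for y
      using that V M.cinv_cmap [OF c] by (auto simp: image_iff subset_iff)
    show ?thesis unfolding *
    proof (rule cderivative_prod [OF M.model [OF c] X.model [OF d] Y.model [OF e]])
      show "(cmap d \<circ> (fst \<circ> f) \<circ> cinv c) ` V \<subseteq> carrier (cmodel d)"
        using ** X.cmap_in_carrier [OF d] by (force simp: image_subset_iff mem_Times_iff)
      show "(cmap e \<circ> (snd \<circ> f) \<circ> cinv c) ` V \<subseteq> carrier (cmodel e)"
        using ** Y.cmap_in_carrier [OF e] by (force simp: image_subset_iff mem_Times_iff)
      show "V \<subseteq> carrier (cmodel c)" using V M.cmap_carrier [OF c] by blast
    qed (rule xV)
  qed
  show ?thesis
  proof
    assume L: "mdiff M (prod_mfd X Y) f x"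
    have *: "\<exists>V D D'. openin (vtop (cmodel c)) V \<and> cmap c x \<in> V \<and> V \<subseteq> cmap c ` (cdom c \<inter> f -` (cdom d \<times> cdom e)) \<and>
       has_cderivative_at (cmodel c) (cmodel d) V (cmap d \<circ> (fst \<circ> f) \<circ> cinv c) D (cmap c x) \<and>
       has_cderivative_at (cmodel c) (cmodel e) V (cmap e \<circ> (snd \<circ> f) \<circ> cinv c) D' (cmap c x)"
      if c: "c \<in> atlas M" "x \<in> cdom c" and d: "d \<in> atlas X" and e: "e \<in> atlas Y" and fxd: "f x \<in> cdom d \<times> cdom e" for c d e
    proof -
      have "prod_chart d e \<in> atlas (prod_mfd X Y)" using d e by force
      from mdiffE [OF L c(1) this c(2)] fxd obtain V D where
        V: "openin (vtop (cmodel c)) V" "cmap c x \<in> V" "V \<subseteq> cmap c ` (cdom c \<inter> f -` (cdom d \<times> cdom e))"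
        "has_cderivative_at (cmodel c) (prod_space (cmodel d) (cmodel e)) V (map_prod (cmap d) (cmap e) \<circ> f \<circ> cinv c) D (cmap c x)"
        unfolding prod_chart_simps by metis
      obtain D1 D2 where "has_cderivative_at (cmodel c) (cmodel d) V (cmap d \<circ> (fst \<circ> f) \<circ> cinv c) D1 (cmap c x)"
        "has_cderivative_at (cmodel c) (cmodel e) V (cmap e \<circ> (snd \<circ> f) \<circ> cinv c) D2 (cmap c x)"
        using iff [OF c(1) d e V(3,2), THEN iffD1, OF exI [of _ D], OF V(4)] by (elim conjE exE)
      then show ?thesis using V by (intro exI [of _ V] exI [of _ D1] exI [of _ D2] conjI)
    qed
    show "mdiff M X (fst \<circ> f) x \<and> mdiff M Y (snd \<circ> f) x"
    proof
      show "mdiff M X (fst \<circ> f) x" unfolding mdiff_def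
      proof (intro ballI impI)
        fix c d assume c: "c \<in> atlas M" and d: "d \<in> atlas X" and xc: "x \<in> cdom c" "(fst \<circ> f) x \<in> cdom d"
        \<comment> \<open>Product charts are the only charts of the target, so the other component
          needs an auxiliary chart around its value.\<close>
        obtain e where e: "e \<in> atlas Y" "snd (f x) \<in> cdom e" using fx Y.covering by auto
        have fd: "f x \<in> cdom d \<times> cdom e" using xc e by (simp add: mem_Times_iff)
        from * [OF c xc(1) d e(1) fd] obtain V D D' where V: "openin (vtop (cmodel c)) V" "cmap c x \<in> V" "V \<subseteq> cmap c ` (cdom c \<inter> f -` (cdom d \<times> cdom e))"
          "has_cderivative_at (cmodel c) (cmodel d) V (cmap d \<circ> (fst \<circ> f) \<circ> cinv c) D (cmap c x)" by (elim exE conjE)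
        have "V \<subseteq> cmap c ` (cdom c \<inter> (fst \<circ> f) -` cdom d)" using V(3) by (rule order_trans) (auto simp: mem_Times_iff)
        with V show "\<exists>V D. openin (vtop (cmodel c)) V \<and> cmap c x \<in> V \<and> V \<subseteq> cmap c ` (cdom c \<inter> (fst \<circ> f) -` cdom d) \<and>
          has_cderivative_at (cmodel c) (cmodel d) V (cmap d \<circ> (fst \<circ> f) \<circ> cinv c) D (cmap c x)"
          by (intro exI [of _ V] exI [of _ D] conjI)
      qed
      show "mdiff M Y (snd \<circ> f) x" unfolding mdiff_def
      proof (intro ballI impI)
        fix c e assume c: "c \<in> atlas M" and e: "e \<in> atlas Y" and xc: "x \<in> cdom c" "(snd \<circ> f) x \<in> cdom e"
        obtain d where d: "d \<in> atlas X" "fst (f x) \<in> cdom d" using fx X.covering by auto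
        have fd: "f x \<in> cdom d \<times> cdom e" using xc d by (simp add: mem_Times_iff)
        from * [OF c xc(1) d(1) e fd] obtain V D D' where V: "openin (vtop (cmodel c)) V" "cmap c x \<in> V" "V \<subseteq> cmap c ` (cdom c \<inter> f -` (cdom d \<times> cdom e))"
          "has_cderivative_at (cmodel c) (cmodel e) V (cmap e \<circ> (snd \<circ> f) \<circ> cinv c) D' (cmap c x)" by (elim exE conjE)
        have "V \<subseteq> cmap c ` (cdom c \<inter> (snd \<circ> f) -` cdom e)" using V(3) by (rule order_trans) (auto simp: mem_Times_iff)
        with V show "\<exists>V D. openin (vtop (cmodel c)) V \<and> cmap c x \<in> V \<and> V \<subseteq> cmap c ` (cdom c \<inter> (snd \<circ> f) -` cdom e) \<and>
          has_cderivative_at (cmodel c) (cmodel e) V (cmap e \<circ> (snd \<circ> f) \<circ> cinv c) D (cmap c x)"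
          by (intro exI [of _ V] exI [of _ D'] conjI)
      qed
    qed
  next
    assume R: "mdiff M X (fst \<circ> f) x \<and> mdiff M Y (snd \<circ> f) x"
    show "mdiff M (prod_mfd X Y) f x" unfolding mdiff_def
    proof (intro ballI impI)
      fix c de assume c: "c \<in> atlas M" and de: "de \<in> atlas (prod_mfd X Y)" and xc: "x \<in> cdom c" "f x \<in> cdom de"
      then obtain d e where d: "d \<in> atlas X" and e: "e \<in> atlas Y" and de: "de = prod_chart d e" by auto
      have fd: "(fst \<circ> f) x \<in> cdom d" "(snd \<circ> f) x \<in> cdom e" using xc de by (auto simp: mem_Times_iff)
      obtain V1 D1 where V1: "openin (vtop (cmodel c)) V1" "cmap c x \<in> V1" "V1 \<subseteq> cmap c ` (cdom c \<inter> (fst \<circ> f) -` cdom d)"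
          "has_cderivative_at (cmodel c) (cmodel d) V1 (cmap d \<circ> (fst \<circ> f) \<circ> cinv c) D1 (cmap c x)"
        using mdiffE [OF conjunct1 [OF R] c d xc(1) fd(1)] by metis
      obtain V2 D2 where V2: "openin (vtop (cmodel c)) V2" "cmap c x \<in> V2" "V2 \<subseteq> cmap c ` (cdom c \<inter> (snd \<circ> f) -` cdom e)"
          "has_cderivative_at (cmodel c) (cmodel e) V2 (cmap e \<circ> (snd \<circ> f) \<circ> cinv c) D2 (cmap c x)"
        using mdiffE [OF conjunct2 [OF R] c e xc(1) fd(2)] by metis
      let ?V = "V1 \<inter> V2"
      have V: "openin (vtop (cmodel c)) ?V" "cmap c x \<in> ?V" using V1 V2 by auto
      have sub: "?V \<subseteq> cmap c ` (cdom c \<inter> f -` (cdom d \<times> cdom e))"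
      proof
        fix y assume "y \<in> ?V"
        then have y: "y \<in> cmap c ` (cdom c \<inter> (fst \<circ> f) -` cdom d)" "y \<in> cmap c ` (cdom c \<inter> (snd \<circ> f) -` cdom e)"
          using V1(3) V2(3) by blast+
        obtain p where "p \<in> cdom c" "fst (f p) \<in> cdom d" "y = cmap c p" using y(1) by auto
        moreover obtain q where "q \<in> cdom c" "snd (f q) \<in> cdom e" "y = cmap c q" using y(2) by auto
        ultimately show "y \<in> cmap c ` (cdom c \<inter> f -` (cdom d \<times> cdom e))"
          using M.inj_cmap [OF c] by (auto simp: inj_on_def mem_Times_iff)
      qed
      have "has_cderivative_at (cmodel c) (cmodel d) ?V (cmap d \<circ> (fst \<circ> f) \<circ> cinv c) D1 (cmap c x)"
        by (rule cderivative_subset [OF V1(4)]) simp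
      moreover have "has_cderivative_at (cmodel c) (cmodel e) ?V (cmap e \<circ> (snd \<circ> f) \<circ> cinv c) D2 (cmap c x)"
        by (rule cderivative_subset [OF V2(4)]) simp
      ultimately have "\<exists>D. has_cderivative_at (cmodel c) (prod_space (cmodel d) (cmodel e)) ?V (map_prod (cmap d) (cmap e) \<circ> f \<circ> cinv c) D (cmap c x)"
        by (intro iff [OF c d e sub V(2), THEN iffD2] conjI exI [of _ D1] exI [of _ D2])
      then obtain D where "has_cderivative_at (cmodel c) (prod_space (cmodel d) (cmodel e)) ?V (map_prod (cmap d) (cmap e) \<circ> f \<circ> cinv c) D (cmap c x)"
        by (elim exE)
      then show "\<exists>V D. openin (vtop (cmodel c)) V \<and> cmap c x \<in> V \<and> V \<subseteq> cmap c ` (cdom c \<inter> f -` cdom de) \<and>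
          has_cderivative_at (cmodel c) (cmodel de) V (cmap de \<circ> f \<circ> cinv c) D (cmap c x)"
        using V sub unfolding de prod_chart_simps by (intro exI [of _ ?V] exI [of _ D] conjI)
    qed
  qed
qed

lemma mholomorphic_prod_iff:
  assumes M: "atlas_manifold M" and X: "atlas_manifold X" and Y: "atlas_manifold Y"
  shows "mholomorphic M (prod_mfd X Y) f \<longleftrightarrow> mholomorphic M X (fst \<circ> f) \<and> mholomorphic M Y (snd \<circ> f)"
proof -
  note T = atlas_manifold.chart_target [OF X] atlas_manifold.chart_target [OF Y]
  have "mdiff M (prod_mfd X Y) f x \<longleftrightarrow> mdiff M X (fst \<circ> f) x \<and> mdiff M Y (snd \<circ> f) x"
    if "continuous_map (mtop M) (mtop X) (fst \<circ> f)" "continuous_map (mtop M) (mtop Y) (snd \<circ> f)" "x \<in> points M" for x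
    using that by (intro mdiff_prod [OF M X Y]) (auto simp: continuous_map_def mem_Times_iff Pi_iff)
  then show ?thesis
    unfolding mholomorphic_iff [OF M chart_target_prod_mfd [OF T]] mholomorphic_iff [OF M T(1)] mholomorphic_iff [OF M T(2)]
    by (auto simp: continuous_map_pairwise)
qed

definition hartogs_set :: "('p, 'v) banach_mfd \<Rightarrow> ('p \<Rightarrow> ereal) \<Rightarrow> ('p \<times> complex) set" where
  "hartogs_set X \<phi> = {(z, w). z \<in> points X \<and> ereal (cmod w) < exp_ereal (- \<phi> z)}"

text \<open>An intermediate level c decouples the condition on the point from the condition on the
  fibre. This exhibits the Hartogs domain as a union of products of sublevel sets with
  discs.\<close>

lemma less_exp_ereal_iff:
  assumes "a < \<infinity>"
  shows "ereal r < exp_ereal (- a) \<longleftrightarrow> (\<exists>c. a < ereal c \<and> r < exp (- c))"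
proof (cases a)
  case (real b)
  have "\<exists>c. b < c \<and> r < exp (- c)" if "r < exp (- b)"
  proof -
    have "((\<lambda>c. exp (- c)) \<longlongrightarrow> exp (- b)) (at_right b)" by (intro tendsto_intros)
    then have "\<forall>\<^sub>F c in at_right b. r < exp (- c)" using that by (rule order_tendstoD)
    moreover have "\<forall>\<^sub>F c in at_right b. b < c" by (simp add: eventually_at_right_less)
    ultimately have "\<forall>\<^sub>F c in at_right b. b < c \<and> r < exp (- c)" by eventually_elim simp
    then show ?thesis using eventually_happens' trivial_limit_at_right_real by blast
  qed
  then show ?thesis using real by (auto simp: exp_ereal_def intro: less_trans)
next
  case MInf
  \<comment> \<open>The level c = - ln (|r| + 1) works because a = -\<infinity> imposes no
    constraint on it.\<close>
  have "r < exp (- (- ln (\<bar>r\<bar> + 1)))" by (simp add: abs_if)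
  then have "\<exists>c. r < exp (- c)" by blast
  with MInf show ?thesis by (simp add: exp_ereal_def)
qed (use assms in auto)

lemma hartogs_set_iff:
  assumes "usc (mtop X) \<phi>"
  shows "(z, w) \<in> hartogs_set X \<phi> \<longleftrightarrow> z \<in> points X \<and> (\<exists>c. \<phi> z < ereal c \<and> cmod w < exp (- c))"
  using assms less_exp_ereal_iff unfolding usc_def hartogs_set_def by auto

lemma openin_hartogs_set:
  assumes "usc (mtop X) \<phi>"
  shows "openin (prod_topology (mtop X) euclidean) (hartogs_set X \<phi>)"
proof -
  have "hartogs_set X \<phi> = (\<Union>c. {z \<in> points X. \<phi> z < ereal c} \<times> ball 0 (exp (- c)))"
    using hartogs_set_iff [OF assms] by auto
  moreover have "openin (prod_topology (mtop X) euclidean) ({z \<in> points X. \<phi> z < ereal c} \<times> ball 0 (exp (- c)))" for c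
    using assms by (auto simp: openin_prod_Times_iff usc_def)
  ultimately show ?thesis by auto
qed

lemma mtop_hartogs [simp]:
  "mtop (hartogs_domain X \<phi>) = subtopology (prod_topology (mtop X) euclidean) (hartogs_set X \<phi>)"
  by (simp add: hartogs_domain_def hartogs_set_def)

lemma points_hartogs: "points (hartogs_domain X \<phi>) = hartogs_set X \<phi>"
  by (auto simp: hartogs_set_def)

lemma atlas_manifold_complex_plane: "atlas_manifold complex_plane"
  by (rule atlas_manifold_space_mfd [OF complex_banach_space_complex_space])

lemma mholomorphic_hartogs_iff:
  assumes A: "atlas_manifold A" and X: "atlas_manifold X" and usc: "usc (mtop X) \<phi>"
  shows "mholomorphic A (hartogs_domain X \<phi>) F \<longleftrightarrow>
    mholomorphic A X (fst \<circ> F) \<and> mholomorphic A complex_plane (snd \<circ> F) \<and> F \<in> points A \<rightarrow> hartogs_set X \<phi>"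
proof -
  note C = atlas_manifold_complex_plane
  note T = chart_target_prod_mfd [OF atlas_manifold.chart_target [OF X] atlas_manifold.chart_target [OF C]]
  have "openin (mtop (prod_mfd X complex_plane)) (hartogs_set X \<phi>)"
    using openin_hartogs_set [OF usc] by simp
  from mholomorphic_open_target [OF A T this] mholomorphic_prod_iff [OF A X C]
  show ?thesis unfolding hartogs_domain_def hartogs_set_def by auto
qed

lemma limitin_hartogs_iff:
  "limitin (mtop (hartogs_domain X \<phi>)) (\<lambda>k. (a k, b k)) (z, w) sequentially \<longleftrightarrow>
    (z, w) \<in> hartogs_set X \<phi> \<and> (\<forall>\<^sub>F k in sequentially. (a k, b k) \<in> hartogs_set X \<phi>) \<and>
    limitin (mtop X) a z sequentially \<and> b \<longlonglongrightarrow> w"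
  by (simp add: limitin_subtopology limitin_pairwise o_def)

section \<open>Convergence in the space of holomorphic maps\<close>

lemma topspace_compact_open [simp]: "topspace (compact_open A Y) = Hol A Y"
proof -
  have "{f \<in> Hol A Y. f ` {} \<subseteq> {}} \<in> {{f \<in> Hol A Y. f ` K \<subseteq> V} |K V. compactin (mtop A) K \<and> openin (mtop Y) V}"
    by (intro CollectI exI [of _ "{}"]) auto
  then show ?thesis unfolding compact_open_def topology_generated_by_topspace by fast
qed

text \<open>Locally uniform convergence without a metric on Y. The next two lemmas show that for
  sequences of holomorphic maps it is convergence in the compact-open topology.\<close>

definition locally_converges :: "('p, 'v) banach_mfd \<Rightarrow> ('q, 'w) banach_mfd \<Rightarrow> (nat \<Rightarrow> 'p \<Rightarrow> 'q) \<Rightarrow> ('p \<Rightarrow> 'q) \<Rightarrow> bool" where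
  "locally_converges A Y f g \<longleftrightarrow> (\<forall>x\<in>points A. \<forall>V. openin (mtop Y) V \<longrightarrow> g x \<in> V \<longrightarrow>
     (\<exists>U. openin (mtop A) U \<and> x \<in> U \<and> (\<forall>\<^sub>F k in sequentially. f k ` U \<subseteq> V)))"

text \<open>Being eventually in an open set is checked along the generation of the topology; for a
  subbasic set, finitely many of the given neighbourhoods cover K.\<close>

lemma limitin_compact_openI:
  assumes f: "\<And>k. f k \<in> Hol A Y" and g: "g \<in> Hol A Y" and conv: "locally_converges A Y f g"
  shows "limitin (compact_open A Y) f g sequentially"
  unfolding limitin_def
proof (intro conjI allI impI)
  show "g \<in> topspace (compact_open A Y)" using g by simp
  fix W assume W: "openin (compact_open A Y) W \<and> g \<in> W"
  then have "generate_topology_on {{f \<in> Hol A Y. f ` K \<subseteq> V} |K V. compactin (mtop A) K \<and> openin (mtop Y) V} W"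
    unfolding compact_open_def by (simp add: openin_topology_generated_by_iff)
  then have "g \<in> W \<longrightarrow> (\<forall>\<^sub>F k in sequentially. f k \<in> W)"
  proof induction
    case (Int a b)
    then show ?case by (auto intro: eventually_conj)
  next
    case (UN K)
    show ?case
    proof
      assume "g \<in> \<Union>K"
      then obtain s where s: "s \<in> K" "g \<in> s" by auto
      then have "\<forall>\<^sub>F k in sequentially. f k \<in> s" using UN.IH by blast
      then show "\<forall>\<^sub>F k in sequentially. f k \<in> \<Union>K" by eventually_elim (use s in blast)
    qed
  next
    case (Basis s)
    then obtain K V where s: "s = {f \<in> Hol A Y. f ` K \<subseteq> V}" and K: "compactin (mtop A) K" and V: "openin (mtop Y) V" by auto
    show ?case
    proof
      assume "g \<in> s"
      then have gK: "g ` K \<subseteq> V" using s by simp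
      have "\<forall>x\<in>K. \<exists>U. openin (mtop A) U \<and> x \<in> U \<and> (\<forall>\<^sub>F k in sequentially. f k ` U \<subseteq> V)"
        using conv V gK compactin_subset_topspace [OF K] unfolding locally_converges_def by blast
      then obtain U where U: "\<And>x. x \<in> K \<Longrightarrow> openin (mtop A) (U x) \<and> x \<in> U x \<and> (\<forall>\<^sub>F k in sequentially. f k ` U x \<subseteq> V)"
        by metis
      obtain \<F> where F: "finite \<F>" "\<F> \<subseteq> U ` K" "K \<subseteq> \<Union>\<F>"
        using compactinD [OF K, of "U ` K"] U by auto
      have "\<forall>\<^sub>F k in sequentially. \<forall>S\<in>\<F>. f k ` S \<subseteq> V"
        using F U by (intro eventually_ball_finite) auto
      then show "\<forall>\<^sub>F k in sequentially. f k \<in> s"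
      proof eventually_elim
        case (elim k)
        then have "f k ` K \<subseteq> V" using F(3) by blast
        then show ?case using s f by simp
      qed
    qed
  qed auto
  then show "\<forall>\<^sub>F k in sequentially. f k \<in> W" using W by blast
qed

lemma limitin_compact_openD:
  assumes A: "atlas_manifold A" and lim: "limitin (compact_open A Y) f g sequentially"
  shows "g \<in> Hol A Y" "locally_converges A Y f g"
proof -
  interpret A: atlas_manifold A by fact
  show g: "g \<in> Hol A Y" using limitin_topspace [OF lim] by simp
  show "locally_converges A Y f g"
    unfolding locally_converges_def
  proof (intro ballI allI impI)
    fix x V assume x: "x \<in> points A" and V: "openin (mtop Y) V" "g x \<in> V"
    have cont: "continuous_map (mtop A) (mtop Y) g" using g by (simp add: Hol_def mholomorphic_def)
    define W where "W = {y \<in> points A. g y \<in> V}"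
    have W: "openin (mtop A) W" "x \<in> W"
      unfolding W_def using openin_continuous_map_preimage [OF cont V(1)] x V by auto
    show "\<exists>U. openin (mtop A) U \<and> x \<in> U \<and> (\<forall>\<^sub>F k in sequentially. f k ` U \<subseteq> V)"
    proof (rule ccontr)
      assume neg: "\<not> ?thesis"
      have "\<exists>y\<in>U. y \<in> W \<and> (\<exists>k\<ge>n. f k y \<notin> V)" if U: "openin (mtop A) U" "x \<in> U" for U n
      proof -
        have "\<not> (\<forall>\<^sub>F k in sequentially. f k ` (U \<inter> W) \<subseteq> V)"
          using neg openin_Int [OF U(1) W(1)] U(2) W(2) by blast
        then show ?thesis unfolding eventually_sequentially by blast
      qed
      then obtain y where y: "\<And>n. y n \<in> W \<and> (\<exists>k\<ge>n. f k (y n) \<notin> V)" "limitin (mtop A) y x sequentially"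
        using A.sequence_at [OF x, of "\<lambda>n y. y \<in> W \<and> (\<exists>k\<ge>n. f k y \<notin> V)"] by blast
      from y(1) obtain k where ky: "\<And>n. k n \<ge> n" "\<And>n. f (k n) (y n) \<notin> V" by metis
      note y(2)
      moreover have "range y \<subseteq> W" using y(1) by blast
      ultimately have K: "compactin (mtop A) (insert x (range y))"
        by (intro compactin_sequence_with_limit) (auto simp: W_def)
      let ?S = "{f \<in> Hol A Y. f ` (insert x (range y)) \<subseteq> V}"
      have "openin (compact_open A Y) ?S"
        unfolding compact_open_def by (rule topology_generated_by_Basis) (use K V in blast)
      moreover have "g \<in> ?S" using g V \<open>range y \<subseteq> W\<close> by (auto simp: W_def)
      ultimately have "\<forall>\<^sub>F j in sequentially. f j \<in> ?S" using lim unfolding limitin_def by blast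
      then obtain N where "\<And>j. j \<ge> N \<Longrightarrow> f j \<in> ?S" unfolding eventually_sequentially by blast
      then have "f (k N) \<in> ?S" using ky(1) by blast
      then show False using ky(2) [of N] by blast
    qed
  qed
qed

lemma locally_converges_pointwise:
  assumes "locally_converges A Y f g" "x \<in> points A" "g x \<in> points Y"
  shows "limitin (mtop Y) (\<lambda>k. f k x) (g x) sequentially"
  unfolding limitin_def
proof (intro conjI allI impI)
  fix V assume "openin (mtop Y) V \<and> g x \<in> V"
  then obtain U where "x \<in> U" "\<forall>\<^sub>F k in sequentially. f k ` U \<subseteq> V"
    using assms unfolding locally_converges_def by meson
  then show "\<forall>\<^sub>F k in sequentially. f k x \<in> V" by (auto elim!: eventually_mono)
qed (rule assms)

lemma Hol_points: "g \<in> Hol A Y \<Longrightarrow> x \<in> points A \<Longrightarrow> g x \<in> points Y"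
  by (auto simp: Hol_def mholomorphic_def continuous_map_def)

lemma uniq_set_mono:
  assumes "S \<subseteq> T" shows "uniq_set A S \<subseteq> uniq_set A T"
  using assms closure_of_mono [OF assms, of "mtop A"] unfolding uniq_set_def by blast

lemma strong_imp_weak_vitali: "strong_vitali TYPE('u) Y \<Longrightarrow> weak_vitali TYPE('u) Y"
  unfolding strong_vitali_def weak_vitali_def by blast

section \<open>Plane domains as test manifolds\<close>

lemma vholomorphic_complex_iff:
  "vholomorphic_on complex_space complex_space D f \<longleftrightarrow> open D \<and> f holomorphic_on D"
proof -
  have 1: "(f has_field_derivative E 1) (at z)" if "open D" "z \<in> D" "has_cderivative_at complex_space complex_space D f E z" for z E
    using cderivative_line [OF complex_banach_space_complex_space, of D 0 1 z f E] that by simp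
  have 2: "has_cderivative_at complex_space complex_space D f ((*) d) z" if "(f has_field_derivative d) (at z)" for z d
    by (rule cderivative_of_field_derivative [OF that])
  show ?thesis
  proof
    assume L: "vholomorphic_on complex_space complex_space D f"
    then have D: "open D" by (simp add: vholomorphic_on_def)
    have "f field_differentiable at z" if "z \<in> D" for z
      using L that 1 [OF D that] unfolding vholomorphic_on_def field_differentiable_def by metis
    then show "open D \<and> f holomorphic_on D"
      using D by (simp add: holomorphic_on_open field_differentiable_def)
  next
    assume R: "open D \<and> f holomorphic_on D"
    then have "\<exists>E. has_cderivative_at complex_space complex_space D f E z" if "z \<in> D" for z
      using 2 that by (metis holomorphic_on_open)
    then show "vholomorphic_on complex_space complex_space D f"
      using R by (simp add: vholomorphic_on_def)
  qed
qed

lemma mholomorphic_plane_iff: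
  assumes "open D"
  shows "mholomorphic (open_submfd complex_plane D) complex_plane f \<longleftrightarrow> f holomorphic_on D"
  using assms mholomorphic_space_iff [OF complex_banach_space_complex_space complex_banach_space_complex_space, of D f]
    holomorphic_on_imp_continuous_on
  by (auto simp: vholomorphic_complex_iff)

lemma atlas_manifold_plane: "open D \<Longrightarrow> atlas_manifold (open_submfd complex_plane D)"
  by (intro atlas_manifold.atlas_manifold_open_submfd [OF atlas_manifold_complex_plane]) simp

section \<open>The complex line inside the universe of the test manifolds\<close>

abbreviation unemb :: "(complex \<Rightarrow> 'u) \<Rightarrow> 'u \<Rightarrow> complex" where
  "unemb emb \<equiv> inv_into UNIV emb"

text \<open>A copy of the complex line with carrier in \<open>'u\<close>, because the Vitali
  properties quantify only over manifolds whose points and model vectors have type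
  \<open>'u\<close>.\<close>

definition transported_space :: "(complex \<Rightarrow> 'u) \<Rightarrow> 'u cnormed_space" where
  "transported_space emb =
    \<lparr>carrier = range emb, mult = (\<lambda>x y. emb (unemb emb x * unemb emb y)), one = emb 1, zero = emb 0,
     add = (\<lambda>x y. emb (unemb emb x + unemb emb y)), smult = (\<lambda>c x. emb (c * unemb emb x)), vnorm = (\<lambda>x. cmod (unemb emb x))\<rparr>"

lemma transported_space_simps [simp]:
  "carrier (transported_space emb) = range emb"
  "x \<oplus>\<^bsub>transported_space emb\<^esub> y = emb (unemb emb x + unemb emb y)"
  "\<zero>\<^bsub>transported_space emb\<^esub> = emb 0"
  "c \<odot>\<^bsub>transported_space emb\<^esub> x = emb (c * unemb emb x)"
  "vnorm (transported_space emb) x = cmod (unemb emb x)"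
  by (simp_all add: transported_space_def)

definition test_domain :: "(complex \<Rightarrow> 'u) \<Rightarrow> complex set \<Rightarrow> ('u, 'u) banach_mfd" where
  "test_domain emb D = open_submfd (space_mfd (transported_space emb)) (emb ` D)"

context
  fixes emb :: "complex \<Rightarrow> 'u"
  assumes inj: "inj emb"
begin

lemma inv_emb [simp]: "unemb emb (emb z) = z"
  using inj by simp

lemma abelian_group_transported: "abelian_group (transported_space emb)"
proof (rule abelian_groupI)
  fix x assume "x \<in> carrier (transported_space emb)"
  then show "\<exists>y\<in>carrier (transported_space emb). y \<oplus>\<^bsub>transported_space emb\<^esub> x = \<zero>\<^bsub>transported_space emb\<^esub>"
    by (intro bexI [of _ "emb (- unemb emb x)"]) auto
qed (auto simp: algebra_simps)

lemma transported_minus: "emb z \<ominus>\<^bsub>transported_space emb\<^esub> emb w = emb (z - w)"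
proof -
  have "\<ominus>\<^bsub>transported_space emb\<^esub> (emb w) = emb (- w)"
    by (rule abelian_group.minus_equality [OF abelian_group_transported]) auto
  then show ?thesis by (simp add: a_minus_def)
qed

lemma vdist_transported: "vdist (transported_space emb) (emb z) (emb w) = dist z w"
  by (simp add: vdist_def transported_minus dist_norm)

lemma transported_banach: "complex_banach_space (transported_space emb)"
proof (intro complex_banach_space.intro complex_banach_space_axioms.intro)
  show "module complex_ring (transported_space emb)"
    by (rule moduleI [OF cring_complex_ring abelian_group_transported]) (auto simp: algebra_simps)
  let ?d = "vdist (transported_space emb)"
  have dist: "?d x y = dist (unemb emb x) (unemb emb y)" if "x \<in> range emb" "y \<in> range emb" for x y
    using that vdist_transported by auto
  have met: "Metric_space (range emb) ?d"
  proof
    show "0 \<le> ?d x y" for x y by (simp add: vdist_def)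
    show "?d x y = ?d y x" for x y
      using dist [of x y] dist [of y x] by (cases "x \<in> range emb \<and> y \<in> range emb") (auto simp: vdist_def dist_commute)
    show "?d x y = 0 \<longleftrightarrow> x = y" if "x \<in> range emb" "y \<in> range emb" for x y
      using that dist [OF that] by auto
    show "?d x z \<le> ?d x y + ?d y z" if "x \<in> range emb" "y \<in> range emb" "z \<in> range emb" for x y z
      using that by (simp add: dist dist_triangle)
  qed
  then interpret T: Metric_space "range emb" ?d .
  have "T.mcomplete"
    unfolding T.mcomplete_def
  proof (intro allI impI)
    fix \<sigma> assume s: "T.MCauchy \<sigma>"
    then have sr: "\<sigma> n \<in> range emb" for n by (auto simp: T.MCauchy_def)
    have "Cauchy (unemb emb \<circ> \<sigma>)"
      using s unfolding T.MCauchy_def Cauchy_def by (auto simp: dist sr)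
    then obtain z where z: "(unemb emb \<circ> \<sigma>) \<longlonglongrightarrow> z" using Cauchy_convergent_iff convergent_def by blast
    have "limitin T.mtopology \<sigma> (emb z) sequentially"
      using z unfolding T.limitin_metric tendsto_iff by (auto simp: dist sr)
    then show "\<exists>x. limitin T.mtopology \<sigma> x sequentially" ..
  qed
  then show "Metric_space.mcomplete (carrier (transported_space emb)) ?d" by simp
qed (auto simp: norm_triangle_ineq norm_mult)

lemma bounded_clinear_inv_emb: "bounded_clinear (transported_space emb) complex_space (unemb emb)"
  by (auto simp: bounded_clinear_def intro!: exI [of _ 1])

lemma bounded_clinear_emb: "bounded_clinear complex_space (transported_space emb) emb"
  by (auto simp: bounded_clinear_def intro!: exI [of _ 1])

lemma vball_transported: "vball (transported_space emb) (emb z) r = emb ` ball z r"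
  by (auto simp: complex_banach_space.in_vball [OF transported_banach] vdist_transported)

lemma openin_transported: "openin (vtop (transported_space emb)) (emb ` D) \<longleftrightarrow> open D"
  by (auto simp: complex_banach_space.openin_vtop [OF transported_banach] vball_transported open_contains_ball
      inj_image_subset_iff [OF inj])

lemma continuous_map_emb: "continuous_map euclidean (vtop (transported_space emb)) emb"
  unfolding continuous_map_def
proof (intro conjI allI impI)
  fix U assume U: "openin (vtop (transported_space emb)) U"
  then have "U = emb ` (emb -` U)" using openin_subset [OF U] complex_banach_space.topspace_vtop [OF transported_banach] by auto
  then have "open (emb -` U)" using U openin_transported by metis
  then show "openin euclidean {x \<in> topspace euclidean. emb x \<in> U}" by (simp add: vimage_def)
qed (simp add: complex_banach_space.topspace_vtop [OF transported_banach])

lemma continuous_map_inv_emb: "continuous_map (vtop (transported_space emb)) euclidean (unemb emb)"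
  unfolding continuous_map_def
proof (intro conjI allI impI)
  fix U assume "openin euclidean (U :: complex set)"
  then have "openin (vtop (transported_space emb)) (emb ` U)" by (simp add: openin_transported)
  moreover have "{x \<in> topspace (vtop (transported_space emb)). unemb emb x \<in> U} = emb ` U"
    by (auto simp: complex_banach_space.topspace_vtop [OF transported_banach])
  ultimately show "openin (vtop (transported_space emb)) {x \<in> topspace (vtop (transported_space emb)). unemb emb x \<in> U}" by simp
qed simp

lemma points_test_domain [simp]: "points (test_domain emb D) = emb ` D"
  by (auto simp: test_domain_def complex_banach_space.topspace_vtop [OF transported_banach])

lemma atlas_manifold_test_domain: "open D \<Longrightarrow> atlas_manifold (test_domain emb D)"
  unfolding test_domain_def
  by (intro atlas_manifold.atlas_manifold_open_submfd atlas_manifold_space_mfd transported_banach)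
    (simp add: openin_transported)

lemma banach_manifold_test_domain:
  assumes "open D" "connected D" shows "banach_manifold (test_domain emb D)"
proof -
  interpret atlas_manifold "test_domain emb D" by (rule atlas_manifold_test_domain) fact
  have "connectedin (vtop (transported_space emb)) (emb ` D)"
    by (rule connectedin_continuous_map_image [OF continuous_map_emb]) (use assms in simp)
  then have conn: "connected_space (mtop (test_domain emb D))"
    by (simp add: test_domain_def connectedin_def)
  have haus: "Hausdorff_space (mtop (test_domain emb D))"
    using Metric_space.Hausdorff_space_mtopology [OF complex_banach_space.metric [OF transported_banach]]
    by (simp add: test_domain_def vtop_def Hausdorff_space_subtopology)
  show ?thesis
    by (rule banach_manifold.intro) (fact conn haus covering model open_cdom open_range chart_homeomorphic transition)+
qed

lemma mholomorphic_inv_emb: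
  assumes D: "open D"
  shows "mholomorphic (test_domain emb D) (open_submfd complex_plane D) (unemb emb)"
proof -
  note T = transported_banach and C = complex_banach_space_complex_space
  have oD: "openin (vtop (transported_space emb)) (emb ` D)" using D by (simp add: openin_transported)
  have "has_cderivative_at (transported_space emb) complex_space (emb ` D) (unemb emb) (unemb emb) x" if "x \<in> emb ` D" for x
    using cderivative_affine [OF T C bounded_clinear_inv_emb, of 0 x "emb ` D"] that by auto
  then have "vholomorphic_on (transported_space emb) complex_space (emb ` D) (unemb emb)"
    using oD by (auto simp: vholomorphic_on_def)
  then have "mholomorphic (test_domain emb D) complex_plane (unemb emb)"
    using mholomorphic_space_iff [OF T C oD] continuous_map_from_subtopology [OF continuous_map_inv_emb]
    by (simp add: test_domain_def)
  then show ?thesis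
    using mholomorphic_open_target [OF atlas_manifold_test_domain [OF D] atlas_manifold.chart_target [OF atlas_manifold_complex_plane], of D] D
    by auto
qed

lemma mholomorphic_emb:
  assumes D: "open D"
  shows "mholomorphic (open_submfd complex_plane D) (test_domain emb D) emb"
proof -
  note T = transported_banach and C = complex_banach_space_complex_space
  have oD: "openin (mtop (space_mfd (transported_space emb))) (emb ` D)" using D by (simp add: openin_transported)
  have "has_cderivative_at complex_space (transported_space emb) D emb emb x" if "x \<in> D" for x
    using cderivative_affine [OF C T bounded_clinear_emb, of "emb 0" x D] that by auto
  then have "vholomorphic_on complex_space (transported_space emb) D emb"
    using D by (auto simp: vholomorphic_on_def)
  then have "mholomorphic (open_submfd complex_plane D) (space_mfd (transported_space emb)) emb"
    using mholomorphic_space_iff [OF C T, of D] continuous_map_from_subtopology [OF continuous_map_emb] D by simp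
  then show ?thesis
    unfolding test_domain_def
    using mholomorphic_open_target [OF atlas_manifold_plane [OF D] atlas_manifold.chart_target [OF atlas_manifold_space_mfd [OF T]] oD] by auto
qed

text \<open>The identity theorem in one variable: a holomorphic function on a connected domain that
  vanishes on a nonempty open subset is zero.\<close>

lemma open_in_uniq_set:
  assumes D: "open D" and N: "open N" "z \<in> N" "N \<subseteq> D" and S: "emb ` N \<subseteq> S" "S \<subseteq> emb ` D"
  shows "emb z \<in> uniq_set (test_domain emb D) S"
proof -
  note T = transported_banach
  have "emb z \<in> S" "S \<subseteq> points (test_domain emb D)" using N S by auto
  then have "emb z \<in> points (test_domain emb D) \<inter> Abstract_Topology.closure_of (mtop (test_domain emb D)) S"
    using closure_of_subset by (metis IntI subsetD)
  moreover have "\<forall>x\<in>U. f x = 0"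
    if U: "openin (mtop (test_domain emb D)) U" "connectedin (mtop (test_domain emb D)) U" "emb z \<in> U"
      and f: "mholomorphic (open_submfd (test_domain emb D) U) complex_plane f" and f0: "\<forall>x\<in>U \<inter> S. f x = 0" for U f
  proof -
    define U' where "U' = emb -` U"
    have UD: "U \<subseteq> emb ` D" using openin_subset [OF U(1)] by simp
    then have UU': "U = emb ` U'" and U'D: "U' \<subseteq> D" using inj by (auto simp: U'_def inj_def)
    have oU: "openin (vtop (transported_space emb)) U"
      using U(1) D unfolding test_domain_def by (simp add: openin_open_subtopology openin_transported)
    then have oU': "open U'" using UU' openin_transported by metis
    have "connectedin (vtop (transported_space emb)) U"
      using U(2) by (simp add: test_domain_def connectedin_subtopology)
    then have "connectedin euclidean (unemb emb ` U)"
      using connectedin_continuous_map_image [OF continuous_map_inv_emb] by blast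
    moreover have "unemb emb ` U = U'" unfolding UU' by (simp add: image_image)
    ultimately have cU': "connected U'" by simp
    \<comment> \<open>An open submanifold of a test domain is the test domain of the corresponding
      plane set, so f becomes a function of one complex variable.\<close>
    have "mtop (open_submfd (test_domain emb D) U) = mtop (test_domain emb U')"
      using UU' U'D by (simp add: test_domain_def subtopology_subtopology inf.absorb2 image_mono)
    moreover have "range emb \<inter> emb ` D \<inter> U = range emb \<inter> emb ` U'" unfolding UU' using U'D by auto
    ultimately have eq: "open_submfd (test_domain emb D) U = test_domain emb U'"
      unfolding test_domain_def open_submfd_def by (simp del: image_Int)
    have "mholomorphic (open_submfd complex_plane U') complex_plane (f \<circ> emb)"
      by (rule mholomorphic_comp [OF atlas_manifold_plane [OF oU'] atlas_manifold_test_domain [OF oU'] atlas_manifold_complex_plane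
            mholomorphic_emb [OF oU']]) (use f eq in simp)
    then have hol: "(f \<circ> emb) holomorphic_on U'" using mholomorphic_plane_iff [OF oU'] by simp
    have "(f \<circ> emb) w = 0" if "w \<in> U'" for w
    proof (rule analytic_continuation_open [of "U' \<inter> N" U' "f \<circ> emb" "\<lambda>_. 0"])
      show "U' \<inter> N \<noteq> {}" using N U by (auto simp: U'_def)
      show "(f \<circ> emb) z = 0" if "z \<in> U' \<inter> N" for z using that f0 S UU' by auto
    qed (use oU' N cU' hol that in auto)
    then show ?thesis unfolding UU' by simp
  qed
  ultimately show ?thesis unfolding uniq_set_def by blast
qed

text \<open>All obstructions to the Vitali properties come from this principle.\<close>

lemma weak_vitali_hartogs_spread:
  assumes X: "atlas_manifold X" and usc: "usc (mtop X) \<phi>"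
    and wv: "weak_vitali TYPE('u) (hartogs_domain X \<phi>)"
    and D: "open D" "connected D" and N: "open N" "N \<noteq> {}" "N \<subseteq> D"
    and a: "\<And>k. mholomorphic (open_submfd complex_plane D) X (a k)"
    and b: "\<And>k. b k holomorphic_on D"
    and ab: "\<And>k z. z \<in> D \<Longrightarrow> (a k z, b k z) \<in> hartogs_set X \<phi>"
    and conv: "\<And>z. z \<in> N \<Longrightarrow> \<exists>p w. (p, w) \<in> hartogs_set X \<phi> \<and> limitin (mtop X) (\<lambda>k. a k z) p sequentially \<and> (\<lambda>k. b k z) \<longlonglongrightarrow> w"
    and z: "z \<in> D"
  shows "\<exists>p w. (p, w) \<in> hartogs_set X \<phi> \<and> limitin (mtop X) (\<lambda>k. a k z) p sequentially \<and> (\<lambda>k. b k z) \<longlonglongrightarrow> w"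
proof -
  let ?A = "test_domain emb D" and ?Y = "hartogs_domain X \<phi>"
  note A = atlas_manifold_test_domain [OF D(1)] and P = atlas_manifold_plane [OF D(1)] and C = atlas_manifold_complex_plane
  have bm: "banach_manifold ?A" by (rule banach_manifold_test_domain [OF D])
  define f where "f k = restrict (\<lambda>u. (a k (unemb emb u), b k (unemb emb u))) (emb ` D)" for k
  have fe: "f k (emb z) = (a k z, b k z)" if "z \<in> D" for k z using that by (simp add: f_def)
  have F: "f k \<in> Hol ?A ?Y" for k
  proof -
    have 1: "mholomorphic ?A X (a k \<circ> unemb emb)"
      by (rule mholomorphic_comp [OF A P X mholomorphic_inv_emb [OF D(1)] a])
    have 2: "mholomorphic ?A complex_plane (b k \<circ> unemb emb)"
      by (rule mholomorphic_comp [OF A P C mholomorphic_inv_emb [OF D(1)]]) (simp add: mholomorphic_plane_iff D b)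
    have "mholomorphic ?A X (fst \<circ> f k)"
      by (rule mholomorphic_cong [OF A atlas_manifold.chart_target [OF X] 1]) (auto simp: fe)
    moreover have "mholomorphic ?A complex_plane (snd \<circ> f k)"
      by (rule mholomorphic_cong [OF A atlas_manifold.chart_target [OF C] 2]) (auto simp: fe)
    moreover have "f k \<in> points ?A \<rightarrow> hartogs_set X \<phi>" using ab by (auto simp: fe)
    ultimately have "mholomorphic ?A ?Y (f k)" using mholomorphic_hartogs_iff [OF A X usc] by blast
    then show ?thesis by (simp add: Hol_def f_def)
  qed
  have lim: "limitin (mtop ?Y) (\<lambda>k. f k (emb z)) (p, w) sequentially \<longleftrightarrow>
      (p, w) \<in> hartogs_set X \<phi> \<and> limitin (mtop X) (\<lambda>k. a k z) p sequentially \<and> (\<lambda>k. b k z) \<longlonglongrightarrow> w" if "z \<in> D" for z p w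
    using limitin_hartogs_iff [of X \<phi> "\<lambda>k. a k z" "\<lambda>k. b k z" p w] ab that by (simp add: fe)
  have NS: "emb ` N \<subseteq> conv_set ?A ?Y f"
    using conv lim N(3) unfolding conv_set_def points_test_domain by blast
  obtain n where n: "n \<in> N" using N by blast
  have "emb n \<in> uniq_set ?A (conv_set ?A ?Y f)"
    by (rule open_in_uniq_set [OF D(1) N(1) n N(3) NS]) (auto simp: conv_set_def)
  then have "conv_set ?A ?Y f \<inter> uniq_set ?A (conv_set ?A ?Y f) \<noteq> {}" using NS n by blast
  then obtain g where g: "limitin (compact_open ?A ?Y) f g sequentially"
    using wv bm F unfolding weak_vitali_def by blast
  have zA: "emb z \<in> points ?A" using z by simp
  have "limitin (mtop ?Y) (\<lambda>k. f k (emb z)) (g (emb z)) sequentially"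
    by (rule locally_converges_pointwise [OF limitin_compact_openD(2) [OF A g] zA Hol_points [OF limitin_compact_openD(1) [OF A g] zA]])
  then have "limitin (mtop ?Y) (\<lambda>k. f k (emb z)) (fst (g (emb z)), snd (g (emb z))) sequentially"
    by (simp only: prod.collapse)
  then show ?thesis
    unfolding lim [OF z] by (intro exI [of _ "fst (g (emb z))"] exI [of _ "snd (g (emb z))"])
qed

end

section \<open>Circle means in the complex plane\<close>

text \<open>The mean for continuous functions, with vector values so that it also applies to
  holomorphic functions; \<open>circle_mean_real\<close> relates it to
  \<open>circle_mean\<close>.\<close>

definition cmean :: "(complex \<Rightarrow> 'b) \<Rightarrow> complex \<Rightarrow> real \<Rightarrow> 'b::euclidean_space" where
  "cmean u a r = integral {0..2*pi} (\<lambda>t. u (a + of_real r * cis t)) /\<^sub>R (2*pi)"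

lemma circle_in_sphere: "0 \<le> r \<Longrightarrow> a + of_real r * cis t \<in> sphere a r"
  by (simp add: dist_norm norm_mult)

lemma cmean_integrable:
  fixes u :: "complex \<Rightarrow> 'b::euclidean_space"
  assumes "0 \<le> r" "continuous_on (sphere a r) u"
  shows "(\<lambda>t. u (a + of_real r * cis t)) integrable_on {0..2*pi}"
proof (rule integrable_continuous_interval, rule continuous_on_compose2 [OF assms(2)])
  show "continuous_on {0..2*pi} (\<lambda>t. a + of_real r * cis t)"
    by (intro continuous_intros)
qed (use circle_in_sphere [OF assms(1)] in blast)

lemma cmean_const [simp]: "cmean (\<lambda>z. c) a r = c"
  by (simp add: cmean_def)

lemma cmean_add:
  assumes "0 \<le> r" "continuous_on (sphere a r) u" "continuous_on (sphere a r) v"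
  shows "cmean (\<lambda>z. u z + v z) a r = cmean u a r + cmean v a r"
  using cmean_integrable [OF assms(1,2)] cmean_integrable [OF assms(1,3)]
  by (simp add: cmean_def Henstock_Kurzweil_Integration.integral_add algebra_simps)

lemma cmean_linear:
  assumes "0 \<le> r" "continuous_on (sphere a r) u" "bounded_linear h"
  shows "cmean (\<lambda>z. h (u z)) a r = h (cmean u a r)"
  using integral_linear [OF cmean_integrable [OF assms(1,2)] assms(3)] linear_scale [OF bounded_linear.linear [OF assms(3)]]
  by (simp add: cmean_def o_def)

lemma cmean_mono:
  fixes u v :: "complex \<Rightarrow> real"
  assumes "0 \<le> r" "continuous_on (sphere a r) u" "continuous_on (sphere a r) v"
    and "\<And>z. z \<in> sphere a r \<Longrightarrow> u z \<le> v z"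
  shows "cmean u a r \<le> cmean v a r"
  using integral_le [OF cmean_integrable [OF assms(1,2)] cmean_integrable [OF assms(1,3)]] assms(4) circle_in_sphere [OF assms(1)]
  by (simp add: cmean_def divide_right_mono)

text \<open>Cauchy's integral formula at the centre, where dz / (z - a) becomes i dt.\<close>

lemma cmean_holomorphic:
  assumes f: "continuous_on (cball a r) f" "f holomorphic_on (ball a r)" and r: "0 < r"
  shows "cmean f a r = f a"
proof -
  have "((\<lambda>u. f u / (u - a)) has_contour_integral (2 * of_real pi * \<i> * f a)) (part_circlepath a r 0 (2*pi))"
    using Cauchy_integral_circlepath [OF f, of a] r by (simp add: circlepath_def)
  then have "((\<lambda>t. f (a + r * cis t) / (a + r * cis t - a) * r * \<i> * cis t) has_integral (2 * of_real pi * \<i> * f a)) {0..2*pi}"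
    by (subst (asm) has_contour_integral_part_circlepath_iff) auto
  then have "((\<lambda>t. \<i> * f (a + r * cis t)) has_integral (\<i> * (2 * of_real pi * f a))) {0..2*pi}"
    using r by (simp add: field_simps cis_neq_zero)
  then have "((\<lambda>t. (- \<i>) * (\<i> * f (a + r * cis t))) has_integral ((- \<i>) * (\<i> * (2 * of_real pi * f a)))) {0..2*pi}"
    by (rule has_integral_mult_right)
  then have "integral {0..2*pi} (\<lambda>t. f (a + r * cis t)) = 2 * of_real pi * f a"
    by (intro integral_unique) (simp flip: mult.assoc)
  then show ?thesis by (simp add: cmean_def scaleR_conv_of_real)
qed

lemma cmean_Re_holomorphic:
  assumes f: "f holomorphic_on S" "cball a r \<subseteq> S" and r: "0 < r"
  shows "cmean (\<lambda>z. Re (f z)) a r = Re (f a)"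
proof -
  have c: "continuous_on (cball a r) f" using f holomorphic_on_imp_continuous_on continuous_on_subset by blast
  have "cmean f a r = f a"
    by (rule cmean_holomorphic [OF c _ r]) (use f holomorphic_on_subset ball_subset_cball in blast)
  moreover have "cmean (\<lambda>z. Re (f z)) a r = Re (cmean f a r)"
    using r by (intro cmean_linear bounded_linear_Re continuous_on_subset [OF c]) auto
  ultimately show ?thesis by simp
qed

text \<open>A nonnegative continuous function with integral 0 vanishes; here it is applied to -u.
  This is the equality case behind the maximum principle.\<close>

lemma cmean_nonpos_eq_0:
  fixes u :: "complex \<Rightarrow> real"
  assumes r: "0 \<le> r" and c: "continuous_on (sphere a r) u" and np: "\<And>z. z \<in> sphere a r \<Longrightarrow> u z \<le> 0"
    and m: "0 \<le> cmean u a r" and t: "t \<in> {0..2*pi}"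
  shows "u (a + of_real r * cis t) = 0"
proof -
  let ?g = "\<lambda>t. - u (a + of_real r * cis t)"
  have cg: "continuous_on {0..2*pi} ?g"
    by (intro continuous_intros continuous_on_compose2 [OF c]) (use circle_in_sphere [OF r] in blast)
  have i: "(?g has_integral integral {0..2*pi} ?g) {0..2*pi}"
    by (rule integrable_integral [OF integrable_continuous_interval [OF cg]])
  have "integral {0..2*pi} ?g \<ge> 0"
    by (rule Henstock_Kurzweil_Integration.integral_nonneg) (use integrable_continuous_interval [OF cg] np circle_in_sphere [OF r] in auto)
  moreover have "integral {0..2*pi} ?g = - (2*pi * cmean u a r)" by (simp add: cmean_def)
  ultimately have "integral {0..2*pi} ?g = 0" using m pi_gt_zero by (smt (verit) mult_nonneg_nonneg)
  then have "?g t = 0"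
  proof (intro has_integral_0_cbox_imp_0 [of 0 "2*pi" ?g t])
    show "box 0 (2*pi) \<noteq> {}" using pi_gt_zero by (simp add: not_le del: pi_gt_zero)
    show "(?g has_integral 0) (cbox 0 (2*pi))" using i \<open>integral {0..2*pi} ?g = 0\<close> by simp
  qed (use cg t np circle_in_sphere [OF r] in auto)
  then show ?thesis by simp
qed

text \<open>Continuity on the circle makes the integrals of both parts finite, so their
  extended-real difference is an honest real one.\<close>

lemma circle_mean_real:
  fixes u :: "complex \<Rightarrow> real"
  assumes r: "0 \<le> r" and c: "continuous_on (sphere a r) u"
    and U: "\<And>z. z \<in> sphere a r \<Longrightarrow> U z = ereal (u z)"
  shows "circle_mean U a r = ereal (cmean u a r)"
proof -
  let ?w = "\<lambda>t. u (a + of_real r * cis t)"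
  have cw: "continuous_on {0..2*pi} ?w"
    by (intro continuous_intros continuous_on_compose2 [OF c]) (use circle_in_sphere [OF r] in blast)
  have Uw: "U (a + of_real r * cis t) = ereal (?w t)" for t using U circle_in_sphere [OF r] by blast
  have *: "(\<integral>\<^sup>+t\<in>{0..2*pi}. ennreal (v t) \<partial>lborel) = ennreal (integral {0..2*pi} (\<lambda>t. max (v t) 0))"
    "(\<lambda>t. max (v t) 0) integrable_on {0..2*pi}" "0 \<le> integral {0..2*pi} (\<lambda>t. max (v t) 0)"
    if v: "continuous_on {0..2*pi} v" for v
  proof -
    show i: "(\<lambda>t. max (v t) 0) integrable_on {0..2*pi}"
      by (intro integrable_continuous_interval continuous_intros v)
    have "ennreal (v t) = ennreal (max (v t) 0)" for t by (simp add: max_def ennreal_neg)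
    then show "(\<integral>\<^sup>+t\<in>{0..2*pi}. ennreal (v t) \<partial>lborel) = ennreal (integral {0..2*pi} (\<lambda>t. max (v t) 0))"
      using nn_integral_has_integral_lebesgue' [OF _ integrable_integral [OF i]] by simp
    show "0 \<le> integral {0..2*pi} (\<lambda>t. max (v t) 0)"
      by (rule Henstock_Kurzweil_Integration.integral_nonneg [OF i]) simp
  qed
  have cm: "continuous_on {0..2*pi} (\<lambda>t. - ?w t)" by (intro continuous_intros cw)
  have gen: "(enn2ereal (ennreal p) - enn2ereal (ennreal q)) / ereal (2*pi) = ereal ((p - q) /\<^sub>R (2*pi))"
    if "0 \<le> p" "0 \<le> q" for p q
    using that by (simp add: divide_ereal_def)
  let ?A = "integral {0..2*pi} (\<lambda>t. max (?w t) 0)" and ?B = "integral {0..2*pi} (\<lambda>t. max (- ?w t) 0)"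
  have AB: "?A - ?B = integral {0..2*pi} ?w"
    using *(2) [OF cw] *(2) [OF cm]
    by (subst Henstock_Kurzweil_Integration.integral_diff [symmetric]) (auto intro!: Henstock_Kurzweil_Integration.integral_cong)
  have "circle_mean U a r = (enn2ereal (ennreal ?A) - enn2ereal (ennreal ?B)) / ereal (2*pi)"
    unfolding circle_mean_def Uw uminus_ereal.simps e2ennreal_ereal *(1) [OF cw] *(1) [OF cm] ..
  also have "\<dots> = ereal ((?A - ?B) /\<^sub>R (2*pi))"
    by (rule gen [OF *(3) [OF cw] *(3) [OF cm]])
  also have "\<dots> = ereal (cmean u a r)"
    unfolding AB cmean_def ..
  finally show ?thesis .
qed

section \<open>Harmonic majorants by polynomial approximation on the circle\<close>

text \<open>On the unit circle the conjugate of z is 1/z, so the product is a trigonometric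
  polynomial; taking real parts, each negative frequency can be replaced by the conjugate positive
  one.\<close>

lemma Re_poly_cnj_on_circle:
  fixes P Q :: "complex poly"
  shows "\<exists>S. \<forall>z. norm z = 1 \<longrightarrow> Re (poly P z * cnj (poly Q z)) = Re (poly S z)"
proof (induction P Q rule: poly_induct2)
  case (pCons p P q Q)
  then obtain S where S: "\<And>z. norm z = 1 \<Longrightarrow> Re (poly P z * cnj (poly Q z)) = Re (poly S z)" by blast
  have "Re (poly (pCons p P) z * cnj (poly (pCons q Q) z)) = Re (poly ([:cnj p:] * pCons q Q + [:cnj q:] * pCons 0 P + S) z)"
    if "norm z = 1" for z
  proof -
    have "z * cnj z = 1" using that complex_norm_square [of z] by simp
    \<comment> \<open>Splitting off both constant coefficients leaves the product of the tails
      without any power of z, since z times its conjugate is 1. The induction hypothesis covers this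
      product.\<close>
    then have 1: "poly (pCons p P) z * cnj (poly (pCons q Q) z) =
        p * cnj (q + z * poly Q z) + cnj q * (z * poly P z) + poly P z * cnj (poly Q z)"
      by (simp add: algebra_simps)
    have 2: "poly ([:cnj p:] * pCons q Q + [:cnj q:] * pCons 0 P + S) z =
        cnj p * (q + z * poly Q z) + cnj q * (z * poly P z) + poly S z"
      by (simp add: algebra_simps)
    have 3: "Re (p * cnj w) = Re (cnj p * w)" for w by simp
    show ?thesis unfolding 1 2 plus_complex.sel(1) [of "_ + _"] plus_complex.sel(1) [of "_ * cnj _"]
        plus_complex.sel(1) [of "cnj p * _"] S [OF that] 3 ..
  qed
  then show ?case by blast
qed (auto intro: exI [of _ 0])

text \<open>Polynomials in two real variables agree on the circle with harmonic ones. This turns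
  Stone-Weierstrass into an approximate solution of the Dirichlet problem.\<close>

lemma real_polynomial_function_on_circle:
  fixes g :: "complex \<Rightarrow> real"
  assumes "real_polynomial_function g"
  shows "\<exists>P. \<forall>z. norm z = 1 \<longrightarrow> g z = Re (poly P z)"
  using assms
proof induction
  case (linear f)
  interpret bounded_linear f by fact
  have *: "f z = Re z * f 1 + Im z * f \<i>" for z
  proof -
    have "f z = f (Re z *\<^sub>R 1 + Im z *\<^sub>R \<i>)" by (simp add: scaleR_conv_of_real mult.commute flip: complex_eq)
    then show ?thesis by (simp only: add scaleR) simp
  qed
  \<comment> \<open>A real linear form x f(1) + y f(i) is the real part of (f(1) - i f(i))
    z.\<close>
  have "f z = Re (poly [:0, Complex (f 1) (- f \<i>):] z)" for z by (subst *) simp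
  then show ?case by blast
next
  case (const c)
  have "c = Re (poly [:of_real c:] z)" for z by simp
  then show ?case by blast
next
  case (add f g)
  then obtain P Q where "\<And>z. norm z = 1 \<Longrightarrow> f z = Re (poly P z)" "\<And>z. norm z = 1 \<Longrightarrow> g z = Re (poly Q z)" by blast
  then have "\<forall>z. norm z = 1 \<longrightarrow> f z + g z = Re (poly (P + Q) z)" by simp
  then show ?case by blast
next
  case (mult f g)
  then obtain P Q where PQ: "\<And>z. norm z = 1 \<Longrightarrow> f z = Re (poly P z)" "\<And>z. norm z = 1 \<Longrightarrow> g z = Re (poly Q z)" by blast
  obtain S where S: "\<And>z. norm z = 1 \<Longrightarrow> Re (poly P z * cnj (poly Q z)) = Re (poly S z)"
    using Re_poly_cnj_on_circle by blast
  \<comment> \<open>A product of real parts Re p * Re q is half of Re (p q) + Re (p cnj q), and the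
    second term is handled by S.\<close>
  have "f z * g z = Re (poly ([:1/2:] * (P * Q + S)) z)" if "norm z = 1" for z
  proof -
    have "Re (poly ([:1/2:] * (P * Q + S)) z) = (Re (poly P z * poly Q z) + Re (poly S z)) / 2" by simp
    also have "\<dots> = (Re (poly P z * poly Q z) + Re (poly P z * cnj (poly Q z))) / 2" using S that by simp
    also have "\<dots> = f z * g z" using PQ that by simp
    finally show ?thesis ..
  qed
  then show ?case by blast
qed

text \<open>A harmonic polynomial within e of u on the circle, raised by e, dominates u there; its
  value at the centre is its mean, which exceeds that of u by at most 2 e.\<close>

lemma harmonic_majorant:
  fixes u :: "complex \<Rightarrow> real"
  assumes r: "0 < r" and c: "continuous_on (sphere a r) u" and m: "cmean u a r < b"
  obtains f where "f holomorphic_on UNIV" "\<And>z. z \<in> sphere a r \<Longrightarrow> u z < Re (f z)" "Re (f a) < b"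
proof -
  \<comment> \<open>One third of the gap, so that the loss of 2 e still leaves the value at the
    centre below b.\<close>
  define e where "e = (b - cmean u a r) / 3"
  have e: "e > 0" using m by (simp add: e_def)
  have sph: "a + of_real r * z \<in> sphere a r" if "norm z = 1" for z
    using that r by (simp add: dist_norm norm_mult)
  have "continuous_on (sphere 0 1) (\<lambda>z. u (a + of_real r * z))"
    by (rule continuous_on_compose2 [OF c]) (use sph in \<open>auto intro!: continuous_intros\<close>)
  then obtain g where g: "real_polynomial_function g" "\<And>z. z \<in> sphere 0 1 \<Longrightarrow> \<bar>u (a + of_real r * z) - g z\<bar> < e"
    using Stone_Weierstrass_real_polynomial_function [OF compact_sphere _ e] by metis
  obtain P where P: "\<And>z. norm z = 1 \<Longrightarrow> g z = Re (poly P z)"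
    using real_polynomial_function_on_circle [OF g(1)] by blast
  define f where "f z = poly P ((z - a) / of_real r) + of_real e" for z
  have hol: "f holomorphic_on UNIV" unfolding f_def by (intro holomorphic_intros) (use r in auto)
  have near: "u z < Re (f z) \<and> Re (f z) < u z + 2 * e" if z: "z \<in> sphere a r" for z
  proof -
    have n: "norm ((z - a) / of_real r) = 1" using z r by (simp add: norm_divide dist_norm norm_minus_commute)
    moreover have "a + of_real r * ((z - a) / of_real r) = z" using r by simp
    ultimately have "\<bar>u z - Re (poly P ((z - a) / of_real r))\<bar> < e"
      using g(2) [of "(z - a) / of_real r"] P by simp
    then show ?thesis by (auto simp: f_def abs_less_iff)
  qed
  have cf: "continuous_on (sphere a r) (\<lambda>z. Re (f z))"
    using holomorphic_on_imp_continuous_on [OF hol] by (intro continuous_intros) (auto intro: continuous_on_subset)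
  have "Re (f a) = cmean (\<lambda>z. Re (f z)) a r" using cmean_Re_holomorphic [OF hol] r by simp
  also have "\<dots> \<le> cmean (\<lambda>z. u z + 2 * e) a r"
    using r near by (intro cmean_mono cf continuous_intros c) (auto intro: less_imp_le)
  also have "\<dots> = cmean u a r + 2 * e" using r by (subst cmean_add [OF _ c]) auto
  also have "\<dots> < b" using e by (simp add: e_def field_simps)
  finally show ?thesis using that hol near by blast
qed

section \<open>Quantitative estimates for bounded holomorphic functions\<close>

text \<open>The Schwarz lemma for the rescaled f - f 0. The quotient inherits a bound on the same
  disc, so the division can be iterated without shrinking it.\<close>

lemma divided_difference:
  assumes f: "f holomorphic_on ball 0 \<rho>" and \<rho>: "\<rho> > 0" and M: "M > 0"
    and bd: "\<And>z. z \<in> ball 0 \<rho> \<Longrightarrow> norm (f z) \<le> M"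
  obtains g where "g holomorphic_on ball 0 \<rho>" "\<And>z. f z = f 0 + z * g z" "\<And>z. z \<in> ball 0 \<rho> \<Longrightarrow> norm (g z) \<le> 3 * M / \<rho>"
    "g 0 = deriv f 0"
proof -
  define g where "g z = (if z = 0 then deriv f 0 else (f z - f 0) / (z - 0))" for z
  have hg: "g holomorphic_on ball 0 \<rho>" unfolding g_def by (rule pole_lemma_open [OF f]) simp
  \<comment> \<open>The Schwarz lemma needs a strict bound by 1, while f - f 0 is only bounded by 2
    M; hence the normalization by 3 M.\<close>
  define h where "h z = (f (of_real \<rho> * z) - f 0) / (of_real (3 * M))" for z
  have scale: "of_real \<rho> * z \<in> ball 0 \<rho>" if "norm z < 1" for z :: complex
    using that \<rho> by (simp add: norm_mult)
  have hh: "h holomorphic_on ball 0 1"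
    unfolding h_def by (intro holomorphic_intros holomorphic_on_compose_gen [OF _ f, unfolded o_def]) (use M scale in auto)
  have h1: "norm (h z) < 1" if "norm z < 1" for z
  proof -
    have "norm (f (of_real \<rho> * z) - f 0) \<le> 2 * M"
      using norm_triangle_ineq4 [of "f (of_real \<rho> * z)" "f 0"] bd [OF scale [OF that]] bd [of 0] \<rho> by simp
    also have "\<dots> < 3 * M" using M by simp
    finally show ?thesis using M by (simp add: h_def norm_divide)
  qed
  have h0: "h 0 = 0" by (simp add: h_def)
  have nz: "norm (g z) \<le> 3 * M / \<rho>" if z: "z \<in> ball 0 \<rho>" "z \<noteq> 0" for z
  proof -
    have "norm (z / of_real \<rho>) < 1" using z \<rho> by (simp add: norm_divide)
    from Schwarz_Lemma(1) [OF hh h0 h1 this]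
    have "norm (h (z / of_real \<rho>)) \<le> norm z / \<rho>" using \<rho> by (simp add: norm_divide)
    then show ?thesis using \<rho> M z by (simp add: h_def g_def norm_divide field_simps)
  qed
  \<comment> \<open>The Schwarz estimate covers z \<noteq> 0; the value at 0 is reached by
    continuity.\<close>
  have "norm (g 0) \<le> 3 * M / \<rho>"
  proof -
    have "continuous_on (ball 0 \<rho>) g" by (rule holomorphic_on_imp_continuous_on [OF hg])
    then have "isCont g 0" using \<rho> by (simp add: continuous_on_eq_continuous_at)
    then have "((\<lambda>z. norm (g z)) \<longlongrightarrow> norm (g 0)) (at 0)" by (intro tendsto_norm) (simp add: isCont_def)
    moreover have "\<forall>\<^sub>F z in at 0. norm (g z) \<le> 3 * M / \<rho>"
      unfolding eventually_at using nz \<rho> by (intro exI [of _ \<rho>]) auto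
    ultimately show ?thesis by (rule tendsto_upperbound) simp
  qed
  then have bound: "norm (g z) \<le> 3 * M / \<rho>" if "z \<in> ball 0 \<rho>" for z using nz that by metis
  have eq: "f z = f 0 + z * g z" for z by (simp add: g_def)
  have "g 0 = deriv f 0" by (simp add: g_def)
  with hg eq bound show ?thesis by (rule that)
qed

lemma bounded_holomorphic_lipschitz:
  assumes f: "f holomorphic_on ball 0 \<rho>" and \<rho>: "\<rho> > 0" and M: "M > 0"
    and bd: "\<And>z. z \<in> ball 0 \<rho> \<Longrightarrow> norm (f z) \<le> M" and z: "z \<in> ball 0 \<rho>"
  shows "norm (f z - f 0) \<le> 3 * M / \<rho> * norm z"
proof -
  obtain g where g: "\<And>z. f z = f 0 + z * g z" "\<And>z. z \<in> ball 0 \<rho> \<Longrightarrow> norm (g z) \<le> 3 * M / \<rho>"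
    using divided_difference [OF f \<rho> M bd] by metis
  have "norm (f z - f 0) = norm z * norm (g z)" by (subst g(1)) (simp add: norm_mult)
  also have "\<dots> \<le> norm z * (3 * M / \<rho>)" by (intro mult_left_mono g z) auto
  finally show ?thesis by (simp add: mult.commute)
qed

text \<open>The second-order remainder is z times the increment of the divided difference, and the
  Lipschitz estimate for the latter brings in the second factor 3/\<rho>.\<close>

lemma bounded_holomorphic_taylor:
  assumes f: "f holomorphic_on ball 0 \<rho>" and \<rho>: "\<rho> > 0" and M: "M > 0"
    and bd: "\<And>z. z \<in> ball 0 \<rho> \<Longrightarrow> norm (f z) \<le> M" and z: "z \<in> ball 0 \<rho>"
  shows "norm (deriv f 0) \<le> 3 * M / \<rho>" "norm (f z - f 0 - deriv f 0 * z) \<le> 9 * M / \<rho>\<^sup>2 * (norm z)\<^sup>2"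
proof -
  obtain g where g: "g holomorphic_on ball 0 \<rho>" "\<And>z. f z = f 0 + z * g z" "\<And>z. z \<in> ball 0 \<rho> \<Longrightarrow> norm (g z) \<le> 3 * M / \<rho>"
      "g 0 = deriv f 0"
    using divided_difference [OF f \<rho> M bd] by metis
  show "norm (deriv f 0) \<le> 3 * M / \<rho>" using g(3) [of 0] g(4) \<rho> by simp
  have "3 * M / \<rho> > 0" using M \<rho> by simp
  from bounded_holomorphic_lipschitz [OF g(1) \<rho> this g(3) z]
  have l: "norm (g z - g 0) \<le> 9 * M / \<rho>\<^sup>2 * norm z" by (simp add: power2_eq_square)
  have "f z - f 0 - deriv f 0 * z = z * (g z - g 0)"
    using g(2) [of z] g(4) by (simp add: algebra_simps)
  then have "norm (f z - f 0 - deriv f 0 * z) = norm z * norm (g z - g 0)" by (simp add: norm_mult)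
  also have "\<dots> \<le> norm z * (9 * M / \<rho>\<^sup>2 * norm z)" by (intro mult_left_mono l) auto
  finally show "norm (f z - f 0 - deriv f 0 * z) \<le> 9 * M / \<rho>\<^sup>2 * (norm z)\<^sup>2" by (simp add: power2_eq_square mult_ac)
qed

section \<open>Pointwise cluster points by Tychonoff's theorem\<close>

text \<open>A substitute for Montel's theorem: a subsequence converging at all points need not
  exist, but a finer filter with pointwise limits does, because a product of discs is
  compact.\<close>

lemma cluster_filter:
  fixes F :: "'i \<Rightarrow> 'a \<Rightarrow> complex"
  assumes G: "G \<noteq> bot" and bd: "\<And>a. \<exists>M. \<forall>\<^sub>F i in G. norm (F i a) \<le> M"
  obtains G' L where "G' \<noteq> bot" "G' \<le> G" "\<And>a. ((\<lambda>i. F i a) \<longlongrightarrow> L a) G'"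
proof -
  obtain M where M: "\<And>a. \<forall>\<^sub>F i in G. norm (F i a) \<le> M a" using bd by metis
  \<comment> \<open>Each bound holds only eventually, with exceptions depending on a. Replacing
    offending values by 0 puts every \<open>F' i\<close> into the compact product and changes no
    limit.\<close>
  define F' where "F' i a = (if norm (F i a) \<le> M a then F i a else 0)" for i a
  define K where "K = (\<Pi>\<^sub>E a\<in>UNIV. cball (0::complex) \<bar>M a\<bar>)"
  have "compactin (product_topology (\<lambda>a. euclidean) UNIV) K"
    unfolding K_def by (subst compactin_PiE) auto
  then have K: "compact K" by (simp add: euclidean_product_topology)
  have F'K: "F' i \<in> K" for i by (auto simp: K_def F'_def)
  have nb: "filtermap F' G \<noteq> bot" using G by (simp add: filtermap_bot_iff)
  have "\<forall>\<^sub>F x in filtermap F' G. x \<in> K" using F'K by (simp add: eventually_filtermap)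
  then obtain L where L: "inf (nhds L) (filtermap F' G) \<noteq> bot"
    using K nb unfolding compact_filter by blast
  \<comment> \<open>Pulling the neighbourhoods of the cluster point back to the index set turns
    clustering into convergence along a finer filter.\<close>
  define G' where "G' = inf G (filtercomap F' (nhds L))"
  have "G' \<noteq> bot"
  proof
    assume "G' = bot"
    then have "eventually (\<lambda>_. False) G'" by simp
    then obtain Q R where QR: "eventually Q G" "eventually R (filtercomap F' (nhds L))" "\<And>x. Q x \<Longrightarrow> R x \<Longrightarrow> False"
      unfolding G'_def eventually_inf by blast
    obtain S where S: "eventually S (nhds L)" "\<And>x. S (F' x) \<Longrightarrow> R x"
      using QR(2) unfolding eventually_filtercomap by blast
    have "eventually (\<lambda>x. \<not> S x) (filtermap F' G)"
      unfolding eventually_filtermap using QR(1) by eventually_elim (use QR S in blast)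
    then have "eventually (\<lambda>_. False) (inf (nhds L) (filtermap F' G))"
      unfolding eventually_inf using S(1) by blast
    then show False using L by (simp add: trivial_limit_def)
  qed
  moreover have "G' \<le> G" by (simp add: G'_def)
  moreover have "((\<lambda>i. F i a) \<longlongrightarrow> L a) G'" for a
  proof -
    have "filterlim F' (nhds L) G'"
      unfolding G'_def filterlim_def using filtermap_filtercomap by (metis filtermap_mono inf_le2 order_trans)
    then have "((\<lambda>i. F' i a) \<longlongrightarrow> L a) G'"
      by (rule continuous_on_tendsto_compose [OF continuous_on_product_coordinates [of a]]) auto
    moreover have "\<forall>\<^sub>F i in G'. F' i a = F i a"
      using filter_leD [OF \<open>G' \<le> G\<close> M [of a]] by eventually_elim (simp add: F'_def)
    ultimately show ?thesis by (rule Lim_transform_eventually)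
  qed
  ultimately show ?thesis using that by blast
qed

section \<open>Limits of bounded holomorphic functions\<close>

lemma holomorphic_on_line:
  assumes E: "complex_banach_space E" and f: "vholomorphic_on E complex_space U f"
    and p: "p \<in> carrier E" and v: "v \<in> carrier E" and D: "open D" "\<And>z. z \<in> D \<Longrightarrow> p \<oplus>\<^bsub>E\<^esub> z \<odot>\<^bsub>E\<^esub> v \<in> U"
  shows "(\<lambda>z. f (p \<oplus>\<^bsub>E\<^esub> z \<odot>\<^bsub>E\<^esub> v)) holomorphic_on D"
  unfolding holomorphic_on_open [OF D(1)]
proof (intro ballI)
  fix z assume z: "z \<in> D"
  then obtain A where "has_cderivative_at E complex_space U f A (p \<oplus>\<^bsub>E\<^esub> z \<odot>\<^bsub>E\<^esub> v)"
    using f D unfolding vholomorphic_on_def by metis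
  moreover have "openin (vtop E) U" using f by (simp add: vholomorphic_on_def)
  ultimately have "((\<lambda>z. f (p \<oplus>\<^bsub>E\<^esub> z \<odot>\<^bsub>E\<^esub> v)) has_field_derivative A v) (at z)"
    by (intro cderivative_line [OF E _ p v D(2) [OF z]])
  then show "\<exists>f'. ((\<lambda>z. f (p \<oplus>\<^bsub>E\<^esub> z \<odot>\<^bsub>E\<^esub> v)) has_field_derivative f') (at z)" by (rule exI [of _ "A v"])
qed

text \<open>On the complex line through x in direction v, the ball contains a disc of radius \<rho>
  divided by the norm of v. The one-variable estimates there have constants that, in terms of the
  norm, do not depend on v.\<close>

lemma bounded_on_ball_estimates:
  assumes E: "complex_banach_space E" and f: "vholomorphic_on E complex_space U f"
    and B: "vball E x \<rho> \<subseteq> U" and x: "x \<in> carrier E" and \<rho>: "\<rho> > 0" and M: "M > 0"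
    and bd: "\<And>y. y \<in> vball E x \<rho> \<Longrightarrow> cmod (f y) \<le> M"
    and D: "has_cderivative_at E complex_space U f D x"
  shows "y \<in> vball E x \<rho> \<Longrightarrow> cmod (f y - f x) \<le> 3 * M / \<rho> * vdist E y x"
    and "v \<in> carrier E \<Longrightarrow> cmod (D v) \<le> 3 * M / \<rho> * vnorm E v"
    and "y \<in> vball E x \<rho> \<Longrightarrow> cmod (f y - f x - D (y \<ominus>\<^bsub>E\<^esub> x)) \<le> 9 * M / \<rho>\<^sup>2 * (vdist E y x)\<^sup>2"
proof -
  interpret E: complex_banach_space E by fact
  have U: "openin (vtop E) U" using f by (simp add: vholomorphic_on_def)
  have xU: "x \<in> U" using B x \<rho> by auto
  have blD: "bounded_clinear E complex_space D" using D by (simp add: has_cderivative_at_def)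
  note Ds = bounded_clinear_simps [OF E complex_banach_space_complex_space blD]
  have D0: "D \<zero>\<^bsub>E\<^esub> = 0" using Ds(3) [of "\<zero>\<^bsub>E\<^esub>" 0] by simp
  have main: "cmod (D v) \<le> 3 * M / (\<rho> / vnorm E v)"
      "z \<in> ball 0 (\<rho> / vnorm E v) \<Longrightarrow> cmod (f (x \<oplus>\<^bsub>E\<^esub> z \<odot>\<^bsub>E\<^esub> v) - f x) \<le> 3 * M / (\<rho> / vnorm E v) * cmod z"
      "z \<in> ball 0 (\<rho> / vnorm E v) \<Longrightarrow> cmod (f (x \<oplus>\<^bsub>E\<^esub> z \<odot>\<^bsub>E\<^esub> v) - f x - D v * z) \<le> 9 * M / (\<rho> / vnorm E v)\<^sup>2 * (cmod z)\<^sup>2"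
    if v: "v \<in> carrier E" "vnorm E v > 0" for v z
  proof -
    let ?g = "\<lambda>z. f (x \<oplus>\<^bsub>E\<^esub> z \<odot>\<^bsub>E\<^esub> v)" and ?r = "\<rho> / vnorm E v"
    have r: "?r > 0" using v \<rho> by simp
    have inB: "x \<oplus>\<^bsub>E\<^esub> z \<odot>\<^bsub>E\<^esub> v \<in> vball E x \<rho>" if "z \<in> ball 0 ?r" for z
    proof -
      have "vdist E (x \<oplus>\<^bsub>E\<^esub> 0 \<odot>\<^bsub>E\<^esub> v) (x \<oplus>\<^bsub>E\<^esub> z \<odot>\<^bsub>E\<^esub> v) = cmod z * vnorm E v"
        using E.vdist_line [OF x v(1), of 0 z] by simp
      also have "\<dots> < \<rho>" using that v by (simp add: field_simps)
      finally show ?thesis using x v by simp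
    qed
    have hol: "?g holomorphic_on ball 0 ?r"
      by (rule holomorphic_on_line [OF E f x v(1)]) (use inB B in auto)
    have bg: "cmod (?g z) \<le> M" if "z \<in> ball 0 ?r" for z using bd inB that by blast
    have g0: "?g 0 = f x" using x v by simp
    have xU': "x \<oplus>\<^bsub>E\<^esub> 0 \<odot>\<^bsub>E\<^esub> v \<in> U" using x v xU by simp
    have "has_cderivative_at E complex_space U f D (x \<oplus>\<^bsub>E\<^esub> 0 \<odot>\<^bsub>E\<^esub> v)" using x v D by simp
    from cderivative_line [OF E U x v(1) xU' this] have "(?g has_field_derivative D v) (at 0)" .
    then have d: "deriv ?g 0 = D v" by (rule DERIV_imp_deriv)
    show "cmod (D v) \<le> 3 * M / ?r"
      using bounded_holomorphic_taylor(1) [OF hol r M bg, of 0] r d by simp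
    show "cmod (?g z - f x) \<le> 3 * M / ?r * cmod z" if "z \<in> ball 0 ?r"
      using bounded_holomorphic_lipschitz [OF hol r M bg that] unfolding g0 by simp
    show "cmod (?g z - f x - D v * z) \<le> 9 * M / ?r\<^sup>2 * (cmod z)\<^sup>2" if "z \<in> ball 0 ?r"
      using bounded_holomorphic_taylor(2) [OF hol r M bg that] unfolding g0 d by simp
  qed
  show "cmod (D v) \<le> 3 * M / \<rho> * vnorm E v" if v: "v \<in> carrier E"
  proof (cases "vnorm E v = 0")
    case True
    then show ?thesis using E.vnorm_eq_zero [OF v] D0 by simp
  next
    case False
    then show ?thesis using main(1) [OF v] E.vnorm_nonneg [OF v] by simp
  qed
  have both: "cmod (f y - f x) \<le> 3 * M / \<rho> * vdist E y x \<and>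
      cmod (f y - f x - D (y \<ominus>\<^bsub>E\<^esub> x)) \<le> 9 * M / \<rho>\<^sup>2 * (vdist E y x)\<^sup>2" if y: "y \<in> vball E x \<rho>"
  proof (cases "y = x")
    case True
    then show ?thesis using x D0 E.r_neg [of x] by (simp add: a_minus_def)
  next
    case False
    define v where "v = y \<ominus>\<^bsub>E\<^esub> x"
    have yC: "y \<in> carrier E" using y by simp
    have v: "v \<in> carrier E" using yC x by (simp add: v_def)
    have n: "vdist E y x = vnorm E v" using yC x by (simp add: v_def E.vdist_eq)
    moreover have "vdist E y x \<noteq> 0" using False yC x Metric_space.zero [OF E.metric] by blast
    ultimately have v0: "vnorm E v > 0" using E.vnorm_nonneg [OF v] by simp
    have "vnorm E v < \<rho>" using y n E.vdist_commute [of x y] by simp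
    \<comment> \<open>With v = y - x the point y has parameter 1, which lies in the disc because the
      norm of v is less than \<rho>.\<close>
    then have 1: "1 \<in> ball (0::complex) (\<rho> / vnorm E v)" using v0 by simp
    have "x \<oplus>\<^bsub>E\<^esub> 1 \<odot>\<^bsub>E\<^esub> v = y" using yC x unfolding v_def by (intro E.eq_dual) (auto simp: E.unit_dualD)
    then show ?thesis
      using main(2,3) [OF v v0 1] v0 unfolding n by (simp add: v_def [symmetric] power_divide mult.commute)
  qed
  show "cmod (f y - f x) \<le> 3 * M / \<rho> * vdist E y x" if "y \<in> vball E x \<rho>" using both [OF that] by blast
  show "cmod (f y - f x - D (y \<ominus>\<^bsub>E\<^esub> x)) \<le> 9 * M / \<rho>\<^sup>2 * (vdist E y x)\<^sup>2" if "y \<in> vball E x \<rho>" using both [OF that] by blast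
qed

lemma mholomorphic_plane_chart:
  assumes A: "atlas_manifold A" and f: "mholomorphic A complex_plane f" and c: "c \<in> atlas A"
  shows "vholomorphic_on (cmodel c) complex_space (cmap c ` cdom c) (f \<circ> cinv c)"
  using f c unfolding mholomorphic_def by auto

text \<open>The estimates on balls have constants that are eventually independent of i. The
  Lipschitz one upgrades pointwise to locally uniform convergence; the quadratic one survives the
  limit and makes a cluster point of the derivatives the derivative of L.\<close>

lemma holomorphic_filter_limit:
  fixes h :: "'i \<Rightarrow> 'p \<Rightarrow> complex" and A :: "('p, 'v) banach_mfd"
  assumes A: "atlas_manifold A" and G: "G \<noteq> bot"
    and h: "\<And>i. mholomorphic A complex_plane (h i)"
    and bd: "\<And>x. x \<in> points A \<Longrightarrow> \<exists>U M. openin (mtop A) U \<and> x \<in> U \<and> (\<forall>\<^sub>F i in G. \<forall>y\<in>U. cmod (h i y) \<le> M)"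
    and lim: "\<And>x. x \<in> points A \<Longrightarrow> ((\<lambda>i. h i x) \<longlongrightarrow> L x) G"
  shows "mholomorphic A complex_plane L"
    and "x \<in> points A \<Longrightarrow> e > 0 \<Longrightarrow> \<exists>U. openin (mtop A) U \<and> x \<in> U \<and> (\<forall>\<^sub>F i in G. \<forall>y\<in>U. cmod (h i y - L x) < e)"
proof -
  interpret A: atlas_manifold A by fact
  have local: "(\<forall>e>0. \<exists>U. openin (mtop A) U \<and> x \<in> U \<and> (\<forall>\<^sub>F i in G. \<forall>y\<in>U. cmod (h i y - L x) < e)) \<and>
      (\<exists>V D. openin (vtop (cmodel c)) V \<and> cmap c x \<in> V \<and> V \<subseteq> cmap c ` cdom c \<and>
        has_cderivative_at (cmodel c) complex_space V (L \<circ> cinv c) D (cmap c x))"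
    if c: "c \<in> atlas A" "x \<in> cdom c" for x c
  proof -
    let ?E = "cmodel c" and ?x = "cmap c x" and ?R = "cmap c ` cdom c"
    let ?f = "\<lambda>i. h i \<circ> cinv c"
    interpret E: complex_banach_space ?E by (rule A.model [OF c(1)])
    have xA: "x \<in> points A" using c A.cdom_subset by blast
    have xE: "?x \<in> carrier ?E" using A.cmap_in_carrier c by blast
    obtain U M0 where U: "openin (mtop A) U" "x \<in> U" "\<forall>\<^sub>F i in G. \<forall>y\<in>U. cmod (h i y) \<le> M0" using bd [OF xA] by blast
    define M where "M = max M0 1"
    have M: "M > 0" by (simp add: M_def)
    obtain \<rho> where \<rho>: "\<rho> > 0" "vball ?E ?x \<rho> \<subseteq> cmap c ` (cdom c \<inter> U)" "A.chart_ball c x \<rho> \<subseteq> U"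
      using A.chart_ball_small [OF c U(1,2)] by metis
    have BR: "vball ?E ?x \<rho> \<subseteq> ?R" using \<rho>(2) by blast
    have xR: "?x \<in> ?R" using c by blast
    have hol: "vholomorphic_on ?E complex_space ?R (?f i)" for i by (rule mholomorphic_plane_chart [OF A h c(1)])
    then have "\<exists>D. has_cderivative_at ?E complex_space ?R (?f i) D ?x" for i
      using xR unfolding vholomorphic_on_def by blast
    then obtain D where D: "\<And>i. has_cderivative_at ?E complex_space ?R (?f i) (D i) ?x" by metis
    have ev: "\<forall>\<^sub>F i in G. \<forall>y\<in>vball ?E ?x \<rho>. cmod (?f i y) \<le> M"
      using U(3)
    proof eventually_elim
      case (elim i)
      show ?case
      proof
        fix y assume "y \<in> vball ?E ?x \<rho>"
        then obtain z where "z \<in> cdom c" "z \<in> U" "y = cmap c z" using \<rho>(2) by blast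
        then have "cmod (?f i y) \<le> M0" using elim A.cinv_cmap [OF c(1)] by simp
        then show "cmod (?f i y) \<le> M" by (simp add: M_def)
      qed
    qed
    have L0: "L (cinv c ?x) = L x" using A.cinv_cmap [OF c] by simp
    have limf: "((\<lambda>i. ?f i y) \<longlongrightarrow> (L \<circ> cinv c) y) G" if "y \<in> ?R" for y
      using that lim A.cinv_cmap [OF c(1)] A.cdom_subset [OF c(1)] by auto
    have "\<exists>U. openin (mtop A) U \<and> x \<in> U \<and> (\<forall>\<^sub>F i in G. \<forall>y\<in>U. cmod (h i y - L x) < e)" if e: "e > 0" for e
    proof -
      \<comment> \<open>On a ball of this radius the Lipschitz constant 3 M / \<rho> allows an
        increment below e / 2.\<close>
      define r where "r = min \<rho> (e / (2 * (3 * M / \<rho>)))"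
      have r: "r > 0" using \<rho>(1) M e by (simp add: r_def)
      have "\<forall>\<^sub>F i in G. cmod (h i x - L x) < e / 2"
        using tendstoD [OF lim [OF xA], of "e / 2"] e by (simp add: dist_norm)
      with ev have "\<forall>\<^sub>F i in G. \<forall>y\<in>A.chart_ball c x r. cmod (h i y - L x) < e"
      proof eventually_elim
        case (elim i)
        show ?case
        proof
          fix y assume y: "y \<in> A.chart_ball c x r"
          then have y': "y \<in> cdom c" "cmap c y \<in> vball ?E ?x \<rho>" "vdist ?E (cmap c y) ?x < r"
            by (auto simp: A.chart_ball_def r_def E.vdist_commute)
          have "cmod (?f i (cmap c y) - ?f i ?x) \<le> 3 * M / \<rho> * vdist ?E (cmap c y) ?x"
            by (rule bounded_on_ball_estimates(1) [OF A.model [OF c(1)] hol BR xE \<rho>(1) M _ D y'(2)]) (use elim in blast)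
          also have "\<dots> < 3 * M / \<rho> * r" using y' M \<rho>(1) by (intro mult_strict_left_mono) auto
          also have "\<dots> \<le> 3 * M / \<rho> * (e / (2 * (3 * M / \<rho>)))" using M \<rho>(1) by (intro mult_left_mono) (auto simp: r_def)
          also have "\<dots> = e / 2" using M \<rho>(1) by simp
          finally have "cmod (h i y - h i x) < e / 2" using A.cinv_cmap [OF c(1)] c y' by simp
          then show "cmod (h i y - L x) < e"
            using elim norm_triangle_ineq [of "h i y - h i x" "h i x - L x"] by simp
        qed
      qed
      then show ?thesis
        by (intro exI [of _ "A.chart_ball c x r"] conjI A.openin_chart_ball A.chart_ball_self c r)
    qed
    moreover have "\<exists>V D. openin (vtop ?E) V \<and> ?x \<in> V \<and> V \<subseteq> ?R \<and> has_cderivative_at ?E complex_space V (L \<circ> cinv c) D ?x"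
    proof -
      have blD: "bounded_clinear ?E complex_space (D i)" for i using D [of i] by (simp add: has_cderivative_at_def)
      note Ds = bounded_clinear_simps [OF A.model [OF c(1)] complex_banach_space_complex_space blD]
      have Dbd: "\<forall>\<^sub>F i in G. cmod (D i v) \<le> 3 * M / \<rho> * vnorm ?E v" if "v \<in> carrier ?E" for v
        using ev
      proof eventually_elim
        case (elim i)
        show ?case
          by (rule bounded_on_ball_estimates(2) [OF A.model [OF c(1)] hol BR xE \<rho>(1) M _ D that]) (use elim in blast)
      qed
      \<comment> \<open>Extended by 0, because \<open>cluster_filter\<close> needs eventual bounds
        at every element of the type, not only on the carrier.\<close>
      define F where "F i v = (if v \<in> carrier ?E then D i v else 0)" for i v
      have "\<exists>K. \<forall>\<^sub>F i in G. cmod (F i v) \<le> K" for v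
        using Dbd [of v] by (cases "v \<in> carrier ?E") (auto simp: F_def intro: exI [of _ 0])
      then obtain G' T where G': "G' \<noteq> bot" "G' \<le> G" "\<And>v. ((\<lambda>i. F i v) \<longlongrightarrow> T v) G'"
        using cluster_filter [OF G, of F] by metis
      have DT: "((\<lambda>i. D i v) \<longlongrightarrow> T v) G'" if "v \<in> carrier ?E" for v using G'(3) [of v] that by (simp add: F_def)
      have "T (v \<oplus>\<^bsub>?E\<^esub> w) = T v + T w" if "v \<in> carrier ?E" "w \<in> carrier ?E" for v w
      proof -
        have "((\<lambda>i. D i (v \<oplus>\<^bsub>?E\<^esub> w)) \<longlongrightarrow> T v + T w) G'"
          using tendsto_add [OF DT [OF that(1)] DT [OF that(2)]] that by (simp add: Ds)
        then show ?thesis using tendsto_unique [OF G'(1) DT] that by blast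
      qed
      moreover have "T (a \<odot>\<^bsub>?E\<^esub> v) = a * T v" if "v \<in> carrier ?E" for v a
      proof -
        have "((\<lambda>i. D i (a \<odot>\<^bsub>?E\<^esub> v)) \<longlongrightarrow> a * T v) G'"
          using tendsto_mult_left [OF DT [OF that]] that by (simp add: Ds)
        then show ?thesis using tendsto_unique [OF G'(1) DT] that by blast
      qed
      moreover have "cmod (T v) \<le> 3 * M / \<rho> * vnorm ?E v" if "v \<in> carrier ?E" for v
        by (rule tendsto_upperbound [OF tendsto_norm [OF DT [OF that]] _ G'(1)]) (rule filter_leD [OF G'(2) Dbd [OF that]])
      ultimately have blT: "bounded_clinear ?E complex_space T"
        unfolding bounded_clinear_def by (auto intro!: exI [of _ "3 * M / \<rho>"])
      have rem: "cmod ((L \<circ> cinv c) y - L x - T (y \<ominus>\<^bsub>?E\<^esub> ?x)) \<le> 9 * M / \<rho>\<^sup>2 * (vdist ?E y ?x)\<^sup>2" if y: "y \<in> vball ?E ?x \<rho>" for y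
      proof -
        have yE: "y \<ominus>\<^bsub>?E\<^esub> ?x \<in> carrier ?E" using y xE by simp
        have yR: "y \<in> ?R" using y BR by blast
        have 1: "((\<lambda>i. ?f i y - ?f i ?x - D i (y \<ominus>\<^bsub>?E\<^esub> ?x)) \<longlongrightarrow> (L \<circ> cinv c) y - (L \<circ> cinv c) ?x - T (y \<ominus>\<^bsub>?E\<^esub> ?x)) G'"
          by (intro tendsto_diff DT [OF yE] tendsto_mono [OF G'(2)] limf yR xR)
        have "\<forall>\<^sub>F i in G. cmod (?f i y - ?f i ?x - D i (y \<ominus>\<^bsub>?E\<^esub> ?x)) \<le> 9 * M / \<rho>\<^sup>2 * (vdist ?E y ?x)\<^sup>2"
          using ev
        proof eventually_elim
          case (elim i)
          show ?case
            by (rule bounded_on_ball_estimates(3) [OF A.model [OF c(1)] hol BR xE \<rho>(1) M _ D y]) (use elim in blast)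
        qed
        from tendsto_upperbound [OF tendsto_norm [OF 1] filter_leD [OF G'(2) this] G'(1)]
        show ?thesis using L0 by simp
      qed
      have "has_cderivative_at ?E complex_space (vball ?E ?x \<rho>) (L \<circ> cinv c) T ?x"
        unfolding has_cderivative_at_def
      proof (intro conjI allI impI blT)
        fix e :: real assume e: "e > 0"
        let ?C = "9 * M / \<rho>\<^sup>2"
        have C: "?C > 0" using M \<rho>(1) by simp
        show "\<exists>\<delta>>0. \<forall>y\<in>vball ?E ?x \<rho>. vdist ?E y ?x < \<delta> \<longrightarrow>
          vnorm complex_space ((L \<circ> cinv c) y \<ominus>\<^bsub>complex_space\<^esub> (L \<circ> cinv c) ?x \<ominus>\<^bsub>complex_space\<^esub> T (y \<ominus>\<^bsub>?E\<^esub> ?x)) \<le> e * vdist ?E y ?x"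
        proof (intro exI [of _ "e / ?C"] conjI ballI impI)
          show "0 < e / ?C" using e C by (rule divide_pos_pos)
          fix y assume y: "y \<in> vball ?E ?x \<rho>" "vdist ?E y ?x < e / ?C"
          have "?C * vdist ?E y ?x \<le> e" using y(2) unfolding pos_less_divide_eq [OF C] mult.commute [of _ ?C] by (rule less_imp_le)
          then have "(?C * vdist ?E y ?x) * vdist ?E y ?x \<le> e * vdist ?E y ?x" by (intro mult_right_mono) auto
          then have "?C * (vdist ?E y ?x)\<^sup>2 \<le> e * vdist ?E y ?x" by (simp only: power2_eq_square mult.assoc)
          with rem [OF y(1)]
          show "vnorm complex_space ((L \<circ> cinv c) y \<ominus>\<^bsub>complex_space\<^esub> (L \<circ> cinv c) ?x \<ominus>\<^bsub>complex_space\<^esub> T (y \<ominus>\<^bsub>?E\<^esub> ?x)) \<le> e * vdist ?E y ?x"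
            using L0 by simp
        qed
      qed
      then show ?thesis
        using BR xE \<rho>(1) by (intro exI [of _ "vball ?E ?x \<rho>"] exI [of _ T] conjI E.openin_vball) auto
    qed
    ultimately show ?thesis by blast
  qed
  have chart: "\<exists>c. c \<in> atlas A \<and> x \<in> cdom c" if "x \<in> points A" for x using that A.covering by auto
  show equi: "\<exists>U. openin (mtop A) U \<and> x \<in> U \<and> (\<forall>\<^sub>F i in G. \<forall>y\<in>U. cmod (h i y - L x) < e)" if "x \<in> points A" "e > 0" for x e
  proof -
    obtain c where c: "c \<in> atlas A" "x \<in> cdom c" using chart [OF \<open>x \<in> points A\<close>] by blast
    show ?thesis using conjunct1 [OF local [OF c]] \<open>e > 0\<close> by (elim allE impE)
  qed
  have cont: "continuous_map (mtop A) euclidean L"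
    unfolding mtopology_is_euclidean [symmetric] Met_TC.continuous_map_to_metric
  proof (intro ballI allI impI)
    fix x and e :: real assume x: "x \<in> points A" and e: "e > 0"
    obtain U where U: "openin (mtop A) U" "x \<in> U" "\<forall>\<^sub>F i in G. \<forall>y\<in>U. cmod (h i y - L x) < e / 2"
      using equi [OF x, of "e / 2"] e by auto
    have "cmod (L y - L x) \<le> e / 2" if y: "y \<in> U" for y
    proof (rule tendsto_upperbound [OF tendsto_norm [OF tendsto_diff [OF lim tendsto_const]] _ G])
      show "y \<in> points A" using openin_subset [OF U(1)] y by blast
      show "\<forall>\<^sub>F i in G. cmod (h i y - L x) \<le> e / 2" using U(3) by eventually_elim (use y in force)
    qed
    then have "\<forall>y\<in>U. L y \<in> Met_TC.mball (L x) e"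
      using e by (force simp: dist_norm norm_minus_commute)
    with U show "\<exists>U. openin (mtop A) U \<and> x \<in> U \<and> (\<forall>y\<in>U. L y \<in> Met_TC.mball (L x) e)" by blast
  qed
  have "mdiff A complex_plane L x" if "x \<in> points A" for x
    unfolding mdiff_def
  proof (intro ballI impI)
    fix c d assume c: "c \<in> atlas A" and d: "d \<in> atlas complex_plane" and xc: "x \<in> cdom c" "L x \<in> cdom d"
    from conjunct2 [OF local [OF c xc(1)]] obtain V D where
      V: "openin (vtop (cmodel c)) V" "cmap c x \<in> V" "V \<subseteq> cmap c ` cdom c" "has_cderivative_at (cmodel c) complex_space V (L \<circ> cinv c) D (cmap c x)"
      by (elim exE conjE)
    then show "\<exists>V D. openin (vtop (cmodel c)) V \<and> cmap c x \<in> V \<and> V \<subseteq> cmap c ` (cdom c \<inter> L -` cdom d) \<and>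
        has_cderivative_at (cmodel c) (cmodel d) V (cmap d \<circ> L \<circ> cinv c) D (cmap c x)"
      using d by (intro exI [of _ V] exI [of _ D]) simp
  qed
  then show "mholomorphic A complex_plane L"
    using cont unfolding mholomorphic_iff [OF A atlas_manifold.chart_target [OF atlas_manifold_complex_plane]] by simp
qed

lemma mholomorphic_diff:
  assumes A: "atlas_manifold A" and f: "mholomorphic A complex_plane f" and g: "mholomorphic A complex_plane g"
  shows "mholomorphic A complex_plane (\<lambda>x. f x - g x)"
proof -
  interpret A: atlas_manifold A by fact
  note I = mholomorphic_iff [OF A atlas_manifold.chart_target [OF atlas_manifold_complex_plane]]
  have "continuous_map (mtop A) euclidean f" "continuous_map (mtop A) euclidean g" using f g by (auto simp: mholomorphic_def)
  then have cont: "continuous_map (mtop A) euclidean (\<lambda>x. f x - g x)" by (rule continuous_map_diff)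
  have "mdiff A complex_plane (\<lambda>x. f x - g x) x" for x
    unfolding mdiff_def
  proof (intro ballI impI)
    fix c d assume c: "c \<in> atlas A" and d: "d \<in> atlas complex_plane" and xc: "x \<in> cdom c"
    let ?V = "cmap c ` cdom c" and ?E = "cmodel c"
    interpret E: complex_banach_space ?E by (rule A.model [OF c])
    have xV: "cmap c x \<in> ?V" using xc by blast
    obtain D1 where D1: "has_cderivative_at ?E complex_space ?V (f \<circ> cinv c) D1 (cmap c x)"
      using mholomorphic_plane_chart [OF A f c] xV unfolding vholomorphic_on_def by blast
    obtain D2 where D2: "has_cderivative_at ?E complex_space ?V (g \<circ> cinv c) D2 (cmap c x)"
      using mholomorphic_plane_chart [OF A g c] xV unfolding vholomorphic_on_def by blast
    have bl: "bounded_clinear ?E complex_space D1" "bounded_clinear ?E complex_space D2"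
      using D1 D2 by (auto simp: has_cderivative_at_def)
    have "\<exists>K. \<forall>v\<in>carrier ?E. cmod (D1 v) \<le> K * vnorm ?E v"
      using bl(1) unfolding bounded_clinear_def by simp
    then obtain K1 where K1: "\<And>v. v \<in> carrier ?E \<Longrightarrow> cmod (D1 v) \<le> K1 * vnorm ?E v" by blast
    have "\<exists>K. \<forall>v\<in>carrier ?E. cmod (D2 v) \<le> K * vnorm ?E v"
      using bl(2) unfolding bounded_clinear_def by simp
    then obtain K2 where K2: "\<And>v. v \<in> carrier ?E \<Longrightarrow> cmod (D2 v) \<le> K2 * vnorm ?E v" by blast
    have "cmod (D1 v - D2 v) \<le> (K1 + K2) * vnorm ?E v" if "v \<in> carrier ?E" for v
      using norm_triangle_ineq4 [of "D1 v" "D2 v"] K1 [OF that] K2 [OF that] by (simp add: algebra_simps)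
    then have "\<exists>K. \<forall>v\<in>carrier ?E. cmod (D1 v - D2 v) \<le> K * vnorm ?E v" by blast
    then have "bounded_clinear ?E complex_space (\<lambda>v. D1 v - D2 v)"
      using bl unfolding bounded_clinear_def by (simp add: algebra_simps)
    moreover have "\<exists>\<delta>>0. \<forall>y\<in>?V. vdist ?E y (cmap c x) < \<delta> \<longrightarrow>
        cmod ((f (cinv c y) - g (cinv c y)) - (f (cinv c (cmap c x)) - g (cinv c (cmap c x))) - (D1 (y \<ominus>\<^bsub>?E\<^esub> cmap c x) - D2 (y \<ominus>\<^bsub>?E\<^esub> cmap c x)))
        \<le> e * vdist ?E y (cmap c x)" if e: "e > 0" for e
    proof -
      obtain d1 where d1: "d1 > 0" "\<And>y. y \<in> ?V \<Longrightarrow> vdist ?E y (cmap c x) < d1 \<Longrightarrow>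
          cmod (f (cinv c y) - f (cinv c (cmap c x)) - D1 (y \<ominus>\<^bsub>?E\<^esub> cmap c x)) \<le> e / 2 * vdist ?E y (cmap c x)"
        using D1 [unfolded has_cderivative_at_def, THEN conjunct2, THEN spec, THEN mp, of "e / 2"] e by auto
      obtain d2 where d2: "d2 > 0" "\<And>y. y \<in> ?V \<Longrightarrow> vdist ?E y (cmap c x) < d2 \<Longrightarrow>
          cmod (g (cinv c y) - g (cinv c (cmap c x)) - D2 (y \<ominus>\<^bsub>?E\<^esub> cmap c x)) \<le> e / 2 * vdist ?E y (cmap c x)"
        using D2 [unfolded has_cderivative_at_def, THEN conjunct2, THEN spec, THEN mp, of "e / 2"] e by auto
      show ?thesis
      proof (intro exI [of _ "min d1 d2"] conjI ballI impI)
        fix y assume y: "y \<in> ?V" "vdist ?E y (cmap c x) < min d1 d2"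
        let ?a = "f (cinv c y) - f (cinv c (cmap c x)) - D1 (y \<ominus>\<^bsub>?E\<^esub> cmap c x)"
          and ?b = "g (cinv c y) - g (cinv c (cmap c x)) - D2 (y \<ominus>\<^bsub>?E\<^esub> cmap c x)"
        have "cmod (?a - ?b) \<le> e / 2 * vdist ?E y (cmap c x) + e / 2 * vdist ?E y (cmap c x)"
          using norm_triangle_ineq4 [of ?a ?b] d1(2) [OF y(1)] d2(2) [OF y(1)] y(2) by simp
        then show "cmod ((f (cinv c y) - g (cinv c y)) - (f (cinv c (cmap c x)) - g (cinv c (cmap c x))) - (D1 (y \<ominus>\<^bsub>?E\<^esub> cmap c x) - D2 (y \<ominus>\<^bsub>?E\<^esub> cmap c x)))
          \<le> e * vdist ?E y (cmap c x)" by (simp add: algebra_simps)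
      qed (use d1 d2 in auto)
    qed
    ultimately have "has_cderivative_at ?E complex_space ?V ((\<lambda>x. f x - g x) \<circ> cinv c) (\<lambda>v. D1 v - D2 v) (cmap c x)"
      unfolding has_cderivative_at_def by simp
    then show "\<exists>V D. openin (vtop ?E) V \<and> cmap c x \<in> V \<and> V \<subseteq> cmap c ` (cdom c \<inter> (\<lambda>x. f x - g x) -` cdom d) \<and>
        has_cderivative_at ?E (cmodel d) V (cmap d \<circ> (\<lambda>x. f x - g x) \<circ> cinv c) D (cmap c x)"
      using d xV A.open_range [OF c] by (intro exI [of _ ?V] exI [of _ "\<lambda>v. D1 v - D2 v"]) simp
  qed
  then show ?thesis using cont unfolding I by simp
qed

text \<open>The Arendt--Nikolski argument, with cluster points along filters instead of functionals on
  sequence spaces: if a cluster point differed from the limit along another filter, their difference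
  would be a nonzero holomorphic function vanishing on \<open>S\<close>.\<close>

theorem Vitali_bounded:
  fixes h :: "nat \<Rightarrow> 'p \<Rightarrow> complex" and A :: "('p, 'v) banach_mfd"
  assumes A: "banach_manifold A"
    and h: "\<And>k. mholomorphic A complex_plane (h k)"
    and bd: "\<And>x. x \<in> points A \<Longrightarrow> \<exists>U M. openin (mtop A) U \<and> x \<in> U \<and> (\<forall>\<^sub>F k in sequentially. \<forall>y\<in>U. cmod (h k y) \<le> M)"
    and S: "S \<subseteq> points A" "uniq_set A S \<noteq> {}" "\<And>x. x \<in> S \<Longrightarrow> convergent (\<lambda>k. h k x)"
  obtains L where "mholomorphic A complex_plane L"
    "\<And>x e. x \<in> points A \<Longrightarrow> e > 0 \<Longrightarrow>
      \<exists>U. openin (mtop A) U \<and> x \<in> U \<and> (\<forall>\<^sub>F k in sequentially. \<forall>y\<in>U. cmod (h k y - L x) < e)"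
    "\<And>x. x \<in> points A \<Longrightarrow> (\<lambda>k. h k x) \<longlonglongrightarrow> L x"
proof -
  interpret banach_manifold A by fact
  note AA = atlas_manifold
  have limit: "\<exists>G' L. G' \<noteq> bot \<and> G' \<le> G \<and> (\<forall>x\<in>points A. ((\<lambda>k. h k x) \<longlongrightarrow> L x) G') \<and> mholomorphic A complex_plane L"
    if G: "G \<noteq> bot" "G \<le> sequentially" for G
  proof -
    define F where "F k x = (if x \<in> points A then h k x else 0)" for k x
    have "\<exists>M. \<forall>\<^sub>F k in G. cmod (F k x) \<le> M" for x
    proof (cases "x \<in> points A")
      case True
      then obtain U M where "x \<in> U" "\<forall>\<^sub>F k in sequentially. \<forall>y\<in>U. cmod (h k y) \<le> M" using bd by blast
      then have "\<forall>\<^sub>F k in sequentially. cmod (F k x) \<le> M" using True by (auto simp: F_def elim!: eventually_mono)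
      then show ?thesis using filter_leD [OF G(2)] by blast
    qed (auto simp: F_def intro: exI [of _ 0])
    then obtain G' L where G': "G' \<noteq> bot" "G' \<le> G" "\<And>x. ((\<lambda>k. F k x) \<longlongrightarrow> L x) G'"
      using cluster_filter [OF G(1), of F] by metis
    have lim: "((\<lambda>k. h k x) \<longlongrightarrow> L x) G'" if "x \<in> points A" for x using G'(3) [of x] that by (simp add: F_def)
    have le: "G' \<le> sequentially" using G'(2) G(2) by simp
    have "\<exists>U M. openin (mtop A) U \<and> x \<in> U \<and> (\<forall>\<^sub>F k in G'. \<forall>y\<in>U. cmod (h k y) \<le> M)" if "x \<in> points A" for x
      using bd [OF that] filter_leD [OF le] by blast
    then have "mholomorphic A complex_plane L"
      by (rule holomorphic_filter_limit(1) [OF AA G'(1) h _ lim])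
    then show ?thesis using G' lim by (intro exI [of _ G'] exI [of _ L] conjI ballI)
  qed
  obtain G1 L1 where G1: "G1 \<noteq> bot" "G1 \<le> sequentially" "\<And>x. x \<in> points A \<Longrightarrow> ((\<lambda>k. h k x) \<longlongrightarrow> L1 x) G1"
    "mholomorphic A complex_plane L1"
    using limit [of sequentially] by auto
  have conv: "(\<lambda>k. h k x) \<longlonglongrightarrow> L1 x" if x: "x \<in> points A" for x
  proof (rule ccontr)
    assume "\<not> ?thesis"
    then obtain e where e: "e > 0" "\<not> (\<forall>\<^sub>F k in sequentially. dist (h k x) (L1 x) < e)"
      unfolding tendsto_iff by blast
    \<comment> \<open>Along this filter h k x keeps distance at least e from L1 x, so any limit
      along a finer filter differs from L1 at x.\<close>
    define G0 where "G0 = inf sequentially (principal {k. dist (h k x) (L1 x) \<ge> e})"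
    have "G0 \<noteq> bot"
      using e(2) unfolding G0_def trivial_limit_def eventually_inf_principal by (simp add: not_le)
    moreover have "G0 \<le> sequentially" by (simp add: G0_def)
    ultimately obtain G2 L2 where G2: "G2 \<noteq> bot" "G2 \<le> G0" "\<And>x. x \<in> points A \<Longrightarrow> ((\<lambda>k. h k x) \<longlongrightarrow> L2 x) G2"
      "mholomorphic A complex_plane L2"
      using limit by blast
    have le2: "G2 \<le> sequentially" using G2(2) \<open>G0 \<le> sequentially\<close> by simp
    have eq0: "L1 y - L2 y = 0" if "y \<in> S" for y
    proof -
      obtain l where l: "(\<lambda>k. h k y) \<longlonglongrightarrow> l" using S(3) [OF \<open>y \<in> S\<close>] by (auto simp: convergent_def)
      have yA: "y \<in> points A" using that S by blast
      have "L1 y = l" using tendsto_unique [OF G1(1) G1(3) [OF yA] tendsto_mono [OF G1(2) l]] .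
      moreover have "L2 y = l" using tendsto_unique [OF G2(1) G2(3) [OF yA] tendsto_mono [OF le2 l]] .
      ultimately show ?thesis by simp
    qed
    obtain z where z: "z \<in> uniq_set A S" using S by blast
    have "mholomorphic (open_submfd A (points A)) complex_plane (\<lambda>x. L1 x - L2 x)"
      by (rule mholomorphic_open_source [OF AA atlas_manifold.chart_target [OF atlas_manifold_complex_plane] openin_topspace
          mholomorphic_diff [OF AA G1(4) G2(4)]])
    moreover have "connectedin (mtop A) (points A)" using connected by (simp add: connectedin_topspace)
    moreover have "z \<in> points A" using z by (simp add: uniq_set_def)
    ultimately have "L1 x - L2 x = 0"
      using z eq0 x unfolding uniq_set_def by (auto dest!: spec [of _ "points A"] spec [of _ "\<lambda>x. L1 x - L2 x"])
    moreover have "e \<le> dist (L2 x) (L1 x)"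
    proof (rule tendsto_lowerbound [OF tendsto_dist [OF G2(3) [OF x] tendsto_const] _ G2(1)])
      show "\<forall>\<^sub>F k in G2. e \<le> dist (h k x) (L1 x)"
        by (rule filter_leD [OF G2(2)]) (simp add: G0_def eventually_inf_principal)
    qed
    ultimately show False using e(1) by simp
  qed
  show ?thesis
    by (rule that [OF holomorphic_filter_limit [OF AA sequentially_bot h bd conv] conv])
qed

section \<open>Submean inequality along holomorphic curves\<close>

context complex_banach_space
begin

text \<open>\<open>lincomb c n a\<close> is \<open>c 0 + a 0 c 1 + \<dots> + a (n - 1) c n\<close>, so \<open>a j\<close> plays the role of \<open>z ^ (j + 1)\<close>.\<close>

fun lincomb :: "(nat \<Rightarrow> 'v) \<Rightarrow> nat \<Rightarrow> (nat \<Rightarrow> complex) \<Rightarrow> 'v" where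
  "lincomb c 0 a = c 0"
| "lincomb c (Suc n) a = lincomb c n a \<oplus> a n \<odot> c (Suc n)"

lemma lincomb_closed [simp]: "(\<And>i. c i \<in> carrier E) \<Longrightarrow> lincomb c n a \<in> carrier E"
  by (induction n) auto

lemma dual_lincomb:
  assumes "l \<in> unit_dual" "\<And>i. c i \<in> carrier E"
  shows "l (lincomb c n a) = l (c 0) + (\<Sum>j<n. a j * l (c (Suc j)))"
  by (induction n) (use assms in \<open>auto simp: unit_dualD\<close>)

lemma lincomb_cong: "(\<And>i. i \<le> n \<Longrightarrow> c i = d i) \<Longrightarrow> lincomb c n a = lincomb d n a"
  by (induction n) auto

lemma vdist_lincomb:
  assumes c: "\<And>i. c i \<in> carrier E"
  shows "vdist E (lincomb c n a) (lincomb c n b) \<le> (\<Sum>j<n. cmod (a j - b j) * vnorm E (c (Suc j)))"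
proof -
  have "vnorm E (lincomb c n a \<ominus> lincomb c n b) \<le> (\<Sum>j<n. cmod (a j - b j) * vnorm E (c (Suc j)))"
  proof (rule vnorm_le_dual)
    fix l assume l: "l \<in> unit_dual"
    have "l (lincomb c n a \<ominus> lincomb c n b) = (\<Sum>j<n. (a j - b j) * l (c (Suc j)))"
      using l c by (simp add: unit_dualD(6) [OF l] dual_lincomb sum_subtractf left_diff_distrib)
    also have "cmod \<dots> \<le> (\<Sum>j<n. cmod ((a j - b j) * l (c (Suc j))))" by (rule norm_sum)
    also have "\<dots> \<le> (\<Sum>j<n. cmod (a j - b j) * vnorm E (c (Suc j)))"
      using c by (intro sum_mono) (simp add: norm_mult mult_left_mono unit_dualD(3) [OF l])
    finally show "cmod (l (lincomb c n a \<ominus> lincomb c n b)) \<le> (\<Sum>j<n. cmod (a j - b j) * vnorm E (c (Suc j)))" .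
  qed (use c in auto)
  then show ?thesis using c by (simp add: vdist_eq)
qed

text \<open>Affine motion of the coefficients moves the vector along a complex line, on which the
  submean inequality of \<open>\<Phi>\<close> is available.\<close>

lemma lincomb_line:
  assumes c: "\<And>i. c i \<in> carrier E"
  shows "lincomb c n (\<lambda>j. a j + t * b j) = lincomb c n a \<oplus> t \<odot> (lincomb c n b \<ominus> c 0)"
proof (rule eq_dual)
  fix l assume l: "l \<in> unit_dual"
  show "l (lincomb c n (\<lambda>j. a j + t * b j)) = l (lincomb c n a \<oplus> t \<odot> (lincomb c n b \<ominus> c 0))"
    using c by (simp add: unit_dualD [OF l] dual_lincomb [OF l] sum_distrib_left algebra_simps sum.distrib)
qed (use c in auto)

text \<open>Continuous plurisubharmonic functions on an open set B, in metric terms; the first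
  clause contains both the openness of B and continuity.\<close>

definition line_submean :: "'v set \<Rightarrow> ('v \<Rightarrow> real) \<Rightarrow> bool" where
  "line_submean B \<Phi> \<longleftrightarrow>
     (\<forall>x\<in>B. \<forall>e>0. \<exists>d>0. \<forall>y\<in>carrier E. vdist E x y < d \<longrightarrow> y \<in> B \<and> \<bar>\<Phi> y - \<Phi> x\<bar> < e) \<and> B \<subseteq> carrier E \<and>
     (\<forall>p\<in>carrier E. \<forall>v\<in>carrier E. \<forall>r>0. (\<forall>t. cmod t \<le> r \<longrightarrow> p \<oplus> t \<odot> v \<in> B) \<longrightarrow>
        \<Phi> p \<le> cmean (\<lambda>t. \<Phi> (p \<oplus> t \<odot> v)) 0 r)"

definition curve_on :: "complex set \<Rightarrow> 'v set \<Rightarrow> (complex \<Rightarrow> 'v) \<Rightarrow> bool" where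
  "curve_on S B c \<longleftrightarrow> c ` S \<subseteq> B \<and> (\<forall>z\<in>S. \<forall>e>0. \<exists>d>0. \<forall>w\<in>S. dist w z < d \<longrightarrow> vdist E (c z) (c w) < e)"

lemma continuous_on_curve:
  assumes \<Phi>: "line_submean B \<Phi>" and c: "curve_on S B c"
  shows "continuous_on S (\<lambda>z. \<Phi> (c z))"
  unfolding continuous_on_iff
proof (intro ballI allI impI)
  fix z and e :: real assume z: "z \<in> S" and e: "e > 0"
  have "c z \<in> B" using c z by (auto simp: curve_on_def)
  then obtain d where d: "d > 0" "\<And>y. y \<in> carrier E \<Longrightarrow> vdist E (c z) y < d \<Longrightarrow> \<bar>\<Phi> y - \<Phi> (c z)\<bar> < e"
    using \<Phi> e unfolding line_submean_def by meson
  obtain d' where d': "d' > 0" "\<And>w. w \<in> S \<Longrightarrow> dist w z < d' \<Longrightarrow> vdist E (c z) (c w) < d"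
    using c z d(1) unfolding curve_on_def by meson
  have "c w \<in> carrier E" if "w \<in> S" for w using that c \<Phi> by (auto simp: curve_on_def line_submean_def)
  then show "\<exists>d>0. \<forall>w\<in>S. dist w z < d \<longrightarrow> dist (\<Phi> (c w)) (\<Phi> (c z)) < e"
    using d d' by (intro exI [of _ d']) (auto simp: dist_real_def)
qed

text \<open>Although B need not be locally compact, continuity of \<open>\<Phi>\<close> is uniform
  near the compact image of the curve. Violations at distance 1/(n + 1) would accumulate at a point
  of that image.\<close>

lemma uniform_near_curve:
  assumes \<Phi>: "line_submean B \<Phi>" and S: "compact S" and c: "curve_on S B c" and e: "e > 0"
  obtains d where "d > 0" "\<And>z y. z \<in> S \<Longrightarrow> y \<in> carrier E \<Longrightarrow> vdist E (c z) y < d \<Longrightarrow> y \<in> B \<and> \<bar>\<Phi> y - \<Phi> (c z)\<bar> < e"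
proof (rule ccontr)
  assume neg: "\<not> thesis"
  have BC: "B \<subseteq> carrier E" using \<Phi> by (simp add: line_submean_def)
  have cB: "c z \<in> B" if "z \<in> S" for z using c that by (auto simp: curve_on_def)
  have "\<exists>z y. z \<in> S \<and> y \<in> carrier E \<and> vdist E (c z) y < 1 / (real n + 1) \<and> \<not> (y \<in> B \<and> \<bar>\<Phi> y - \<Phi> (c z)\<bar> < e)" for n
  proof (rule ccontr)
    assume *: "\<not> ?thesis"
    show False by (rule neg [THEN notE], rule that [of "1 / (real n + 1)"]) (use * in auto)
  qed
  then obtain z y where zy: "\<And>n. z n \<in> S" "\<And>n. y n \<in> carrier E" "\<And>n. vdist E (c (z n)) (y n) < 1 / (real n + 1)"
      "\<And>n. \<not> (y n \<in> B \<and> \<bar>\<Phi> (y n) - \<Phi> (c (z n))\<bar> < e)"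
    by metis
  obtain z0 s where z0: "z0 \<in> S" "strict_mono (s :: nat \<Rightarrow> nat)" "(z \<circ> s) \<longlonglongrightarrow> z0"
    using S zy(1) unfolding compact_def by metis
  obtain d where d: "d > 0" "\<And>y. y \<in> carrier E \<Longrightarrow> vdist E (c z0) y < d \<Longrightarrow> y \<in> B \<and> \<bar>\<Phi> y - \<Phi> (c z0)\<bar> < e / 2"
    using \<Phi> cB [OF z0(1)] e unfolding line_submean_def by (meson half_gt_zero)
  obtain d' where d': "d' > 0" "\<And>w. w \<in> S \<Longrightarrow> dist w z0 < d' \<Longrightarrow> vdist E (c z0) (c w) < d / 2"
    using c z0(1) d(1) unfolding curve_on_def by (meson half_gt_zero)
  have lim: "(\<lambda>n. 1 / (real n + 1)) \<longlonglongrightarrow> 0" by real_asymp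
  have "\<forall>\<^sub>F n in sequentially. dist ((z \<circ> s) n) z0 < d'" by (rule tendstoD [OF z0(3) d'(1)])
  moreover have "\<forall>\<^sub>F n in sequentially. 1 / (real n + 1) < d / 2"
    by (rule order_tendstoD(2) [OF lim]) (use d(1) in simp)
  ultimately have "\<forall>\<^sub>F n in sequentially. False"
  proof eventually_elim
    case (elim n)
    have zs: "z (s n) \<in> S" "y (s n) \<in> carrier E" "c (z (s n)) \<in> carrier E" "c z0 \<in> carrier E"
      using zy cB BC z0(1) by blast+
    have 1: "vdist E (c z0) (c (z (s n))) < d / 2" using d'(2) [OF zs(1)] elim by simp
    have "vdist E (c (z (s n))) (y (s n)) < 1 / (real (s n) + 1)" by (rule zy(3))
    also have "\<dots> \<le> 1 / (real n + 1)" using seq_suble [OF z0(2), of n] by (simp add: frac_le)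
    finally have 2: "vdist E (c (z (s n))) (y (s n)) < d / 2" using elim by simp
    have "vdist E (c z0) (y (s n)) < d"
      using vdist_triangle [OF zs(4,3,2)] 1 2 by simp
    then have "y (s n) \<in> B" "\<bar>\<Phi> (y (s n)) - \<Phi> (c z0)\<bar> < e / 2" using d(2) [OF zs(2)] by auto
    moreover have "\<bar>\<Phi> (c (z (s n))) - \<Phi> (c z0)\<bar> < e / 2" using d(2) [OF zs(3)] 1 d(1) by simp
    ultimately have "y (s n) \<in> B \<and> \<bar>\<Phi> (y (s n)) - \<Phi> (c (z (s n)))\<bar> < e" by linarith
    then show False using zy(4) by blast
  qed
  then show False by simp
qed

text \<open>The quadratic Taylor estimate on the unit disc, with bound M = 2 ^ (j + 1) since |z + w|
  \<le> 2 there.\<close>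

lemma power_remainder_bound:
  assumes "cmod z \<le> 1" "cmod t < 1"
  shows "cmod ((z + t) ^ Suc j - z ^ Suc j - of_nat (Suc j) * z ^ j * t) \<le> 9 * 2 ^ Suc j * (cmod t)\<^sup>2"
proof -
  let ?f = "\<lambda>t. (z + t) ^ Suc j"
  have hol: "?f holomorphic_on ball 0 1" by (intro holomorphic_intros)
  have bd: "cmod (?f w) \<le> 2 ^ Suc j" if "w \<in> ball 0 1" for w
  proof -
    have "cmod (z + w) \<le> 2" using norm_triangle_ineq [of z w] assms that by simp
    then show ?thesis unfolding norm_power by (intro power_mono) auto
  qed
  have "(?f has_field_derivative of_nat (Suc j) * z ^ j) (at 0)"
    by (auto intro!: derivative_eq_intros simp del: power_Suc of_nat_Suc)
  then have d: "deriv ?f 0 = of_nat (Suc j) * z ^ j" by (rule DERIV_imp_deriv)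
  have "(2::real) ^ Suc j > 0" by simp
  from bounded_holomorphic_taylor(2) [OF hol _ this bd, of t] assms(2)
  show ?thesis unfolding d by simp
qed

lemma curve_on_lincomb:
  assumes c: "\<And>i. c i \<in> carrier E" and B: "\<And>z. z \<in> S \<Longrightarrow> lincomb c n (\<lambda>j. z ^ Suc j) \<in> B"
  shows "curve_on S B (\<lambda>z. lincomb c n (\<lambda>j. z ^ Suc j))"
  unfolding curve_on_def
proof (intro conjI ballI allI impI)
  fix z and e :: real assume z: "z \<in> S" and e: "e > 0"
  let ?g = "\<lambda>w. \<Sum>j<n. cmod (z ^ Suc j - w ^ Suc j) * vnorm E (c (Suc j))"
  have "continuous_on UNIV ?g" by (intro continuous_intros)
  then have "isCont ?g z" by (simp add: continuous_on_eq_continuous_at)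
  then obtain d where d: "d > 0" "\<And>w. dist w z < d \<Longrightarrow> dist (?g w) (?g z) < e"
    using e unfolding continuous_at_eps_delta by blast
  have "vdist E (lincomb c n (\<lambda>j. z ^ Suc j)) (lincomb c n (\<lambda>j. w ^ Suc j)) < e" if "dist w z < d" for w
  proof -
    have "?g w < e" using d(2) [OF that] by (simp add: dist_real_def)
    then show ?thesis using vdist_lincomb [of c n "\<lambda>j. z ^ Suc j" "\<lambda>j. w ^ Suc j", OF c] by linarith
  qed
  then show "\<exists>d>0. \<forall>w\<in>S. dist w z < d \<longrightarrow> vdist E (lincomb c n (\<lambda>j. z ^ Suc j)) (lincomb c n (\<lambda>j. w ^ Suc j)) < e"
    using d(1) by blast
qed (use B in auto)

text \<open>Doubling of variables: if the inequality failed, a harmonic function would touch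
  \<open>\<Phi> (c z) + \<epsilon> |z|\<^sup>2\<close> from above. Letting the coefficients \<open>a j\<close> vary independently of the powers of
  \<open>z\<close>, with the penalty \<open>K Q\<close> on the distance between them, the pair can be moved along a complex line
  tangent to the curve: the mean gains \<open>\<epsilon> r\<^sup>2\<close> and loses only \<open>K C r\<^sup>4\<close>, since the first-order terms are
  holomorphic. No smoothness of \<open>\<Phi>\<close> is needed.\<close>

lemma submean_polynomial_curve:
  assumes \<Phi>: "line_submean B \<Phi>" and c: "\<And>i. c i \<in> carrier E"
    and B: "\<And>z. z \<in> cball 0 1 \<Longrightarrow> lincomb c n (\<lambda>j. z ^ Suc j) \<in> B"
  shows "\<Phi> (c 0) \<le> cmean (\<lambda>z. \<Phi> (lincomb c n (\<lambda>j. z ^ Suc j))) 0 1"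
proof (rule ccontr)
  let ?P = "\<lambda>z. lincomb c n (\<lambda>j. z ^ Suc j)"
  let ?u = "\<lambda>z. \<Phi> (?P z)"
  note power_Suc [simp del]
  assume "\<not> \<Phi> (c 0) \<le> cmean ?u 0 1"
  then have lt: "cmean ?u 0 1 < \<Phi> (c 0)" by simp
  have P0: "?P 0 = c 0" using c by (intro eq_dual) (auto simp: dual_lincomb)
  have curve: "curve_on (cball 0 1) B ?P" by (rule curve_on_lincomb [OF c B])
  have cu: "continuous_on (cball 0 1) ?u" by (rule continuous_on_curve [OF \<Phi> curve])
  obtain f where f: "f holomorphic_on UNIV" "\<And>z. z \<in> sphere 0 1 \<Longrightarrow> ?u z < Re (f z)" "Re (f 0) < \<Phi> (c 0)"
    using harmonic_majorant [of 1 0 ?u, OF _ _ lt] continuous_on_subset [OF cu] by auto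
  have cf: "continuous_on T f" for T using f(1) holomorphic_on_imp_continuous_on continuous_on_subset by blast
  define \<kappa> where "\<kappa> = \<Phi> (c 0) - Re (f 0)"
  have \<kappa>: "\<kappa> > 0" using f(3) by (simp add: \<kappa>_def)
  \<comment> \<open>On the unit circle U is then below \<epsilon>, hence below the level \<kappa> /
    2 that defines T.\<close>
  define \<epsilon> where "\<epsilon> = \<kappa> / 4"
  define U where "U z = ?u z - Re (f z) + \<epsilon> * (cmod z)\<^sup>2" for z
  have cU: "continuous_on (cball 0 1) U" unfolding U_def by (intro continuous_intros cu cf)
  have U0: "U 0 = \<kappa>" using P0 by (simp add: U_def \<kappa>_def)
  obtain zm where zm: "zm \<in> cball 0 1" "\<And>z. z \<in> cball 0 1 \<Longrightarrow> U z \<le> U zm"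
    using continuous_attains_sup [OF compact_cball _ cU] by auto
  define Um where "Um = U zm"
  have Um: "Um \<ge> \<kappa>" "\<And>z. z \<in> cball 0 1 \<Longrightarrow> U z \<le> Um" using zm(2) [of 0] zm(2) U0 by (auto simp: Um_def)
  \<comment> \<open>All z in near-maximal pairs will lie in T. Being compact and disjoint from the
    circle, T fixes a distance from the circle before any such pair is chosen.\<close>
  define T where "T = {z \<in> cball 0 1. \<kappa> / 2 \<le> U z}"
  have "compact T"
    unfolding T_def using continuous_closed_preimage [OF cU, of "{\<kappa> / 2..}"] compact_Int_closed [of "cball 0 1" T]
    by (auto simp: T_def vimage_def Int_def intro: compact_eq_bounded_closed [THEN iffD2] bounded_subset [OF bounded_cball])
  moreover have "0 \<in> T" using U0 \<kappa> by (simp add: T_def)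
  ultimately obtain zs where zs: "zs \<in> T" "\<And>z. z \<in> T \<Longrightarrow> cmod z \<le> cmod zs"
    using continuous_attains_sup [of T norm] continuous_on_norm_id by auto
  have "cmod zs \<noteq> 1"
  proof
    assume "cmod zs = 1"
    then have "U zs < \<epsilon>" using f(2) [of zs] by (simp add: U_def)
    then show False using zs(1) \<kappa> by (simp add: T_def \<epsilon>_def)
  qed
  then have zs1: "cmod zs < 1" using zs(1) by (simp add: T_def)
  obtain \<tau> where \<tau>: "\<tau> > 0" "\<And>z y. z \<in> cball 0 1 \<Longrightarrow> y \<in> carrier E \<Longrightarrow> vdist E (?P z) y < \<tau> \<Longrightarrow> y \<in> B \<and> \<bar>\<Phi> y - ?u z\<bar> < \<kappa> / 8"
    using uniform_near_curve [OF \<Phi> compact_cball curve, of "\<kappa> / 8"] \<kappa> by auto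
  define Q where "Q z a = (\<Sum>j<n. (cmod (a j - z ^ Suc j))\<^sup>2)" for z and a :: "nat \<Rightarrow> complex"
  have Q0: "Q z a \<ge> 0" for z a by (simp add: Q_def sum_nonneg)
  \<comment> \<open>If every coefficient is within t1 of the corresponding power of z, the linear
    combination is within \<tau> of the curve; the added 1 keeps the divisor positive.\<close>
  define nc where "nc = 1 + (\<Sum>j<n. vnorm E (c (Suc j)))"
  have nc: "nc > 0" unfolding nc_def using sum_nonneg [of "{..<n}" "\<lambda>j. vnorm E (c (Suc j))"] vnorm_nonneg c by (simp add: add_pos_nonneg)
  define t1 where "t1 = \<tau> / nc"
  have t1: "t1 > 0" using \<tau> nc by (simp add: t1_def)
  have near: "lincomb c n a \<in> B \<and> \<bar>\<Phi> (lincomb c n a) - ?u z\<bar> < \<kappa> / 8" if z: "z \<in> cball 0 1" and q: "Q z a < t1\<^sup>2" for z a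
  proof -
    have "cmod (z ^ Suc j - a j) \<le> t1" if "j < n" for j
    proof -
      have "(cmod (a j - z ^ Suc j))\<^sup>2 \<le> Q z a" unfolding Q_def by (rule member_le_sum) (use that in auto)
      then have "(cmod (a j - z ^ Suc j))\<^sup>2 \<le> t1\<^sup>2" using q by simp
      then show ?thesis using t1 by (simp add: norm_minus_commute power2_le_iff_abs_le)
    qed
    then have "(\<Sum>j<n. cmod (z ^ Suc j - a j) * vnorm E (c (Suc j))) \<le> (\<Sum>j<n. t1 * vnorm E (c (Suc j)))"
      using vnorm_nonneg c by (intro sum_mono mult_right_mono) auto
    also have "\<dots> = t1 * (nc - 1)" by (simp add: nc_def sum_distrib_left)
    also have "\<dots> < t1 * nc" using t1 by simp
    also have "\<dots> = \<tau>" using nc by (simp add: t1_def)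
    finally have "vdist E (?P z) (lincomb c n a) < \<tau>" using vdist_lincomb [of c n "\<lambda>j. z ^ Suc j" a, OF c] by linarith
    then show ?thesis using \<tau>(2) [OF z] c by simp
  qed
  \<comment> \<open>Large enough that a near-maximal pair has Q < t1^2 / 4, leaving room inside S
    for moving it.\<close>
  define K where "K = 4 * Um / t1\<^sup>2"
  have K: "K > 0" using Um \<kappa> t1 by (simp add: K_def)
  define S where "S = {(z, a). z \<in> cball 0 1 \<and> Q z a < t1\<^sup>2}"
  define W where "W za = (case za of (z, a) \<Rightarrow> \<Phi> (lincomb c n a) - Re (f z) + \<epsilon> * (cmod z)\<^sup>2 - K * Q z a)" for za
  have W_le: "W (z, a) \<le> U z + \<kappa> / 8 - K * Q z a" if "(z, a) \<in> S" for z a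
  proof -
    have "z \<in> cball 0 1" "Q z a < t1\<^sup>2" using that by (auto simp: S_def)
    then have "\<bar>\<Phi> (lincomb c n a) - ?u z\<bar> < \<kappa> / 8" using near by blast
    then show ?thesis unfolding W_def U_def prod.case by linarith
  qed
  have bdd: "bdd_above (W ` S)"
  proof (rule bdd_aboveI2)
    fix za assume "za \<in> S"
    then obtain z a where za: "za = (z, a)" "(z, a) \<in> S" by (cases za) auto
    have "K * Q z a \<ge> 0" using K Q0 by simp
    then show "W za \<le> Um + \<kappa> / 8" using W_le [OF za(2)] Um(2) [of z] za by (auto simp: S_def)
  qed
  have S0: "(0, \<lambda>j. 0) \<in> S" using t1 by (simp add: S_def Q_def)
  \<comment> \<open>Attainment of the supremum is not shown; a pair within \<delta> of it
    suffices.\<close>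
  define M where "M = (SUP za\<in>S. W za)"
  have WM: "W za \<le> M" if "za \<in> S" for za unfolding M_def by (rule cSUP_upper [OF that bdd])
  have "lincomb c n (\<lambda>j. 0) = c 0" using c by (intro eq_dual) (auto simp: dual_lincomb)
  then have W0: "W (0, \<lambda>j. 0) = \<kappa>" by (simp add: W_def Q_def \<kappa>_def)
  define C where "C = (\<Sum>j<n. (9 * 2 ^ Suc j)\<^sup>2 :: real)"
  have C: "C \<ge> 0" by (simp add: C_def sum_nonneg)
  \<comment> \<open>The radius makes the loss K C r^4 less than half of the gain \<epsilon> r^2,
    keeps moved pairs in S, and keeps z + t in the disc. It is chosen before the pair because
    \<delta> depends on it.\<close>
  have "((\<lambda>r. K * C * r\<^sup>2) \<longlongrightarrow> K * C * 0\<^sup>2) (at_right 0)" by (intro tendsto_intros)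
  then have "\<forall>\<^sub>F r in at_right 0. K * C * r\<^sup>2 < \<epsilon> / 2" using \<kappa> by (intro order_tendstoD(2)) (auto simp: \<epsilon>_def)
  moreover have "((\<lambda>r. 2 * C * r ^ 4) \<longlongrightarrow> 2 * C * 0 ^ 4) (at_right 0)" by (intro tendsto_intros)
  then have "\<forall>\<^sub>F r in at_right 0. 2 * C * r ^ 4 < t1\<^sup>2 / 2" using t1 by (intro order_tendstoD(2)) auto
  moreover have "\<forall>\<^sub>F r in at_right 0. r < 1 - cmod zs" using zs1 by (intro order_tendstoD(2) [OF tendsto_ident_at]) auto
  moreover have "\<forall>\<^sub>F r in at_right (0::real). r > 0" by (simp add: eventually_at_right_less)
  ultimately have "\<forall>\<^sub>F r in at_right 0. K * C * r\<^sup>2 < \<epsilon> / 2 \<and> 2 * C * r ^ 4 < t1\<^sup>2 / 2 \<and> r < 1 - cmod zs \<and> r > 0"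
    by eventually_elim blast
  then obtain r where r: "K * C * r\<^sup>2 < \<epsilon> / 2" "2 * C * r ^ 4 < t1\<^sup>2 / 2" "r < 1 - cmod zs" "r > 0"
    using eventually_happens' [OF trivial_limit_at_right_real] by blast
  \<comment> \<open>The bound \<kappa> / 8 forces z into T; the bound \<epsilon> r^2 / 2 is the net
    gain that yields the contradiction.\<close>
  define \<delta> where "\<delta> = min (\<kappa> / 8) (\<epsilon> * r\<^sup>2 / 2)"
  have \<delta>: "\<delta> > 0" using \<kappa> r by (simp add: \<delta>_def \<epsilon>_def)
  have "M - \<delta> < (SUP za\<in>S. W za)" using \<delta> by (simp add: M_def)
  then obtain za where "za \<in> S" "M - \<delta> < W za" using less_cSUP_iff [OF _ bdd] S0 by blast
  then obtain z a where za: "(z, a) \<in> S" "M - \<delta> < W (z, a)" by (cases za) auto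
  have z1: "z \<in> cball 0 1" "Q z a < t1\<^sup>2" using za(1) by (auto simp: S_def)
  have W78: "W (z, a) > 7 * \<kappa> / 8" using za(2) WM [OF S0] W0 by (simp add: \<delta>_def)
  have KQ: "K * Q z a < Um" using W78 W_le [OF za(1)] Um(2) [OF z1(1)] \<kappa> by linarith
  then have Qz: "Q z a < t1\<^sup>2 / 4"
    using t1 Um \<kappa> by (simp add: K_def field_simps)
  have "U z \<ge> \<kappa> / 2"
  proof -
    have "K * Q z a \<ge> 0" using K Q0 by simp
    then show ?thesis using W78 W_le [OF za(1)] \<kappa> by linarith
  qed
  then have "z \<in> T" using z1 by (simp add: T_def)
  then have zr: "cmod z + r < 1" using zs(2) r(3) by force
  \<comment> \<open>The derivatives of the powers z ^ (j + 1), so that w is the tangent direction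
    and the mismatch with the moved powers is only the second-order remainder R.\<close>
  define b where "b j = of_nat (Suc j) * z ^ j" for j
  define w where "w = lincomb c n b \<ominus> c 0"
  define R where "R j t = (z + t) ^ Suc j - z ^ Suc j - b j * t" for j t
  have Rb: "cmod (R j t) \<le> 9 * 2 ^ Suc j * (cmod t)\<^sup>2" if "cmod t \<le> r" for j t
  proof -
    have "cmod t < 1" using that zr norm_ge_zero [of z] by linarith
    then show ?thesis using power_remainder_bound [of z t j] z1(1) unfolding R_def b_def by simp
  qed
  have R2: "(\<Sum>j<n. (cmod (R j t))\<^sup>2) \<le> C * r ^ 4" if "cmod t \<le> r" for t
  proof -
    have "(cmod (R j t))\<^sup>2 \<le> (9 * 2 ^ Suc j)\<^sup>2 * r ^ 4" for j
    proof -
      have "cmod (R j t) \<le> 9 * 2 ^ Suc j * r\<^sup>2"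
        using Rb [OF that, of j] power_mono [OF that, of 2] by (smt (verit) mult_left_mono norm_ge_zero zero_le_power mult_nonneg_nonneg)
      then have "(cmod (R j t))\<^sup>2 \<le> (9 * 2 ^ Suc j * r\<^sup>2)\<^sup>2" by (rule power_mono) simp
      then show ?thesis by (simp add: power_mult_distrib flip: power_mult)
    qed
    then show ?thesis unfolding C_def sum_distrib_right by (intro sum_mono)
  qed
  let ?a = "\<lambda>t j. a j + t * b j"
  have diff: "?a t j - (z + t) ^ Suc j = (a j - z ^ Suc j) - R j t" for t j by (simp add: R_def algebra_simps)
  have sq: "(cmod (x - y))\<^sup>2 = (cmod x)\<^sup>2 - 2 * Re (cnj x * y) + (cmod y)\<^sup>2" for x y
    unfolding cmod_power2 by (simp add: power2_eq_square algebra_simps)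
  \<comment> \<open>The mixed term in the expansion of the penalty. It is holomorphic in t and
    vanishes at 0, so its real part has mean 0 although it need not be small of fourth
    order.\<close>
  define H where "H t = (\<Sum>j<n. cnj (a j - z ^ Suc j) * R j t)" for t
  have Qt: "Q (z + t) (?a t) = Q z a - 2 * Re (H t) + (\<Sum>j<n. (cmod (R j t))\<^sup>2)" for t
    unfolding Q_def diff sq H_def by (simp add: sum.distrib sum_subtractf sum_distrib_left)
  have St: "(z + t, ?a t) \<in> S" if t: "cmod t \<le> r" for t
  proof -
    have "(cmod (x - y))\<^sup>2 \<le> 2 * (cmod x)\<^sup>2 + 2 * (cmod y)\<^sup>2" for x y
    proof -
      have "(cmod (x - y))\<^sup>2 + (cmod (x + y))\<^sup>2 = 2 * (cmod x)\<^sup>2 + 2 * (cmod y)\<^sup>2"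
        unfolding cmod_power2 by (simp add: power2_eq_square algebra_simps)
      then show ?thesis by (smt (verit) zero_le_power2)
    qed
    then have "Q (z + t) (?a t) \<le> (\<Sum>j<n. 2 * (cmod (a j - z ^ Suc j))\<^sup>2 + 2 * (cmod (R j t))\<^sup>2)"
      unfolding Q_def diff by (intro sum_mono)
    also have "\<dots> = 2 * Q z a + 2 * (\<Sum>j<n. (cmod (R j t))\<^sup>2)" by (simp add: Q_def sum.distrib sum_distrib_left)
    also have "\<dots> \<le> 2 * Q z a + 2 * C * r ^ 4" using R2 [OF t] by simp
    also have "\<dots> < t1\<^sup>2" using Qz r(2) by simp
    finally have "Q (z + t) (?a t) < t1\<^sup>2" .
    moreover have "cmod (z + t) \<le> 1" using norm_triangle_ineq [of z t] t zr by simp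
    ultimately show ?thesis by (simp add: S_def)
  qed
  have line: "lincomb c n (?a t) = lincomb c n a \<oplus> t \<odot> w" for t
    unfolding w_def by (rule lincomb_line [OF c])
  have inB: "lincomb c n a \<oplus> t \<odot> w \<in> B" if "cmod t \<le> r" for t
    using near [of "z + t" "?a t"] St [OF that] unfolding line by (auto simp: S_def)
  have wE: "w \<in> carrier E" and aE: "lincomb c n a \<in> carrier E" using c by (auto simp: w_def)
  have sub: "\<Phi> (lincomb c n a) \<le> cmean (\<lambda>t. \<Phi> (lincomb c n a \<oplus> t \<odot> w)) 0 r"
    using \<Phi> aE wE r(4) inB unfolding line_submean_def by blast
  have lc: "curve_on (cball 0 r) B (\<lambda>t. lincomb c n a \<oplus> t \<odot> w)"
    unfolding curve_on_def
  proof (intro conjI ballI allI impI)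
    fix s and e :: real assume e: "e > 0"
    let ?n = "vnorm E w + 1"
    have n: "?n > 0" using vnorm_nonneg [OF wE] by simp
    have "vdist E (lincomb c n a \<oplus> s \<odot> w) (lincomb c n a \<oplus> t \<odot> w) < e" if "dist t s < e / ?n" for t
    proof -
      have "vdist E (lincomb c n a \<oplus> s \<odot> w) (lincomb c n a \<oplus> t \<odot> w) = cmod (s - t) * vnorm E w" by (rule vdist_line [OF aE wE])
      also have "\<dots> \<le> cmod (s - t) * ?n" by (simp add: mult_left_mono)
      also have "\<dots> < e" using that n by (simp add: dist_norm norm_minus_commute field_simps)
      finally show ?thesis .
    qed
    then show "\<exists>d>0. \<forall>t\<in>cball 0 r. dist t s < d \<longrightarrow> vdist E (lincomb c n a \<oplus> s \<odot> w) (lincomb c n a \<oplus> t \<odot> w) < e"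
      using e n by (intro exI [of _ "e / ?n"]) auto
  qed (use inB in auto)
  \<comment> \<open>F collects the terms holomorphic in t, which average to the value f z at t = 0;
    the constants go into k.\<close>
  define F where "F t = f (z + t) - 2 * of_real \<epsilon> * cnj z * t - 2 * of_real K * H t" for t
  define k where "k = M - \<epsilon> * (cmod z)\<^sup>2 - \<epsilon> * r\<^sup>2 + K * Q z a + K * (C * r ^ 4)"
  have "(\<lambda>t. f (z + t)) holomorphic_on UNIV"
    by (rule holomorphic_on_compose_gen [OF _ f(1), unfolded o_def]) (auto intro!: holomorphic_intros)
  then have holF: "F holomorphic_on UNIV"
    unfolding F_def H_def R_def by (intro holomorphic_intros)
  have cF: "continuous_on T' (\<lambda>t. Re (F t))" for T'
    using holomorphic_on_imp_continuous_on [OF holF] by (intro continuous_intros) (auto intro: continuous_on_subset)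
  have "cmean (\<lambda>t. \<Phi> (lincomb c n a \<oplus> t \<odot> w)) 0 r \<le> cmean (\<lambda>t. k + Re (F t)) 0 r"
  proof (rule cmean_mono)
    show "continuous_on (sphere 0 r) (\<lambda>t. \<Phi> (lincomb c n a \<oplus> t \<odot> w))"
      by (rule continuous_on_subset [OF continuous_on_curve [OF \<Phi> lc]]) auto
    show "continuous_on (sphere 0 r) (\<lambda>t. k + Re (F t))" by (intro continuous_intros cF)
    fix t :: complex assume "t \<in> sphere 0 r"
    then have t: "cmod t = r" by simp
    have "W (z + t, ?a t) \<le> M" by (rule WM [OF St]) (use t in simp)
    then have 1: "\<Phi> (lincomb c n a \<oplus> t \<odot> w) \<le> M + Re (f (z + t)) - \<epsilon> * (cmod (z + t))\<^sup>2 + K * Q (z + t) (?a t)"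
      by (simp add: W_def line)
    have "K * Q (z + t) (?a t) \<le> K * (Q z a - 2 * Re (H t) + C * r ^ 4)"
      unfolding Qt using R2 [of t] t K by (intro mult_left_mono) auto
    moreover have "(cmod (z + t))\<^sup>2 = (cmod z)\<^sup>2 + 2 * Re (cnj z * t) + r\<^sup>2"
      using sq [of z "- t"] t by simp
    moreover have "Re (F t) = Re (f (z + t)) - 2 * \<epsilon> * Re (cnj z * t) - 2 * K * Re (H t)"
      by (simp add: F_def algebra_simps)
    ultimately show "\<Phi> (lincomb c n a \<oplus> t \<odot> w) \<le> k + Re (F t)"
      using 1 by (simp add: k_def algebra_simps)
  qed (use r in auto)
  also have "\<dots> = k + Re (F 0)"
    using cmean_add [of r 0 "\<lambda>t. k" "\<lambda>t. Re (F t)"] cF r cmean_Re_holomorphic [OF holF, of 0 r] by simp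
  also have "F 0 = f z"
    by (simp add: F_def H_def R_def)
  finally have "W (z, a) \<le> M - \<epsilon> * r\<^sup>2 + (K * C * r\<^sup>2) * r\<^sup>2"
    using sub by (simp add: W_def k_def power2_eq_square power4_eq_xxxx mult_ac)
  also have "(K * C * r\<^sup>2) * r\<^sup>2 \<le> (\<epsilon> / 2) * r\<^sup>2" using r by (intro mult_right_mono) auto
  finally show False using za(2) by (simp add: \<delta>_def)
qed

section \<open>Taylor expansion of vector-valued holomorphic curves\<close>

text \<open>Holomorphy tested by functionals together with a norm bound: this form survives division
  by z by scalar arguments alone.\<close>

definition weakly_holomorphic :: "real \<Rightarrow> real \<Rightarrow> (complex \<Rightarrow> 'v) \<Rightarrow> bool" where
  "weakly_holomorphic \<rho> M c \<longleftrightarrow> (\<forall>z\<in>ball 0 \<rho>. c z \<in> carrier E \<and> vnorm E (c z) \<le> M) \<and>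
     (\<forall>l\<in>unit_dual. (\<lambda>z. l (c z)) holomorphic_on ball 0 \<rho>)"

text \<open>For each functional the quotient extends over 0 by the scalar lemma. These values must
  come from one vector of E; it is found by completeness, since the quotients along a sequence
  tending to 0 are Cauchy at a rate uniform over the dual ball.\<close>

lemma weakly_holomorphic_divide:
  assumes c: "weakly_holomorphic \<rho> M c" and \<rho>: "\<rho> > 0" and M: "M > 0"
  obtains d where "weakly_holomorphic \<rho> (3 * M / \<rho>) d" "\<And>z. z \<in> ball 0 \<rho> \<Longrightarrow> c z = c 0 \<oplus> z \<odot> d z"
proof -
  have cE: "c z \<in> carrier E" if "z \<in> ball 0 \<rho>" for z using c that by (simp add: weakly_holomorphic_def)
  have c0: "c 0 \<in> carrier E" using cE \<rho> by simp
  have "\<exists>g. g holomorphic_on ball 0 \<rho> \<and> (\<forall>z. l (c z) = l (c 0) + z * g z) \<and> (\<forall>z\<in>ball 0 \<rho>. cmod (g z) \<le> 3 * M / \<rho>)"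
    if l: "l \<in> unit_dual" for l
  proof -
    have hol: "(\<lambda>z. l (c z)) holomorphic_on ball 0 \<rho>" using c l by (simp add: weakly_holomorphic_def)
    have bd: "cmod (l (c z)) \<le> M" if "z \<in> ball 0 \<rho>" for z
      using unit_dualD(3) [OF l cE [OF that]] c that unfolding weakly_holomorphic_def by force
    show ?thesis
    proof (rule divided_difference [OF hol \<rho> M bd])
      fix g assume "g holomorphic_on ball 0 \<rho>" "\<And>z. l (c z) = l (c 0) + z * g z" "\<And>z. z \<in> ball 0 \<rho> \<Longrightarrow> cmod (g z) \<le> 3 * M / \<rho>"
      then show ?thesis by (intro exI [of _ g] conjI allI ballI)
    qed
  qed
  then obtain g where g: "\<And>l. l \<in> unit_dual \<Longrightarrow> g l holomorphic_on ball 0 \<rho>"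
     "\<And>l z. l \<in> unit_dual \<Longrightarrow> l (c z) = l (c 0) + z * g l z"
     "\<And>l z. l \<in> unit_dual \<Longrightarrow> z \<in> ball 0 \<rho> \<Longrightarrow> cmod (g l z) \<le> 3 * M / \<rho>"
    by metis
  define q where "q z = (1 / z) \<odot> (c z \<ominus> c 0)" for z
  have qE: "q z \<in> carrier E" if "z \<in> ball 0 \<rho>" for z using cE [OF that] c0 by (simp add: q_def)
  have lq: "l (q z) = g l z" if "l \<in> unit_dual" "z \<in> ball 0 \<rho>" "z \<noteq> 0" for l z
    using g(2) [OF that(1), of z] unit_dualD [OF that(1)] cE [OF that(2)] c0 that(3) by (simp add: q_def)
  \<comment> \<open>The Lipschitz constant at 0 of the scalar quotients, which are bounded by 3 M /
    \<rho>; it is the same for all functionals.\<close>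
  define C where "C = 3 * (3 * M / \<rho>) / \<rho>"
  have C: "C > 0" using M \<rho> by (simp add: C_def)
  have gl: "cmod (g l z - g l 0) \<le> C * cmod z" if "l \<in> unit_dual" "z \<in> ball 0 \<rho>" for l z
    unfolding C_def by (rule bounded_holomorphic_lipschitz [OF g(1) \<rho> _ g(3)]) (use that M \<rho> in auto)
  \<comment> \<open>Nonzero points tending to 0; the 2 in the denominator keeps even s 0 inside the
    disc.\<close>
  define s where "s k = complex_of_real (\<rho> / (real k + 2))" for k
  have ns: "cmod (s k) = \<rho> / (real k + 2)" for k using \<rho> unfolding s_def norm_of_real by simp
  have s: "s k \<in> ball 0 \<rho>" "s k \<noteq> 0" for k
  proof -
    show "s k \<in> ball 0 \<rho>" using \<rho> by (simp add: ns field_simps add_pos_nonneg)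
    have "cmod (s k) > 0" unfolding ns using \<rho> by simp
    then show "s k \<noteq> 0" by auto
  qed
  have s0: "(\<lambda>k. cmod (s k)) \<longlonglongrightarrow> 0" unfolding ns by real_asymp
  have s0': "s \<longlonglongrightarrow> 0" using s0 by (rule tendsto_norm_zero_cancel)
  have dq: "vdist E (q (s j)) (q (s k)) \<le> C * cmod (s j) + C * cmod (s k)" for j k
  proof -
    have "vnorm E (q (s j) \<ominus> q (s k)) \<le> C * cmod (s j) + C * cmod (s k)"
    proof (rule vnorm_le_dual)
      fix l assume l: "l \<in> unit_dual"
      have "l (q (s j) \<ominus> q (s k)) = (g l (s j) - g l 0) - (g l (s k) - g l 0)"
        using unit_dualD(6) [OF l qE qE] s lq [OF l] by simp
      then show "cmod (l (q (s j) \<ominus> q (s k))) \<le> C * cmod (s j) + C * cmod (s k)"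
        using norm_triangle_ineq4 [of "g l (s j) - g l 0" "g l (s k) - g l 0"] gl [OF l s(1), of j] gl [OF l s(1), of k] by simp
    qed (use qE s in auto)
    then show ?thesis using qE s by (simp add: vdist_eq)
  qed
  interpret Metric_space "carrier E" "vdist E" by (rule metric)
  have "MCauchy (\<lambda>k. q (s k))"
    unfolding MCauchy_def
  proof (intro conjI allI impI)
    fix e :: real assume e: "e > 0"
    then have "\<forall>\<^sub>F k in sequentially. cmod (s k) < e / (2 * C)"
      using C by (intro order_tendstoD(2) [OF s0]) simp
    then obtain N where N: "\<And>k. k \<ge> N \<Longrightarrow> cmod (s k) < e / (2 * C)" unfolding eventually_sequentially by blast
    have "vdist E (q (s j)) (q (s k)) < e" if "N \<le> j" "N \<le> k" for j k
    proof -
      have "C * cmod (s j) < e / 2" "C * cmod (s k) < e / 2" using N [OF that(1)] N [OF that(2)] C by (auto simp: field_simps)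
      then show ?thesis using dq [of j k] by linarith
    qed
    then show "\<exists>N. \<forall>n n'. N \<le> n \<longrightarrow> N \<le> n' \<longrightarrow> vdist E (q (s n)) (q (s n')) < e" by blast
  qed (use qE s in auto)
  then obtain e where lim: "limitin mtopology (\<lambda>k. q (s k)) e sequentially"
    using complete unfolding mcomplete_def by blast
  then have eE: "e \<in> carrier E" using limitin_mspace by blast
  have le: "l e = g l 0" if l: "l \<in> unit_dual" for l
  proof -
    have "(\<lambda>k. vdist E (q (s k)) e) \<longlonglongrightarrow> 0" using lim by (simp add: limitin_metric_dist_null)
    then have "(\<lambda>k. l (q (s k)) - l e) \<longlonglongrightarrow> 0"
    proof (rule Lim_null_comparison [rotated])
      have "cmod (l (q (s k)) - l e) \<le> vdist E (q (s k)) e" for k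
        using unit_dualD(3) [OF l, of "q (s k) \<ominus> e"] unit_dualD(6) [OF l] qE [OF s(1)] eE by (simp add: vdist_eq)
      then show "\<forall>\<^sub>F k in sequentially. norm (l (q (s k)) - l e) \<le> vdist E (q (s k)) e" by simp
    qed
    then have "(\<lambda>k. l (q (s k))) \<longlonglongrightarrow> l e" by (simp add: LIM_zero_iff)
    then have "(\<lambda>k. g l (s k)) \<longlonglongrightarrow> l e" using lq [OF l s] by simp
    moreover have "isCont (g l) 0"
      using holomorphic_on_imp_continuous_on [OF g(1) [OF l]] \<rho> by (simp add: continuous_on_eq_continuous_at)
    then have "(\<lambda>k. g l (s k)) \<longlonglongrightarrow> g l 0" using s0' by (rule isCont_tendsto_compose)
    ultimately show ?thesis by (rule LIMSEQ_unique)
  qed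
  define d where "d z = (if z = 0 then e else q z)" for z
  have dE: "d z \<in> carrier E" if "z \<in> ball 0 \<rho>" for z using that eE qE by (simp add: d_def)
  have ld: "l (d z) = g l z" if "l \<in> unit_dual" "z \<in> ball 0 \<rho>" for l z
    using that lq le by (simp add: d_def)
  have "weakly_holomorphic \<rho> (3 * M / \<rho>) d"
    unfolding weakly_holomorphic_def
  proof (intro conjI ballI)
    fix z :: complex assume z: "z \<in> ball 0 \<rho>"
    show "d z \<in> carrier E" by (rule dE [OF z])
    show "vnorm E (d z) \<le> 3 * M / \<rho>" by (rule vnorm_le_dual [OF dE [OF z]]) (use ld g(3) z in simp)
  next
    fix l assume l: "l \<in> unit_dual"
    show "(\<lambda>z. l (d z)) holomorphic_on ball 0 \<rho>"
      by (rule holomorphic_transform [OF g(1) [OF l]]) (use ld [OF l] in simp)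
  qed
  moreover have "c z = c 0 \<oplus> z \<odot> d z" if z: "z \<in> ball 0 \<rho>" for z
  proof (rule eq_dual)
    fix l assume l: "l \<in> unit_dual"
    have "l (c 0 \<oplus> z \<odot> d z) = l (c 0) + z * g l z" using dE [OF z] c0 unit_dualD [OF l] ld [OF l z] by simp
    also have "\<dots> = l (c z)" by (rule g(2) [OF l, symmetric])
    finally show "l (c z) = l (c 0 \<oplus> z \<odot> d z)" ..
  qed (use cE [OF z] dE [OF z] c0 in auto)
  ultimately show ?thesis using that by blast
qed

text \<open>Repeated division by z; each step multiplies the bound on the remainder by 3 / \<rho>
  and keeps the disc.\<close>

lemma weakly_holomorphic_expansion:
  assumes c: "weakly_holomorphic \<rho> M c" and \<rho>: "\<rho> > 0" and M: "M > 0"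
  shows "\<exists>d R. (\<forall>i. d i \<in> carrier E) \<and> d 0 = c 0 \<and> weakly_holomorphic \<rho> ((3 / \<rho>) ^ Suc n * M) R \<and>
    (\<forall>z\<in>ball 0 \<rho>. c z = lincomb d n (\<lambda>j. z ^ Suc j) \<oplus> z ^ Suc n \<odot> R z)"
proof (induction n)
  case 0
  obtain R where R: "weakly_holomorphic \<rho> (3 * M / \<rho>) R" "\<And>z. z \<in> ball 0 \<rho> \<Longrightarrow> c z = c 0 \<oplus> z \<odot> R z"
    using weakly_holomorphic_divide [OF c \<rho> M] by blast
  have "c 0 \<in> carrier E" using c \<rho> by (simp add: weakly_holomorphic_def)
  then show ?case using R(1) by (intro exI [of _ "\<lambda>i. c 0"] exI [of _ R]) (auto intro: R(2))
next
  case (Suc n)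
  then obtain d R where d: "\<And>i. d i \<in> carrier E" "d 0 = c 0" and R: "weakly_holomorphic \<rho> ((3 / \<rho>) ^ Suc n * M) R"
    and eq: "\<And>z. z \<in> ball 0 \<rho> \<Longrightarrow> c z = lincomb d n (\<lambda>j. z ^ Suc j) \<oplus> z ^ Suc n \<odot> R z" by blast
  have M': "(3 / \<rho>) ^ Suc n * M > 0" using \<rho> M by simp
  obtain R' where R': "weakly_holomorphic \<rho> (3 * ((3 / \<rho>) ^ Suc n * M) / \<rho>) R'" "\<And>z. z \<in> ball 0 \<rho> \<Longrightarrow> R z = R 0 \<oplus> z \<odot> R' z"
    using weakly_holomorphic_divide [OF R \<rho> M'] by blast
  have R0: "R 0 \<in> carrier E" and R'E: "\<And>z. z \<in> ball 0 \<rho> \<Longrightarrow> R' z \<in> carrier E"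
    using R R'(1) \<rho> by (auto simp: weakly_holomorphic_def)
  \<comment> \<open>The next coefficient is the value at 0 of the old remainder; the earlier ones
    are unchanged.\<close>
  let ?d = "d(Suc n := R 0)"
  have dE: "?d i \<in> carrier E" for i using d R0 by simp
  have expansion: "c z = lincomb ?d (Suc n) (\<lambda>j. z ^ Suc j) \<oplus> z ^ Suc (Suc n) \<odot> R' z" if z: "z \<in> ball 0 \<rho>" for z
  proof -
    have "lincomb ?d n (\<lambda>j. z ^ Suc j) = lincomb d n (\<lambda>j. z ^ Suc j)" by (rule lincomb_cong) auto
    then have l: "lincomb ?d (Suc n) (\<lambda>j. z ^ Suc j) = lincomb d n (\<lambda>j. z ^ Suc j) \<oplus> z ^ Suc n \<odot> R 0" by simp
    have "c z = lincomb d n (\<lambda>j. z ^ Suc j) \<oplus> z ^ Suc n \<odot> (R 0 \<oplus> z \<odot> R' z)" using eq [OF z] R'(2) [OF z] by simp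
    also have "\<dots> = (lincomb d n (\<lambda>j. z ^ Suc j) \<oplus> z ^ Suc n \<odot> R 0) \<oplus> z ^ Suc (Suc n) \<odot> R' z"
      using d R0 R'E [OF z] by (intro eq_dual) (auto simp: unit_dualD algebra_simps)
    finally show ?thesis unfolding l .
  qed
  have "3 * ((3 / \<rho>) ^ Suc n * M) / \<rho> = (3 / \<rho>) ^ Suc (Suc n) * M" by simp
  with R'(1) have R'': "weakly_holomorphic \<rho> ((3 / \<rho>) ^ Suc (Suc n) * M) R'" by (simp only:)
  have d0: "?d 0 = c 0" using d(2) by simp
  show ?case
    by (intro exI [of _ ?d] exI [of _ R'] conjI allI ballI) (rule dE, rule d0, rule R'', erule expansion)
qed

text \<open>On the unit disc the Taylor polynomials of c differ from it by at most (3/8) ^ (n + 1)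
  M, which tends to 0. By uniform continuity of \<open>\<Phi>\<close> near the compact curve, the
  inequality for polynomial curves passes to c.\<close>

theorem submean_curve:
  assumes \<Phi>: "line_submean B \<Phi>" and wh: "weakly_holomorphic 8 M c" and M: "M > 0"
    and c: "curve_on (cball 0 1) B c"
  shows "\<Phi> (c 0) \<le> cmean (\<lambda>z. \<Phi> (c z)) 0 1"
proof (rule field_le_epsilon)
  fix e :: real assume e: "e > 0"
  obtain \<tau> where \<tau>: "\<tau> > 0" "\<And>z y. z \<in> cball 0 1 \<Longrightarrow> y \<in> carrier E \<Longrightarrow> vdist E (c z) y < \<tau> \<Longrightarrow> y \<in> B \<and> \<bar>\<Phi> y - \<Phi> (c z)\<bar> < e"
    using uniform_near_curve [OF \<Phi> compact_cball c e] by blast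
  have "(\<lambda>n. (3 / 8 :: real) ^ Suc n * M) \<longlonglongrightarrow> 0" by real_asymp
  then have "\<forall>\<^sub>F n in sequentially. (3 / 8 :: real) ^ Suc n * M < \<tau>" using \<tau>(1) by (rule order_tendstoD(2))
  then obtain n where n: "(3 / 8 :: real) ^ Suc n * M < \<tau>" unfolding eventually_sequentially by blast
  from weakly_holomorphic_expansion [OF wh zero_less_numeral M, of n]
  obtain d R where dR: "(\<forall>i. d i \<in> carrier E) \<and> d 0 = c 0 \<and> weakly_holomorphic 8 ((3 / 8) ^ Suc n * M) R \<and>
      (\<forall>z\<in>ball 0 8. c z = lincomb d n (\<lambda>j. z ^ Suc j) \<oplus> z ^ Suc n \<odot> R z)"
    by (elim exE)
  have d: "d i \<in> carrier E" "d 0 = c 0" for i using dR by blast+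
  have R: "weakly_holomorphic 8 ((3 / 8) ^ Suc n * M) R" using dR by (elim conjE)
  have eq: "c z = lincomb d n (\<lambda>j. z ^ Suc j) \<oplus> z ^ Suc n \<odot> R z" if "z \<in> ball 0 8" for z
    using dR that by (elim conjE) (rule bspec)
  let ?P = "\<lambda>z. lincomb d n (\<lambda>j. z ^ Suc j)"
  have near: "?P z \<in> B \<and> \<bar>\<Phi> (?P z) - \<Phi> (c z)\<bar> < e" if z: "z \<in> cball 0 1" for z
  proof -
    have z8: "z \<in> ball 0 8" using z by simp
    have RE: "R z \<in> carrier E" "vnorm E (R z) \<le> (3 / 8) ^ Suc n * M" using R z8 by (auto simp: weakly_holomorphic_def)
    have PE: "?P z \<in> carrier E" using d by simp
    have "c z \<ominus> ?P z = z ^ Suc n \<odot> R z"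
      unfolding eq [OF z8] using PE RE by (intro eq_dual) (auto simp: unit_dualD simp del: power_Suc)
    moreover have "c z \<in> carrier E" using wh z8 by (simp add: weakly_holomorphic_def)
    ultimately have "vdist E (c z) (?P z) = cmod z ^ Suc n * vnorm E (R z)"
      using PE RE by (simp add: vdist_eq vnorm_smult norm_power del: power_Suc)
    also have "\<dots> \<le> 1 * vnorm E (R z)"
      using z vnorm_nonneg [OF RE(1)] by (intro mult_right_mono power_le_one) auto
    also have "\<dots> < \<tau>" using RE(2) n by simp
    finally show ?thesis using \<tau>(2) [OF z PE] by blast
  qed
  have cP: "continuous_on (cball 0 1) (\<lambda>z. \<Phi> (?P z))"
    by (rule continuous_on_curve [OF \<Phi> curve_on_lincomb [OF d(1)]]) (use near in blast)
  have cc: "continuous_on (cball 0 1) (\<lambda>z. \<Phi> (c z))" by (rule continuous_on_curve [OF \<Phi> c])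
  have sph: "sphere 0 1 \<subseteq> cball (0::complex) 1" by auto
  have "\<Phi> (c 0) \<le> cmean (\<lambda>z. \<Phi> (?P z)) 0 1"
    using submean_polynomial_curve [of B \<Phi> d n, OF \<Phi> d(1)] near d(2) by simp
  also have "\<dots> \<le> cmean (\<lambda>z. \<Phi> (c z) + e) 0 1"
  proof (rule cmean_mono)
    show "continuous_on (sphere 0 1) (\<lambda>z. \<Phi> (?P z))" by (rule continuous_on_subset [OF cP sph])
    show "continuous_on (sphere 0 1) (\<lambda>z. \<Phi> (c z) + e)" by (intro continuous_intros continuous_on_subset [OF cc sph])
    fix z :: complex assume "z \<in> sphere 0 1"
    then show "\<Phi> (?P z) \<le> \<Phi> (c z) + e" using near [of z] sph by (auto simp: abs_less_iff simp del: power_Suc)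
  qed simp
  also have "\<dots> = cmean (\<lambda>z. \<Phi> (c z)) 0 1 + e"
    using continuous_on_subset [OF cc sph] by (subst cmean_add) auto
  finally show "\<Phi> (c 0) \<le> cmean (\<lambda>z. \<Phi> (c z)) 0 1 + e" .
qed

end

section \<open>Necessity\<close>

lemma mholomorphic_const:
  assumes M: "atlas_manifold M" and X: "atlas_manifold X" and p: "p \<in> points X"
  shows "mholomorphic M X (\<lambda>_. p)"
proof -
  interpret M: atlas_manifold M by fact
  interpret X: atlas_manifold X by fact
  have "mdiff M X (\<lambda>_. p) x" for x
    unfolding mdiff_def
  proof (intro ballI impI)
    fix c d assume c: "c \<in> atlas M" and d: "d \<in> atlas X" and x: "x \<in> cdom c" and pd: "p \<in> cdom d"
    let ?V = "cmap c ` cdom c" and ?F = "cmodel d" and ?E = "cmodel c"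
    interpret E: complex_banach_space ?E by (rule M.model [OF c])
    interpret F: complex_banach_space ?F by (rule X.model [OF d])
    have pF: "cmap d p \<in> carrier ?F" by (rule X.cmap_in_carrier [OF d pd])
    have xV: "cmap c x \<in> ?V" using x by blast
    have bl: "bounded_clinear ?E ?F (\<lambda>_. \<zero>\<^bsub>?F\<^esub>)"
      by (auto simp: bounded_clinear_def intro!: exI [of _ 0])
    have "has_cderivative_at ?E ?F ?V (\<lambda>y. cmap d p \<oplus>\<^bsub>?F\<^esub> \<zero>\<^bsub>?F\<^esub>) (\<lambda>_. \<zero>\<^bsub>?F\<^esub>) (cmap c x)"
      by (rule cderivative_affine [OF M.model [OF c] X.model [OF d] bl pF xV M.cmap_carrier [OF c]])
    then have "has_cderivative_at ?E ?F ?V (cmap d \<circ> (\<lambda>_. p) \<circ> cinv c) (\<lambda>_. \<zero>\<^bsub>?F\<^esub>) (cmap c x)"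
      by (rule cderivative_cong [OF _ xV]) (use pF in simp)
    then show "\<exists>V D. openin (vtop ?E) V \<and> cmap c x \<in> V \<and> V \<subseteq> cmap c ` (cdom c \<inter> (\<lambda>_. p) -` cdom d) \<and>
        has_cderivative_at ?E ?F V (cmap d \<circ> (\<lambda>_. p) \<circ> cinv c) D (cmap c x)"
      using xV M.open_range [OF c] pd by (intro exI [of _ ?V] exI [of _ "\<lambda>_. \<zero>\<^bsub>?F\<^esub>"]) auto
  qed
  then show ?thesis using p unfolding mholomorphic_iff [OF M X.chart_target] by simp
qed

lemma continuous_map_line:
  assumes E: "complex_banach_space E" and p: "p \<in> carrier E" and v: "v \<in> carrier E"
  shows "continuous_map euclidean (vtop E) (\<lambda>t. p \<oplus>\<^bsub>E\<^esub> t \<odot>\<^bsub>E\<^esub> v)"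
proof -
  interpret E: complex_banach_space E by fact
  let ?l = "\<lambda>t. p \<oplus>\<^bsub>E\<^esub> t \<odot>\<^bsub>E\<^esub> v"
  have n: "vnorm E v + 1 > 0" using E.vnorm_nonneg [OF v] by simp
  have "\<exists>U. openin euclidean U \<and> t \<in> U \<and> (\<forall>s\<in>U. ?l s \<in> Metric_space.mball (carrier E) (vdist E) (?l t) e)" if e: "e > 0" for t e
  proof (intro exI [of _ "ball t (e / (vnorm E v + 1))"] conjI ballI)
    show "t \<in> ball t (e / (vnorm E v + 1))" using e n by simp
    fix s assume "s \<in> ball t (e / (vnorm E v + 1))"
    then have "cmod (t - s) * (vnorm E v + 1) < e" using n by (simp add: dist_norm field_simps)
    moreover have "cmod (t - s) * vnorm E v \<le> cmod (t - s) * (vnorm E v + 1)" by (simp add: mult_left_mono)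
    ultimately have "vdist E (?l t) (?l s) < e" unfolding E.vdist_line [OF p v] by linarith
    then show "?l s \<in> Metric_space.mball (carrier E) (vdist E) (?l t) e"
      using p v E.in_vball unfolding vball_def by simp
  qed simp
  then show ?thesis unfolding vtop_def Metric_space.continuous_map_to_metric [OF E.metric] by blast
qed

lemma mholomorphic_line:
  assumes E: "complex_banach_space E" and p: "p \<in> carrier E" and v: "v \<in> carrier E" and D: "open D"
    and R: "openin (vtop E) R" "\<And>t. t \<in> D \<Longrightarrow> p \<oplus>\<^bsub>E\<^esub> t \<odot>\<^bsub>E\<^esub> v \<in> R"
  shows "mholomorphic (open_submfd complex_plane D) (open_submfd (space_mfd E) R) (\<lambda>t. p \<oplus>\<^bsub>E\<^esub> t \<odot>\<^bsub>E\<^esub> v)"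
proof -
  interpret E: complex_banach_space E by fact
  note C = complex_banach_space_complex_space
  have "has_cderivative_at complex_space E D (\<lambda>t. p \<oplus>\<^bsub>E\<^esub> t \<odot>\<^bsub>E\<^esub> v) (\<lambda>t. t \<odot>\<^bsub>E\<^esub> v) t" if "t \<in> D" for t
    by (rule cderivative_affine [OF C E bounded_clinear_line [OF E v] p that]) simp
  then have "vholomorphic_on complex_space E D (\<lambda>t. p \<oplus>\<^bsub>E\<^esub> t \<odot>\<^bsub>E\<^esub> v)"
    using D p v unfolding vholomorphic_on_def by auto
  then have "mholomorphic (open_submfd complex_plane D) (space_mfd E) (\<lambda>t. p \<oplus>\<^bsub>E\<^esub> t \<odot>\<^bsub>E\<^esub> v)"
    using mholomorphic_space_iff [OF C E, of D] D continuous_map_from_subtopology [OF continuous_map_line [OF E p v]] by simp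
  then show ?thesis
    using mholomorphic_open_target [OF atlas_manifold_plane [OF D] atlas_manifold.chart_target [OF atlas_manifold_space_mfd [OF E]], of R] R D by auto
qed

definition real_phi :: "('p \<Rightarrow> ereal) \<Rightarrow> 'p \<Rightarrow> real" where
  "real_phi \<phi> = real_of_ereal \<circ> \<phi>"

lemma hartogs_set_real_iff:
  assumes "\<And>z. z \<in> points X \<Longrightarrow> \<bar>\<phi> z\<bar> \<noteq> \<infinity>"
  shows "(z, w) \<in> hartogs_set X \<phi> \<longleftrightarrow> z \<in> points X \<and> cmod w < exp (- real_phi \<phi> z)"
proof (cases "z \<in> points X")
  case True
  then obtain r where "\<phi> z = ereal r" using assms [OF True] by (cases "\<phi> z") auto
  then show ?thesis using True by (simp add: hartogs_set_def real_phi_def exp_ereal_def)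
qed (simp add: hartogs_set_def)

lemma zero_in_hartogs_set:
  assumes "usc (mtop X) \<phi>" "z \<in> points X" shows "(z, 0) \<in> hartogs_set X \<phi>"
proof -
  have "\<phi> z < \<infinity>" using assms by (simp add: usc_def)
  then obtain c where "\<phi> z < ereal c" using less_PInf_Ex_of_nat by fastforce
  then show ?thesis using assms hartogs_set_iff [OF assms(1)] by auto
qed

section \<open>Consequences of the weak Vitali property of the Hartogs domain\<close>

context
  fixes X :: "('x, 'v) banach_mfd" and \<phi> :: "'x \<Rightarrow> ereal" and emb :: "complex \<Rightarrow> 'u"
  assumes X: "banach_manifold X" and usc: "usc (mtop X) \<phi>" and inj: "inj emb"
    and wv: "weak_vitali TYPE('u) (hartogs_domain X \<phi>)"
begin

interpretation X: banach_manifold X by (rule X)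
interpretation X: atlas_manifold X by (rule X.atlas_manifold)

lemmas spread = weak_vitali_hartogs_spread [OF inj X.atlas_manifold usc wv]

lemma phi_finite:
  assumes p: "p \<in> points X" shows "\<bar>\<phi> p\<bar> \<noteq> \<infinity>"
proof
  assume "\<bar>\<phi> p\<bar> = \<infinity>"
  then have m: "\<phi> p = - \<infinity>" using usc p unfolding usc_def by (cases "\<phi> p") auto
  then have H: "(p, w) \<in> hartogs_set X \<phi>" for w using p by (simp add: hartogs_set_def exp_ereal_def)
  \<comment> \<open>The powers of exp z tend to 0 on the left half-plane and are unbounded at z = 1,
    while every value is allowed in a fibre that is the whole plane.\<close>
  let ?N = "{z. Re z < 0}"
  have "\<exists>q w. (q, w) \<in> hartogs_set X \<phi> \<and> limitin (mtop X) (\<lambda>k. p) q sequentially \<and> (\<lambda>k. exp (of_nat k * (1::complex))) \<longlonglongrightarrow> w"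
  proof (rule spread [of UNIV ?N "\<lambda>k z. p" "\<lambda>k z. exp (of_nat k * z)"])
    show "open ?N" by (rule open_halfspace_Re_lt)
    have "-1 \<in> ?N" by simp
    then show "?N \<noteq> {}" by blast
    show "mholomorphic (open_submfd complex_plane UNIV) X (\<lambda>z. p)"
      by (rule mholomorphic_const [OF atlas_manifold_plane [OF open_UNIV] X.atlas_manifold p])
    show "(\<lambda>z. exp (of_nat k * z)) holomorphic_on UNIV" for k by (intro holomorphic_intros)
    fix z assume z: "z \<in> ?N"
    have "(\<lambda>k. exp z ^ k) \<longlonglongrightarrow> 0" by (rule LIMSEQ_power_zero) (use z in simp)
    then have "(\<lambda>k. exp (of_nat k * z)) \<longlonglongrightarrow> 0" by (simp add: exp_of_nat_mult)
    then show "\<exists>q w. (q, w) \<in> hartogs_set X \<phi> \<and> limitin (mtop X) (\<lambda>k. p) q sequentially \<and> (\<lambda>k. exp (of_nat k * z)) \<longlonglongrightarrow> w"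
      using H p by (intro exI [of _ p] exI [of _ 0]) simp
  qed (use H in auto)
  then obtain w where "(\<lambda>k. exp (of_nat k * (1::complex))) \<longlonglongrightarrow> w" by blast
  then have "(\<lambda>k. norm (exp (of_nat k * (1::complex)))) \<longlonglongrightarrow> norm w" by (rule tendsto_norm)
  then have "(\<lambda>k. exp (real k)) \<longlonglongrightarrow> norm w" by simp
  moreover have "filterlim (\<lambda>k. exp (real k)) at_top sequentially" by real_asymp
  ultimately show False
    using not_tendsto_and_filterlim_at_infinity [OF sequentially_bot] filterlim_at_top_imp_at_infinity by blast
qed

lemma H_iff: "(p, w) \<in> hartogs_set X \<phi> \<longleftrightarrow> p \<in> points X \<and> cmod w < exp (- real_phi \<phi> p)"
  by (rule hartogs_set_real_iff) (rule phi_finite)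

lemma phi_real: "p \<in> points X \<Longrightarrow> \<phi> p = ereal (real_phi \<phi> p)"
  using phi_finite [of p] by (cases "\<phi> p") (auto simp: real_phi_def)

lemma continuous_real_phi: "continuous_map (mtop X) euclideanreal (real_phi \<phi>)"
  unfolding continuous_map_upper_lower_semicontinuous_lt
proof (intro conjI allI)
  fix c
  have "{x \<in> points X. real_phi \<phi> x < c} = {x \<in> points X. \<phi> x < ereal c}" using phi_real by auto
  then show "openin (mtop X) {x \<in> points X. real_phi \<phi> x < c}" using usc by (simp add: usc_def)
  show "openin (mtop X) {x \<in> points X. c < real_phi \<phi> x}"
  proof (subst openin_subopen, intro ballI)
    fix p assume "p \<in> {x \<in> points X. c < real_phi \<phi> x}"
    then have p: "p \<in> points X" "c < real_phi \<phi> p" by auto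
    show "\<exists>T. openin (mtop X) T \<and> p \<in> T \<and> T \<subseteq> {x \<in> points X. c < real_phi \<phi> x}"
    proof (rule ccontr)
      assume neg: "\<not> ?thesis"
      have "\<exists>y\<in>U. y \<in> points X \<and> real_phi \<phi> y \<le> c" if "openin (mtop X) U" "p \<in> U" for U
        using neg that openin_subset [OF that(1)] by (metis (mono_tags, lifting) mem_Collect_eq not_le subsetD subsetI)
      then obtain s where s: "\<And>n. s n \<in> points X \<and> real_phi \<phi> (s n) \<le> c" "limitin (mtop X) s p sequentially"
        using X.sequence_at [OF p(1), of "\<lambda>n y. y \<in> points X \<and> real_phi \<phi> y \<le> c"] by blast
      \<comment> \<open>A boundary point of the fibre over p. It still belongs to the common disc of
        radius exp (- c) in the fibres over the s k, because c is less than the value at p.\<close>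
      define w where "w = complex_of_real (exp (- real_phi \<phi> p))"
      have nw: "cmod w = exp (- real_phi \<phi> p)" unfolding w_def norm_of_real by simp
      have "\<exists>q w'. (q, w') \<in> hartogs_set X \<phi> \<and> limitin (mtop X) (\<lambda>k. s k) q sequentially \<and> (\<lambda>k. w) \<longlonglongrightarrow> w'"
      proof (rule spread [of "ball 0 (exp (- c))" "ball 0 (exp (- real_phi \<phi> p))" "\<lambda>k z. s k" "\<lambda>k z. z"])
        show "mholomorphic (open_submfd complex_plane (ball 0 (exp (- c)))) X (\<lambda>z. s k)" for k
          by (rule mholomorphic_const [OF atlas_manifold_plane [OF open_ball] X.atlas_manifold]) (use s in blast)
        show "(s k, z) \<in> hartogs_set X \<phi>" if "z \<in> ball 0 (exp (- c))" for k z
        proof -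
          have "exp (- c) \<le> exp (- real_phi \<phi> (s k))" using s(1) [of k] by simp
          then show ?thesis using H_iff that s(1) [of k] by (simp del: exp_le_cancel_iff)
        qed
        show "\<exists>q w. (q, w) \<in> hartogs_set X \<phi> \<and> limitin (mtop X) (\<lambda>k. s k) q sequentially \<and> (\<lambda>k. z) \<longlonglongrightarrow> w"
          if "z \<in> ball 0 (exp (- real_phi \<phi> p))" for z
          using H_iff that s(2) p(1) by (intro exI [of _ p] exI [of _ z]) simp
        show "ball 0 (exp (- real_phi \<phi> p)) \<subseteq> ball (0::complex) (exp (- c))" using p(2) by (intro subset_ball) simp
        show "w \<in> ball 0 (exp (- c))" using p(2) nw by simp
      qed (auto intro: holomorphic_on_ident)
      then obtain q w' where q: "(q, w') \<in> hartogs_set X \<phi>" "limitin (mtop X) s q sequentially" "(\<lambda>k. w) \<longlonglongrightarrow> w'" by auto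
      have "q = p" by (rule limitin_Hausdorff_unique [OF q(2) s(2) sequentially_bot X.Hausdorff])
      moreover have "w' = w" using q(3) by (simp add: LIMSEQ_const_iff)
      ultimately show False using q(1) H_iff nw by simp
    qed
  qed
qed

lemma continuous_real_hartogs: "continuous_real X \<phi>"
  using continuous_real_phi phi_finite by (simp add: continuous_real_def real_phi_def)

text \<open>A failure gives a harmonic function above u on the circle but below it at the centre.
  Raised until it just touches u from above, it touches inside, and multiples of exp (- g) form
  discs in the Hartogs domain whose limit meets the boundary there.\<close>

lemma submean_disc:
  assumes D: "cball a s \<subseteq> D" "open D" and s: "s > 0" and \<gamma>: "mholomorphic (open_submfd complex_plane D) X \<gamma>"
  shows "real_phi \<phi> (\<gamma> a) \<le> cmean (real_phi \<phi> \<circ> \<gamma>) a s"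
proof (rule ccontr)
  let ?u = "real_phi \<phi> \<circ> \<gamma>"
  assume "\<not> ?thesis"
  then have lt: "cmean ?u a s < ?u a" by simp
  have c\<gamma>: "continuous_map (top_of_set D) (mtop X) \<gamma>" using \<gamma> by (simp add: mholomorphic_def)
  have "continuous_map (top_of_set D) euclideanreal ?u"
    by (rule continuous_map_compose [OF c\<gamma> continuous_real_phi])
  then have cu: "continuous_on (cball a s) ?u" using D continuous_on_subset by auto
  have \<gamma>X: "\<gamma> z \<in> points X" if "z \<in> cball a s" for z
    using c\<gamma> D(1) that by (auto simp: continuous_map_def)
  obtain f where f: "f holomorphic_on UNIV" "\<And>z. z \<in> sphere a s \<Longrightarrow> ?u z < Re (f z)" "Re (f a) < ?u a"
    using harmonic_majorant [OF s _ lt] continuous_on_subset [OF cu] by (metis sphere_cball)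
  let ?d = "\<lambda>z. Re (f z) - ?u z"
  have cd: "continuous_on (cball a s) ?d"
    using holomorphic_on_imp_continuous_on [OF f(1)] by (intro continuous_intros cu) (auto intro: continuous_on_subset)
  \<comment> \<open>The contact point. The minimum m is negative because of the centre, whereas the
    difference is positive on the circle, so z0 is interior.\<close>
  obtain z0 where z0: "z0 \<in> cball a s" "\<And>z. z \<in> cball a s \<Longrightarrow> ?d z0 \<le> ?d z"
    using continuous_attains_inf [OF compact_cball _ cd] s by auto
  define m where "m = ?d z0"
  have m: "m < 0" using z0(2) [of a] f(3) s by (simp add: m_def)
  have z0b: "z0 \<in> ball a s"
  proof (rule ccontr)
    assume "z0 \<notin> ball a s"
    then have "z0 \<in> sphere a s" using z0(1) by auto
    then show False using f(2) [of z0] m by (simp add: m_def)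
  qed
  define g where "g z = f z - of_real m" for z
  have g: "g holomorphic_on UNIV" unfolding g_def by (intro holomorphic_intros f)
  have gu: "?u z \<le> Re (g z)" if "z \<in> cball a s" for z using z0(2) [OF that] by (simp add: g_def m_def)
  have g0: "Re (g z0) = ?u z0" by (simp add: g_def m_def)
  define t where "t k = real k / (real k + 1)" for k
  have t: "0 \<le> t k" "t k < 1" for k by (simp_all add: t_def field_simps)
  have t1: "t \<longlonglongrightarrow> 1" unfolding t_def by real_asymp
  let ?b = "\<lambda>k z. of_real (t k) * exp (- g z)"
  have bH: "(\<gamma> z, ?b k z) \<in> hartogs_set X \<phi>" if z: "z \<in> ball a s" for k z
  proof -
    have "cmod (?b k z) = t k * exp (- Re (g z))" using t(1) by (simp add: norm_mult)
    also have "\<dots> < 1 * exp (- Re (g z))" by (rule mult_strict_right_mono [OF t(2)]) simp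
    also have "\<dots> \<le> exp (- real_phi \<phi> (\<gamma> z))" using gu [of z] z by simp
    finally show ?thesis using H_iff \<gamma>X z by simp
  qed
  have blim: "(\<lambda>k. ?b k z) \<longlonglongrightarrow> exp (- g z)" for z
    using tendsto_mult [OF tendsto_of_real [OF t1] tendsto_const, of "exp (- g z)"] by simp
  have lim\<gamma>: "limitin (mtop X) (\<lambda>k. \<gamma> z) (\<gamma> z) sequentially" if "z \<in> cball a s" for z using \<gamma>X [OF that] by simp
  \<comment> \<open>Off the contact set the limit lies strictly inside the fibres, so the discs
    converge in the Hartogs domain there.\<close>
  define N where "N = {z \<in> ball a s. ?u z < Re (g z)}"
  have cdb: "continuous_on (ball a s) (\<lambda>z. Re (g z) - ?u z)"
    using holomorphic_on_imp_continuous_on [OF g] by (intro continuous_intros continuous_on_subset [OF cu]) (auto intro: continuous_on_subset)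
  have "open N"
  proof -
    have "N = ball a s \<inter> (\<lambda>z. Re (g z) - ?u z) -` {0<..}" by (auto simp: N_def)
    then show ?thesis using continuous_open_preimage [OF cdb open_ball open_greaterThan] by simp
  qed
  \<comment> \<open>Otherwise the difference would equal the negative constant m up to the circle,
    where it is positive.\<close>
  have "N \<noteq> {}"
  proof
    assume "N = {}"
    then have eq: "?d z = m" if "z \<in> ball a s" for z
      using that gu [of z] unfolding N_def g_def by force
    have "a + of_real s \<in> cball a s" "a + of_real s \<in> sphere a s" using s by (auto simp: dist_norm)
    moreover have "?d z = m" if "z \<in> cball a s" for z
      using continuous_constant_on_closure [of "ball a s" ?d m z] cd eq that s by simp
    ultimately show False using f(2) m by fastforce
  qed
  have "\<exists>q w. (q, w) \<in> hartogs_set X \<phi> \<and> limitin (mtop X) (\<lambda>k. \<gamma> z0) q sequentially \<and> (\<lambda>k. ?b k z0) \<longlonglongrightarrow> w"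
  proof (rule spread [of "ball a s" N "\<lambda>k. \<gamma>" ?b])
    show "mholomorphic (open_submfd complex_plane (ball a s)) X \<gamma>"
      using mholomorphic_open_source [OF atlas_manifold_plane [OF D(2)] X.chart_target, of "ball a s"] \<gamma> D
        open_submfd_open_submfd [of "ball a s" D complex_plane] order_trans [OF ball_subset_cball D(1)]
      by (simp add: openin_open_subtopology)
    show "(\<lambda>z. ?b k z) holomorphic_on ball a s" for k
      by (intro holomorphic_intros holomorphic_on_subset [OF g]) auto
    fix z assume z: "z \<in> N"
    then have "(\<gamma> z, exp (- g z)) \<in> hartogs_set X \<phi>" using H_iff \<gamma>X by (simp add: N_def)
    then show "\<exists>q w. (q, w) \<in> hartogs_set X \<phi> \<and> limitin (mtop X) (\<lambda>k. \<gamma> z) q sequentially \<and> (\<lambda>k. ?b k z) \<longlonglongrightarrow> w"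
      using lim\<gamma> [of z] blim [of z] z by (intro exI [of _ "\<gamma> z"] exI [of _ "exp (- g z)"]) (simp add: N_def)
  qed (use \<open>open N\<close> \<open>N \<noteq> {}\<close> z0b bH in \<open>auto simp: N_def\<close>)
  then obtain q w where q: "(q, w) \<in> hartogs_set X \<phi>" "limitin (mtop X) (\<lambda>k. \<gamma> z0) q sequentially" "(\<lambda>k. ?b k z0) \<longlonglongrightarrow> w"
    by blast
  have "q = \<gamma> z0" by (rule limitin_Hausdorff_unique [OF q(2) lim\<gamma> [OF z0(1)] sequentially_bot X.Hausdorff])
  moreover have "w = exp (- g z0)" by (rule LIMSEQ_unique [OF q(3) blim])
  ultimately show False using q(1) H_iff g0 by simp
qed

text \<open>Chart balls provide the neighbourhoods; a complex line in one of them is a holomorphic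
  curve in X, to which \<open>submean_disc\<close> applies.\<close>

lemma plurisubharmonic_hartogs: "plurisubharmonic X \<phi>"
  unfolding plurisubharmonic_def
proof
  fix z assume z: "z \<in> points X"
  then obtain c where c: "c \<in> atlas X" "z \<in> cdom c" using X.covering by auto
  let ?E = "cmodel c" and ?a = "cmap c z" and ?R = "cmap c ` cdom c"
  have E: "complex_banach_space ?E" by (rule X.model [OF c(1)])
  interpret E: complex_banach_space ?E by (rule E)
  have SE: "atlas_manifold (space_mfd ?E)" by (rule atlas_manifold_space_mfd [OF E])
  obtain r where r: "r > 0" "vball ?E ?a r \<subseteq> cmap c ` (cdom c \<inter> points X)"
    using X.chart_ball_small [OF c openin_topspace z] by metis
  let ?B = "vball ?E ?a r"
  have BR: "?B \<subseteq> ?R" using r(2) by blast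
  have oB: "openin (vtop ?E) ?B" and oR: "openin (vtop ?E) ?R" using X.open_range [OF c(1)] by auto
  define U where "U = X.chart_ball c z r"
  have U: "openin (mtop X) U" "z \<in> U" "U \<subseteq> cdom c"
    unfolding U_def by (auto simp: X.openin_chart_ball c X.chart_ball_self r(1)) (auto simp: X.chart_ball_def)
  have mapU: "cmap c x \<in> ?B" if "x \<in> U" for x using that by (simp add: U_def X.chart_ball_def)
  have invU: "cinv c y \<in> U \<and> cmap c (cinv c y) = y" if y: "y \<in> ?B" for y
  proof -
    obtain x where x: "x \<in> cdom c" "y = cmap c x" using BR y by blast
    then show ?thesis using X.cinv_cmap [OF c(1) x(1)] y by (simp add: U_def X.chart_ball_def)
  qed
  have inv: "mholomorphic (open_submfd (space_mfd ?E) ?R) X (cinv c)" by (rule X.mholomorphic_cinv [OF c(1)])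
  have invB: "mholomorphic (open_submfd (space_mfd ?E) ?B) X (cinv c)"
    using mholomorphic_open_source [OF atlas_manifold.atlas_manifold_open_submfd [OF SE, of ?R] X.chart_target _ inv, of ?B]
      open_submfd_open_submfd [OF BR, of "space_mfd ?E"] oR oB BR by (simp add: openin_open_subtopology)
  have contB: "continuous_map (subtopology (vtop ?E) ?B) (mtop X) (cinv c)" using invB by (simp add: mholomorphic_def)
  have 1: "mholomorphic (open_submfd X U) (space_mfd ?E) (cmap c)"
    using mholomorphic_open_source [OF X.atlas_manifold_open_submfd [OF X.open_cdom [OF c(1)]] atlas_manifold.chart_target [OF SE] _
        X.mholomorphic_cmap [OF c(1)], of U] open_submfd_open_submfd [OF U(3), of X] U X.open_cdom [OF c(1)]
    by (simp add: openin_open_subtopology)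
  have 2: "mholomorphic (open_submfd X U) (open_submfd (space_mfd ?E) ?B) (cmap c)"
    using mholomorphic_open_target [OF X.atlas_manifold_open_submfd [OF U(1)] atlas_manifold.chart_target [OF SE], of ?B] oB 1 mapU by auto
  have 3: "mholomorphic (open_submfd (space_mfd ?E) ?B) (open_submfd X U) (cinv c)"
    using mholomorphic_open_target [OF atlas_manifold.atlas_manifold_open_submfd [OF SE, of ?B] X.chart_target U(1)] oB invB invU by auto
  have biho: "biholomorphic (open_submfd X U) (open_submfd (space_mfd ?E) ?B) (cmap c) (cinv c)"
    unfolding biholomorphic_def using 2 3 invU X.cinv_cmap [OF c(1)] U(3) by auto
  have uscB: "usc (subtopology (vtop ?E) ?B) (\<phi> \<circ> cinv c)"
    unfolding usc_def
  proof (intro conjI ballI allI)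
    fix x assume x: "x \<in> topspace (subtopology (vtop ?E) ?B)"
    have "cinv c x \<in> points X" using contB x unfolding continuous_map_def by blast
    then show "(\<phi> \<circ> cinv c) x < \<infinity>" using usc by (simp add: usc_def)
  next
    fix e
    have eq: "{x \<in> topspace (subtopology (vtop ?E) ?B). (\<phi> \<circ> cinv c) x < e} =
        {x \<in> topspace (subtopology (vtop ?E) ?B). cinv c x \<in> {y \<in> points X. \<phi> y < e}}"
      using contB unfolding continuous_map_def by (intro Collect_cong) (simp only: Pi_iff mem_Collect_eq o_apply, blast)
    have "openin (mtop X) {y \<in> points X. \<phi> y < e}" using usc by (simp add: usc_def)
    then show "openin (subtopology (vtop ?E) ?B) {x \<in> topspace (subtopology (vtop ?E) ?B). (\<phi> \<circ> cinv c) x < e}"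
      unfolding eq by (rule openin_continuous_map_preimage [OF contB])
  qed
  have sub: "subharmonic_on {t. p \<oplus>\<^bsub>?E\<^esub> t \<odot>\<^bsub>?E\<^esub> v \<in> ?B} (\<lambda>t. \<phi> (cinv c (p \<oplus>\<^bsub>?E\<^esub> t \<odot>\<^bsub>?E\<^esub> v)))"
    if p: "p \<in> carrier ?E" and v: "v \<in> carrier ?E" for p v
  proof -
    let ?l = "\<lambda>t. p \<oplus>\<^bsub>?E\<^esub> t \<odot>\<^bsub>?E\<^esub> v" and ?D = "{t. p \<oplus>\<^bsub>?E\<^esub> t \<odot>\<^bsub>?E\<^esub> v \<in> ?B}"
    note cl = continuous_map_line [OF E p v]
    have D: "open ?D" using openin_continuous_map_preimage [OF cl oB] by simp
    have "mholomorphic (open_submfd complex_plane ?D) (open_submfd (space_mfd ?E) ?B) ?l"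
      by (rule mholomorphic_line [OF E p v D oB]) simp
    then have \<gamma>: "mholomorphic (open_submfd complex_plane ?D) X (cinv c \<circ> ?l)"
      using mholomorphic_comp [OF atlas_manifold_plane [OF D] atlas_manifold.atlas_manifold_open_submfd [OF SE, of ?B] X.atlas_manifold _ invB] oB
      by simp
    have c\<gamma>: "continuous_map (top_of_set ?D) (mtop X) (cinv c \<circ> ?l)" using \<gamma> by (simp add: mholomorphic_def)
    have \<gamma>X: "cinv c (?l t) \<in> points X" if "t \<in> ?D" for t using c\<gamma> that by (auto simp: continuous_map_def)
    have "usc (top_of_set ?D) (\<lambda>t. \<phi> (cinv c (?l t)))"
      unfolding usc_def
    proof (intro conjI ballI allI)
      show "\<phi> (cinv c (?l t)) < \<infinity>" if "t \<in> topspace (top_of_set ?D)" for t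
        using \<gamma>X that usc by (simp add: usc_def)
      fix e
      have eq: "{t \<in> topspace (top_of_set ?D). \<phi> (cinv c (?l t)) < e} = {t \<in> topspace (top_of_set ?D). (cinv c \<circ> ?l) t \<in> {y \<in> points X. \<phi> y < e}}"
        using \<gamma>X by auto
      have "openin (mtop X) {y \<in> points X. \<phi> y < e}" using usc by (simp add: usc_def)
      then show "openin (top_of_set ?D) {t \<in> topspace (top_of_set ?D). \<phi> (cinv c (?l t)) < e}"
        unfolding eq by (rule openin_continuous_map_preimage [OF c\<gamma>])
    qed
    moreover have "\<phi> (cinv c (?l a)) \<le> circle_mean (\<lambda>t. \<phi> (cinv c (?l t))) a s" if s: "s > 0" "cball a s \<subseteq> ?D" for a s
    proof -
      have "continuous_map (top_of_set ?D) euclideanreal (real_phi \<phi> \<circ> (cinv c \<circ> ?l))"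
        by (rule continuous_map_compose [OF c\<gamma> continuous_real_phi])
      then have "continuous_on ?D (real_phi \<phi> \<circ> (cinv c \<circ> ?l))" by simp
      moreover have sD: "sphere a s \<subseteq> ?D" using s(2) sphere_cball by blast
      ultimately have cs: "continuous_on (sphere a s) (real_phi \<phi> \<circ> (cinv c \<circ> ?l))" using continuous_on_subset by blast
      have "circle_mean (\<lambda>t. \<phi> (cinv c (?l t))) a s = ereal (cmean (real_phi \<phi> \<circ> (cinv c \<circ> ?l)) a s)"
      proof (rule circle_mean_real [OF _ cs])
        show "\<phi> (cinv c (?l t)) = ereal ((real_phi \<phi> \<circ> (cinv c \<circ> ?l)) t)" if "t \<in> sphere a s" for t
          using phi_real \<gamma>X sD that by auto
      qed (use s in simp)
      moreover have "\<phi> (cinv c (?l a)) = ereal (real_phi \<phi> ((cinv c \<circ> ?l) a))"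
      proof -
        have "a \<in> ?D" using s centre_in_cball [of a s] by (meson less_imp_le subsetD)
        then show ?thesis using phi_real [OF \<gamma>X] by simp
      qed
      ultimately show ?thesis using submean_disc [OF s(2) D s(1) \<gamma>] by simp
    qed
    ultimately show ?thesis using D unfolding subharmonic_on_def by blast
  qed
  show "\<exists>U (E :: 'v cnormed_space) a r h g. openin (mtop X) U \<and> z \<in> U \<and> complex_banach_space E \<and> a \<in> carrier E \<and> 0 < r \<and>
        biholomorphic (open_submfd X U) (open_submfd (space_mfd E) (vball E a r)) h g \<and>
        usc (subtopology (vtop E) (vball E a r)) (\<phi> \<circ> g) \<and>
        (\<forall>p\<in>carrier E. \<forall>v\<in>carrier E. v \<noteq> \<zero>\<^bsub>E\<^esub> \<longrightarrow>
           subharmonic_on {\<zeta>. p \<oplus>\<^bsub>E\<^esub> \<zeta> \<odot>\<^bsub>E\<^esub> v \<in> vball E a r} (\<lambda>\<zeta>. \<phi> (g (p \<oplus>\<^bsub>E\<^esub> \<zeta> \<odot>\<^bsub>E\<^esub> v))))"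
    by (intro exI [of _ U] exI [of _ ?E] exI [of _ ?a] exI [of _ r] exI [of _ "cmap c"] exI [of _ "cinv c"]
        conjI ballI impI U E biho uscB sub X.cmap_in_carrier c r(1))
qed

end

section \<open>Sufficiency\<close>

text \<open>Translates holomorphy in the manifold sense into the dual and metric conditions in which
  the submean inequality for curves is stated.\<close>

lemma mholomorphic_space_curve:
  assumes E: "complex_banach_space E" and D: "open D"
    and \<kappa>: "mholomorphic (open_submfd complex_plane D) (space_mfd E) \<kappa>"
  shows "\<kappa> ` D \<subseteq> carrier E" "l \<in> complex_banach_space.unit_dual E \<Longrightarrow> (\<lambda>z. l (\<kappa> z)) holomorphic_on D"
    "S \<subseteq> D \<Longrightarrow> \<kappa> ` S \<subseteq> B \<Longrightarrow> complex_banach_space.curve_on E S B \<kappa>"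
proof -
  interpret E: complex_banach_space E by fact
  note C = complex_banach_space_complex_space
  have k: "continuous_map (top_of_set D) (vtop E) \<kappa>" "vholomorphic_on complex_space E D \<kappa>"
    using \<kappa> mholomorphic_space_iff [OF C E, of D] D by auto
  show kC: "\<kappa> ` D \<subseteq> carrier E" using k(2) by (auto simp: vholomorphic_on_def)
  show "(\<lambda>z. l (\<kappa> z)) holomorphic_on D" if l: "l \<in> E.unit_dual"
  proof -
    have bl: "bounded_clinear E complex_space l"
      using l by (auto simp: bounded_clinear_def E.unit_dualD intro!: exI [of _ 1])
    have "\<exists>T. has_cderivative_at complex_space complex_space D (l \<circ> \<kappa>) T z" if z: "z \<in> D" for z
    proof -
      obtain A where A: "has_cderivative_at complex_space E D \<kappa> A z"
        using k(2) z unfolding vholomorphic_on_def by blast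
      have kz: "\<kappa> z \<in> carrier E" using kC z by blast
      have "has_cderivative_at E complex_space (carrier E) (\<lambda>y. 0 + l y) l (\<kappa> z)"
        using cderivative_affine [OF E C bl _ kz subset_refl, of 0] by simp
      then have "has_cderivative_at E complex_space (carrier E) l l (\<kappa> z)" by simp
      from cderivative_chain [OF C E C A this z _ subset_refl kC]
      have "has_cderivative_at complex_space complex_space D (l \<circ> \<kappa>) (l \<circ> A) z" by simp
      then show ?thesis by (rule exI [of _ "l \<circ> A"])
    qed
    then have "vholomorphic_on complex_space complex_space D (l \<circ> \<kappa>)" using D by (simp add: vholomorphic_on_def)
    then show ?thesis by (simp add: vholomorphic_complex_iff o_def)
  qed
  show "E.curve_on S B \<kappa>" if S: "S \<subseteq> D" "\<kappa> ` S \<subseteq> B"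
    unfolding E.curve_on_def
  proof (intro conjI ballI allI impI S(2))
    fix z and e :: real assume z: "z \<in> S" and e: "e > 0"
    have kz: "\<kappa> z \<in> carrier E" using kC z S by blast
    have "openin (top_of_set D) {w \<in> topspace (top_of_set D). \<kappa> w \<in> vball E (\<kappa> z) e}"
      by (rule openin_continuous_map_preimage [OF k(1) E.openin_vball])
    then have "open {w \<in> D. \<kappa> w \<in> vball E (\<kappa> z) e}" using D by (simp add: openin_open_eq)
    moreover have "z \<in> {w \<in> D. \<kappa> w \<in> vball E (\<kappa> z) e}" using z S kz e by auto
    ultimately obtain d where "d > 0" "ball z d \<subseteq> {w \<in> D. \<kappa> w \<in> vball E (\<kappa> z) e}" by (meson openE)
    then show "\<exists>d>0. \<forall>w\<in>S. dist w z < d \<longrightarrow> vdist E (\<kappa> z) (\<kappa> w) < e"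
      by (intro exI [of _ d]) (auto simp: subset_iff dist_commute)
  qed
qed

text \<open>\<open>cmod (H z) * exp (\<Phi> (\<kappa> z))\<close> is the exponential of the subharmonic function \<open>log |H| + \<Phi> \<circ> \<kappa>\<close>.\<close>

lemma max_principle_disc:
  assumes E: "complex_banach_space E" and \<Phi>: "complex_banach_space.line_submean E (vball E a r) \<Phi>"
    and a: "a \<in> carrier E"
    and \<kappa>: "mholomorphic (open_submfd complex_plane (ball 0 8)) (space_mfd E) \<kappa>" "\<kappa> ` ball 0 8 \<subseteq> vball E a r"
    and H: "H holomorphic_on ball 0 8" "\<And>z. z \<in> ball 0 8 \<Longrightarrow> H z \<noteq> 0"
    and le: "\<And>z. z \<in> ball 0 8 \<Longrightarrow> cmod (H z) * exp (\<Phi> (\<kappa> z)) \<le> 1" and eq: "cmod (H 0) * exp (\<Phi> (\<kappa> 0)) = 1"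
  shows "cmod (H 1) * exp (\<Phi> (\<kappa> 1)) = 1"
proof -
  interpret E: complex_banach_space E by fact
  define M where "M = max 1 (vnorm E a + r)"
  have bd: "vnorm E (\<kappa> z) \<le> M" if "z \<in> ball 0 8" for z
  proof -
    have kz: "\<kappa> z \<in> vball E a r" using \<kappa>(2) that by blast
    then have kC: "\<kappa> z \<in> carrier E" "vdist E a (\<kappa> z) < r" by auto
    have e: "a \<oplus>\<^bsub>E\<^esub> (\<kappa> z \<ominus>\<^bsub>E\<^esub> a) = \<kappa> z" using a kC by (intro E.eq_dual) (auto simp: E.unit_dualD)
    have "vnorm E (a \<oplus>\<^bsub>E\<^esub> (\<kappa> z \<ominus>\<^bsub>E\<^esub> a)) \<le> vnorm E a + vnorm E (\<kappa> z \<ominus>\<^bsub>E\<^esub> a)"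
      using a kC by (intro E.vnorm_triangle) auto
    moreover have "vnorm E (\<kappa> z \<ominus>\<^bsub>E\<^esub> a) < r" using kC a by (metis E.vdist_commute E.vdist_eq)
    ultimately show ?thesis unfolding e M_def by linarith
  qed
  have wh: "E.weakly_holomorphic 8 M \<kappa>"
    unfolding E.weakly_holomorphic_def
    using bd mholomorphic_space_curve(1,2) [OF E open_ball \<kappa>(1)] by blast
  have b18: "cball 0 1 \<subseteq> ball (0::complex) 8" by auto
  have cv: "E.curve_on (cball 0 1) (vball E a r) \<kappa>"
    by (rule mholomorphic_space_curve(3) [OF E open_ball \<kappa>(1) b18]) (use \<kappa>(2) b18 in blast)
  have M: "M > 0" by (simp add: M_def)
  have sub: "\<Phi> (\<kappa> 0) \<le> cmean (\<lambda>z. \<Phi> (\<kappa> z)) 0 1" by (rule E.submean_curve [OF \<Phi> wh M cv])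
  \<comment> \<open>H has no zeros on the disc, so it has a logarithm q, and log |H| is the harmonic
    function Re q.\<close>
  obtain q where q: "q holomorphic_on ball 0 8" "\<And>z. z \<in> ball 0 8 \<Longrightarrow> exp (q z) = H z"
    using holomorphic_logarithm_exists [OF convex_ball open_ball H, of 0] by auto
  have ex: "exp (Re (q z) + \<Phi> (\<kappa> z)) = cmod (H z) * exp (\<Phi> (\<kappa> z))" if "z \<in> ball 0 8" for z
    unfolding q(2) [OF that, symmetric] by (simp add: exp_add)
  have c1: "continuous_on (cball 0 1) (\<lambda>z. \<Phi> (\<kappa> z))" by (rule E.continuous_on_curve [OF \<Phi> cv])
  have c2: "continuous_on (cball 0 1) (\<lambda>z. Re (q z))"
    using holomorphic_on_imp_continuous_on [OF q(1)] continuous_on_subset b18 by (intro continuous_intros) blast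
  have sph: "sphere 0 1 \<subseteq> cball (0::complex) 1" by auto
  let ?u = "\<lambda>z. Re (q z) + \<Phi> (\<kappa> z)"
  have "cmean ?u 0 1 = cmean (\<lambda>z. Re (q z)) 0 1 + cmean (\<lambda>z. \<Phi> (\<kappa> z)) 0 1"
    by (rule cmean_add [OF _ continuous_on_subset [OF c2 sph] continuous_on_subset [OF c1 sph]]) simp
  also have "cmean (\<lambda>z. Re (q z)) 0 1 = Re (q 0)" by (rule cmean_Re_holomorphic [OF q(1) b18]) simp
  finally have "?u 0 \<le> cmean ?u 0 1" using sub by simp
  moreover have "exp (?u 0) = 1" using ex [of 0] eq by simp
  then have "?u 0 = 0" by (simp only: exp_eq_one_iff)
  ultimately have m: "0 \<le> cmean ?u 0 1" by simp
  have np: "?u z \<le> 0" if z: "z \<in> sphere 0 1" for z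
  proof -
    have z8: "z \<in> ball 0 8" using z sph b18 by blast
    have "exp (?u z) \<le> exp 0" using ex [OF z8] le [OF z8] by simp
    then show ?thesis by (simp only: exp_le_cancel_iff)
  qed
  have cu: "continuous_on (sphere 0 1) ?u" by (intro continuous_intros continuous_on_subset [OF c1 sph] continuous_on_subset [OF c2 sph])
  \<comment> \<open>A nonpositive continuous function on the circle with nonnegative mean vanishes
    there; angle 0 is the point 1.\<close>
  have "?u (0 + of_real 1 * cis 0) = 0"
    by (rule cmean_nonpos_eq_0 [OF _ cu np m]) auto
  then have "?u 1 = 0" by simp
  then show ?thesis using ex [of 1] by simp
qed

text \<open>Finiteness and continuity of \<phi> make the extended circle means real. The direction v
  = 0, excluded in plurisubharmonicity, only gives the mean of a constant.\<close>

lemma line_submean_of_subharmonic: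
  assumes E: "complex_banach_space E" and X: "atlas_manifold X"
    and g: "continuous_map (subtopology (vtop E) (vball E a r)) (mtop X) g"
    and cont: "continuous_map (mtop X) euclideanreal (real_phi \<phi>)" and fin: "\<And>p. p \<in> points X \<Longrightarrow> \<phi> p = ereal (real_phi \<phi> p)"
    and sub: "\<And>p v. p \<in> carrier E \<Longrightarrow> v \<in> carrier E \<Longrightarrow> v \<noteq> \<zero>\<^bsub>E\<^esub> \<Longrightarrow>
      subharmonic_on {t. p \<oplus>\<^bsub>E\<^esub> t \<odot>\<^bsub>E\<^esub> v \<in> vball E a r} (\<lambda>t. \<phi> (g (p \<oplus>\<^bsub>E\<^esub> t \<odot>\<^bsub>E\<^esub> v)))"
  shows "complex_banach_space.line_submean E (vball E a r) (\<lambda>y. real_phi \<phi> (g y))"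
proof -
  interpret E: complex_banach_space E by fact
  let ?B = "vball E a r" and ?\<Phi> = "real_phi \<phi> \<circ> g"
  have c\<Phi>: "continuous_map (subtopology (vtop E) ?B) euclideanreal ?\<Phi>"
    by (rule continuous_map_compose [OF g cont])
  have BC: "?B \<subseteq> carrier E" by auto
  have tB: "topspace (subtopology (vtop E) ?B) = ?B" using BC by (simp add: inf.absorb2)
  have gX: "g y \<in> points X" if "y \<in> ?B" for y using g that unfolding continuous_map_def tB by blast
  show ?thesis
    unfolding E.line_submean_def
  proof (intro conjI ballI allI impI BC)
    fix x and e :: real assume x: "x \<in> ?B" and e: "e > 0"
    let ?V = "{y \<in> ?B. ?\<Phi> y \<in> ball (?\<Phi> x) e}"
    have "openin (subtopology (vtop E) ?B) ?V"
      using openin_continuous_map_preimage [OF c\<Phi>, of "ball (?\<Phi> x) e"] unfolding tB by simp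
    then have "openin (vtop E) ?V" using openin_open_subtopology [OF E.openin_vball] by blast
    moreover have "x \<in> ?V" using x e by simp
    ultimately obtain d where d: "d > 0" "vball E x d \<subseteq> ?V" using E.openin_vtop [of ?V] by meson
    show "\<exists>d>0. \<forall>y\<in>carrier E. vdist E x y < d \<longrightarrow> y \<in> ?B \<and> \<bar>real_phi \<phi> (g y) - real_phi \<phi> (g x)\<bar> < e"
    proof (intro exI [of _ d] conjI ballI impI d(1))
      fix y assume "y \<in> carrier E" "vdist E x y < d"
      then have "y \<in> vball E x d" using x by simp
      then have y: "y \<in> ?V" using d(2) by blast
      then show "y \<in> ?B" by blast
      show "\<bar>real_phi \<phi> (g y) - real_phi \<phi> (g x)\<bar> < e" using y by (simp add: dist_real_def abs_minus_commute)
    qed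
  next
    fix p v and s :: real assume p: "p \<in> carrier E" and v: "v \<in> carrier E" and s: "s > 0"
      and inB: "\<forall>t. cmod t \<le> s \<longrightarrow> p \<oplus>\<^bsub>E\<^esub> t \<odot>\<^bsub>E\<^esub> v \<in> ?B"
    let ?l = "\<lambda>t. p \<oplus>\<^bsub>E\<^esub> t \<odot>\<^bsub>E\<^esub> v"
    show "real_phi \<phi> (g p) \<le> cmean (\<lambda>t. real_phi \<phi> (g (?l t))) 0 s"
    proof (cases "v = \<zero>\<^bsub>E\<^esub>")
      case True
      then show ?thesis using p by simp
    next
      case False
      let ?D = "{t. ?l t \<in> ?B}"
      have cb: "cball 0 s \<subseteq> ?D" using inB by auto
      have "continuous_map (top_of_set (cball 0 s)) (subtopology (vtop E) ?B) ?l"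
        using continuous_map_from_subtopology [OF continuous_map_line [OF E p v]] cb by (auto simp: continuous_map_in_subtopology)
      from continuous_map_compose [OF this c\<Phi>]
      have "continuous_on (cball 0 s) (?\<Phi> \<circ> ?l)" by simp
      then have cs: "continuous_on (sphere 0 s) (\<lambda>t. real_phi \<phi> (g (?l t)))"
        using continuous_on_subset [OF _ sphere_cball] by (simp add: o_def)
      have "\<phi> (g (?l 0)) \<le> circle_mean (\<lambda>t. \<phi> (g (?l t))) 0 s"
        using sub [OF p v False] s cb unfolding subharmonic_on_def by blast
      also have "circle_mean (\<lambda>t. \<phi> (g (?l t))) 0 s = ereal (cmean (\<lambda>t. real_phi \<phi> (g (?l t))) 0 s)"
        by (rule circle_mean_real [OF _ cs]) (use s inB fin gX in auto)
      finally have "\<phi> (g (?l 0)) \<le> ereal (cmean (\<lambda>t. real_phi \<phi> (g (?l t))) 0 s)" .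
      moreover have "?l 0 = p" using p v by simp
      moreover have "p \<in> ?B" using inB s \<open>?l 0 = p\<close> by (metis less_imp_le norm_zero)
      ultimately show ?thesis using fin gX by simp
    qed
  qed
qed

section \<open>Maximum principle on manifolds and convergence in the Hartogs domain\<close>

context
  fixes X :: "('x, 'v) banach_mfd" and \<phi> :: "'x \<Rightarrow> ereal"
  assumes X: "banach_manifold X" and usc: "usc (mtop X) \<phi>"
    and cr: "continuous_real X \<phi>" and psh: "plurisubharmonic X \<phi>"
begin

interpretation X: banach_manifold X by (rule X)
interpretation X: atlas_manifold X by (rule X.atlas_manifold)

lemma real_phi_cont: "continuous_map (mtop X) euclideanreal (real_phi \<phi>)"
  using cr by (simp add: continuous_real_def real_phi_def)

lemma phi_eq: "p \<in> points X \<Longrightarrow> \<phi> p = ereal (real_phi \<phi> p)"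
  using cr unfolding continuous_real_def real_phi_def by (cases "\<phi> p") auto

lemma in_hartogs_iff: "(p, w) \<in> hartogs_set X \<phi> \<longleftrightarrow> p \<in> points X \<and> cmod w < exp (- real_phi \<phi> p)"
  by (rule hartogs_set_real_iff) (use cr in \<open>simp add: continuous_real_def\<close>)

text \<open>A nearby point y is joined to x by a complex line in a chart, with x at parameter 0 and
  y at parameter 1, and the maximum principle on discs carries equality from 0 to 1.\<close>

lemma max_principle_local:
  assumes A: "atlas_manifold A" and G: "mholomorphic A X G" and L: "mholomorphic A complex_plane L"
    and le: "\<And>x. x \<in> points A \<Longrightarrow> cmod (L x) * exp (real_phi \<phi> (G x)) \<le> 1"
    and x: "x \<in> points A" and eq: "cmod (L x) * exp (real_phi \<phi> (G x)) = 1"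
  shows "\<exists>U. openin (mtop A) U \<and> x \<in> U \<and> (\<forall>y\<in>U. cmod (L y) * exp (real_phi \<phi> (G y)) = 1)"
proof -
  interpret A: atlas_manifold A by fact
  note C = complex_banach_space_complex_space and AP = atlas_manifold_plane [OF open_ball]
  have cG: "continuous_map (mtop A) (mtop X) G" and cL: "continuous_map (mtop A) euclidean L"
    using G L by (auto simp: mholomorphic_def)
  have "G x \<in> points X" using cG x by (auto simp: continuous_map_def)
  from psh [unfolded plurisubharmonic_def, THEN bspec, OF this]
  obtain U and E :: "'v cnormed_space" and a r h g where U: "openin (mtop X) U" "G x \<in> U"
    and E: "complex_banach_space E" and a: "a \<in> carrier E" and r: "0 < r"
    and bh: "biholomorphic (open_submfd X U) (open_submfd (space_mfd E) (vball E a r)) h g"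
    and sub: "\<forall>p\<in>carrier E. \<forall>v\<in>carrier E. v \<noteq> \<zero>\<^bsub>E\<^esub> \<longrightarrow>
           subharmonic_on {\<zeta>. p \<oplus>\<^bsub>E\<^esub> \<zeta> \<odot>\<^bsub>E\<^esub> v \<in> vball E a r} (\<lambda>\<zeta>. \<phi> (g (p \<oplus>\<^bsub>E\<^esub> \<zeta> \<odot>\<^bsub>E\<^esub> v)))"
    by (elim exE conjE) (rule that)
  interpret E: complex_banach_space E by (rule E)
  let ?B = "vball E a r"
  note SE = atlas_manifold_space_mfd [OF E]
  have oB: "openin (mtop (space_mfd E)) ?B" by simp
  have tU: "points (open_submfd X U) = U" using openin_subset [OF U(1)] by auto
  have tB: "points (open_submfd (space_mfd E) ?B) = ?B" by auto
  have h: "mholomorphic (open_submfd X U) (open_submfd (space_mfd E) ?B) h"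
    and g: "mholomorphic (open_submfd (space_mfd E) ?B) (open_submfd X U) g"
    and gh: "\<And>p. p \<in> U \<Longrightarrow> g (h p) = p"
    using bh unfolding biholomorphic_def tU by auto
  have hB: "h p \<in> ?B" if "p \<in> U" for p
    using h that unfolding mholomorphic_def continuous_map_def tU tB by blast
  have h': "mholomorphic (open_submfd X U) (space_mfd E) h"
    using h mholomorphic_open_target [OF X.atlas_manifold_open_submfd [OF U(1)] atlas_manifold.chart_target [OF SE] oB] by blast
  have "continuous_map (subtopology (vtop E) ?B) (mtop X) g"
    using g by (simp add: mholomorphic_def continuous_map_in_subtopology)
  then have \<Phi>: "E.line_submean ?B (\<lambda>y. real_phi \<phi> (g y))"
    by (rule line_submean_of_subharmonic [OF E X.atlas_manifold _ real_phi_cont phi_eq]) (use sub in blast)+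
  \<comment> \<open>On W the map G stays in one plurisubharmonic chart, and L has no zeros, so that
    its logarithm exists along discs. Equality at x guarantees L x \<noteq> 0.\<close>
  define W where "W = {y \<in> points A. G y \<in> U} \<inter> {y \<in> points A. L y \<in> - {0}}"
  have W: "openin (mtop A) W"
    unfolding W_def by (intro openin_Int openin_continuous_map_preimage [OF cG U(1)] openin_continuous_map_preimage [OF cL]) auto
  have "x \<in> W" using x U(2) eq by (auto simp: W_def)
  obtain c where c: "c \<in> atlas A" "x \<in> cdom c" using x A.covering by auto
  let ?F = "cmodel c" and ?x = "cmap c x"
  have F: "complex_banach_space ?F" by (rule A.model [OF c(1)])
  interpret F: complex_banach_space ?F by (rule F)
  have xF: "?x \<in> carrier ?F" by (rule A.cmap_in_carrier [OF c])
  obtain \<rho> where \<rho>: "\<rho> > 0" "vball ?F ?x \<rho> \<subseteq> cmap c ` (cdom c \<inter> W)"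
    using A.chart_ball_small [OF c W \<open>x \<in> W\<close>] by metis
  let ?V = "vball ?F ?x \<rho>"
  have VW: "cinv c y \<in> W" if "y \<in> ?V" for y
  proof -
    obtain z where "z \<in> cdom c" "z \<in> W" "y = cmap c z" using \<rho>(2) \<open>y \<in> ?V\<close> by blast
    then show ?thesis using A.cinv_cmap [OF c(1)] by simp
  qed
  \<comment> \<open>The radius \<rho> / 8 keeps the line from x through y inside the ball of radius
    \<rho> for all parameters of modulus less than 8.\<close>
  have "cmod (L y) * exp (real_phi \<phi> (G y)) = 1" if y: "y \<in> A.chart_ball c x (\<rho> / 8)" for y
  proof -
    have yc: "y \<in> cdom c" "cmap c y \<in> carrier ?F" "vdist ?F ?x (cmap c y) < \<rho> / 8"
      using y by (auto simp: A.chart_ball_def)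
    define v where "v = cmap c y \<ominus>\<^bsub>?F\<^esub> ?x"
    have v: "v \<in> carrier ?F" using yc xF by (simp add: v_def)
    have nv: "vnorm ?F v < \<rho> / 8" using yc xF by (metis F.vdist_commute F.vdist_eq v_def)
    let ?l = "\<lambda>t. ?x \<oplus>\<^bsub>?F\<^esub> t \<odot>\<^bsub>?F\<^esub> v"
    have l0: "?l 0 = ?x" using xF v by simp
    have l1: "?l 1 = cmap c y" unfolding v_def using xF yc by (intro F.eq_dual) (auto simp: F.unit_dualD)
    have lV: "?l t \<in> ?V" if t: "t \<in> ball 0 8" for t
    proof -
      have "vdist ?F (?l 0) (?l t) = cmod t * vnorm ?F v" using F.vdist_line [OF xF v, of 0 t] by simp
      also have "\<dots> \<le> 8 * vnorm ?F v" using t F.vnorm_nonneg [OF v] by (intro mult_right_mono) auto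
      also have "\<dots> < \<rho>" using nv by simp
      finally show ?thesis using xF v by simp
    qed
    let ?R = "cmap c ` cdom c"
    have lR: "?l t \<in> ?R" if "t \<in> ball 0 8" for t using lV [OF that] \<rho>(2) by blast
    have oR: "openin (mtop (space_mfd ?F)) ?R" using A.open_range [OF c(1)] by simp
    note SF = atlas_manifold.atlas_manifold_open_submfd [OF atlas_manifold_space_mfd [OF F] oR]
    have ml: "mholomorphic (open_submfd complex_plane (ball 0 8)) (open_submfd (space_mfd ?F) ?R) ?l"
      by (rule mholomorphic_line [OF F xF v open_ball A.open_range [OF c(1)] lR])
    have mA: "mholomorphic (open_submfd complex_plane (ball 0 8)) A (cinv c \<circ> ?l)"
      by (rule mholomorphic_comp [OF AP SF A ml A.mholomorphic_cinv [OF c(1)]])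
    have mX: "mholomorphic (open_submfd complex_plane (ball 0 8)) X (G \<circ> (cinv c \<circ> ?l))"
      by (rule mholomorphic_comp [OF AP A X.atlas_manifold mA G])
    have inU: "G (cinv c (?l t)) \<in> U \<and> L (cinv c (?l t)) \<noteq> 0 \<and> cinv c (?l t) \<in> points A" if "t \<in> ball 0 8" for t
      using VW [OF lV [OF that]] by (simp add: W_def)
    have mU: "mholomorphic (open_submfd complex_plane (ball 0 8)) (open_submfd X U) (G \<circ> (cinv c \<circ> ?l))"
      using mholomorphic_open_target [OF AP X.chart_target U(1)] mX inU by auto
    have mE: "mholomorphic (open_submfd complex_plane (ball 0 8)) (space_mfd E) (h \<circ> (G \<circ> (cinv c \<circ> ?l)))"
      by (rule mholomorphic_comp [OF AP X.atlas_manifold_open_submfd [OF U(1)] SE mU h'])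
    have "mholomorphic (open_submfd complex_plane (ball 0 8)) complex_plane (L \<circ> (cinv c \<circ> ?l))"
      by (rule mholomorphic_comp [OF AP A atlas_manifold_complex_plane mA L])
    then have hH: "(L \<circ> (cinv c \<circ> ?l)) holomorphic_on ball 0 8" by (simp only: mholomorphic_plane_iff open_ball)
    have ghk: "g ((h \<circ> (G \<circ> (cinv c \<circ> ?l))) t) = G (cinv c (?l t))" if "t \<in> ball 0 8" for t
      using gh inU [OF that] by simp
    have at_1: "cmod ((L \<circ> (cinv c \<circ> ?l)) 1) * exp (real_phi \<phi> (g ((h \<circ> (G \<circ> (cinv c \<circ> ?l))) 1))) = 1"
    proof (rule max_principle_disc [OF E \<Phi> a mE _ hH])
      show "(h \<circ> (G \<circ> (cinv c \<circ> ?l))) ` ball 0 8 \<subseteq> ?B"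
      proof
        fix y assume "y \<in> (h \<circ> (G \<circ> (cinv c \<circ> ?l))) ` ball 0 8"
        then obtain t where "t \<in> ball 0 8" "y = h (G (cinv c (?l t)))" by auto
        then show "y \<in> ?B" using hB inU by blast
      qed
      show "(L \<circ> (cinv c \<circ> ?l)) t \<noteq> 0" if "t \<in> ball 0 8" for t using inU [OF that] by simp
      show "cmod ((L \<circ> (cinv c \<circ> ?l)) t) * exp (real_phi \<phi> (g ((h \<circ> (G \<circ> (cinv c \<circ> ?l))) t))) \<le> 1" if "t \<in> ball 0 8" for t
        unfolding ghk [OF that] using le inU [OF that] by simp
      have 0: "0 \<in> ball (0::complex) 8" by simp
      show "cmod ((L \<circ> (cinv c \<circ> ?l)) 0) * exp (real_phi \<phi> (g ((h \<circ> (G \<circ> (cinv c \<circ> ?l))) 0))) = 1"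
        unfolding ghk [OF 0] unfolding o_apply l0 A.cinv_cmap [OF c] by (rule eq)
    qed
    have 1: "1 \<in> ball (0::complex) 8" by simp
    show ?thesis using at_1 unfolding ghk [OF 1] unfolding o_apply l1 A.cinv_cmap [OF c(1) yc(1)] .
  qed
  moreover have "x \<in> A.chart_ball c x (\<rho> / 8)" by (rule A.chart_ball_self [OF c]) (use \<rho> in simp)
  ultimately show ?thesis using A.openin_chart_ball [OF c(1)] by blast
qed

text \<open>Continuity of \<phi> provides local bounds for the fibre components; plurisubharmonicity
  prevents the limit from touching the boundary. The Vitali property of X enters only through
  G.\<close>

lemma hartogs_convergent:
  fixes A :: "('u, 'u) banach_mfd"
  assumes A: "banach_manifold A" and f: "\<And>k. f k \<in> Hol A (hartogs_domain X \<phi>)"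
    and uniq: "uniq_set A (conv_set A (hartogs_domain X \<phi>) f) \<noteq> {}"
    and G: "limitin (compact_open A X) (\<lambda>k. restrict (fst \<circ> f k) (points A)) G sequentially"
  shows "\<exists>F. limitin (compact_open A (hartogs_domain X \<phi>)) f F sequentially"
proof -
  interpret A: banach_manifold A by fact
  note AA = A.atlas_manifold and XA = X.atlas_manifold
  let ?Y = "hartogs_domain X \<phi>" and ?S = "conv_set A (hartogs_domain X \<phi>) f"
  define a where "a k = fst \<circ> f k" for k
  define b where "b k = snd \<circ> f k" for k
  have fab: "f k x = (a k x, b k x)" for k x by (simp add: a_def b_def)
  have mf: "mholomorphic A ?Y (f k)" for k using f by (simp add: Hol_def)
  then have ma: "mholomorphic A X (a k)" and mb: "mholomorphic A complex_plane (b k)"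
    and fH: "f k \<in> points A \<rightarrow> hartogs_set X \<phi>" for k
    using mholomorphic_hartogs_iff [OF AA XA usc] unfolding a_def b_def by blast+
  have GH: "G \<in> Hol A X" and Gloc: "locally_converges A X (\<lambda>k. restrict (fst \<circ> f k) (points A)) G"
    using limitin_compact_openD [OF AA G] by auto
  have mG: "mholomorphic A X G" using GH by (simp add: Hol_def)
  then have cG: "continuous_map (mtop A) (mtop X) G" by (simp add: mholomorphic_def)
  have GX: "G x \<in> points X" if "x \<in> points A" for x by (rule Hol_points [OF GH that])
  have aloc: "\<exists>U. openin (mtop A) U \<and> x \<in> U \<and> (\<forall>\<^sub>F k in sequentially. a k ` U \<subseteq> V)"
    if x: "x \<in> points A" and V: "openin (mtop X) V" "G x \<in> V" for x V
  proof -
    obtain U where U: "openin (mtop A) U" "x \<in> U" "\<forall>\<^sub>F k in sequentially. restrict (fst \<circ> f k) (points A) ` U \<subseteq> V"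
      using Gloc [unfolded locally_converges_def, THEN bspec, OF x, THEN spec, THEN mp, OF V(1), THEN mp, OF V(2)]
      by (elim exE conjE)
    have "restrict (fst \<circ> f k) (points A) ` U = a k ` U" for k
      using openin_subset [OF U(1)] by (intro image_cong) (auto simp: a_def)
    then show ?thesis using U by (intro exI [of _ U]) simp
  qed
  have alim: "limitin (mtop X) (\<lambda>k. a k x) (G x) sequentially" if x: "x \<in> points A" for x
    using locally_converges_pointwise [OF Gloc x GX [OF x]] x by (simp add: a_def)
  have bd: "\<exists>U M. openin (mtop A) U \<and> x \<in> U \<and> (\<forall>\<^sub>F k in sequentially. \<forall>y\<in>U. cmod (b k y) \<le> M)" if x: "x \<in> points A" for x
  proof -
    \<comment> \<open>A neighbourhood on which \<phi> drops by less than 1, so the fibres over it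
      have radius at most exp (1 - \<phi> (G x)).\<close>
    let ?V = "{p \<in> points X. real_phi \<phi> p \<in> {real_phi \<phi> (G x) - 1<..}}"
    have oV: "openin (mtop X) ?V" by (rule openin_continuous_map_preimage [OF real_phi_cont]) simp
    have GV: "G x \<in> ?V" using GX [OF x] by simp
    obtain U where U: "openin (mtop A) U" "x \<in> U" "\<forall>\<^sub>F k in sequentially. a k ` U \<subseteq> ?V"
      using aloc [OF x oV GV] by (elim exE conjE)
    have "\<forall>\<^sub>F k in sequentially. \<forall>y\<in>U. cmod (b k y) \<le> exp (1 - real_phi \<phi> (G x))"
      using U(3)
    proof eventually_elim
      case (elim k)
      show ?case
      proof
        fix y assume y: "y \<in> U"
        then have "y \<in> points A" using openin_subset [OF U(1)] by blast
        then have "(a k y, b k y) \<in> hartogs_set X \<phi>" using fH [of k] fab by auto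
        then have 1: "cmod (b k y) < exp (- real_phi \<phi> (a k y))" using in_hartogs_iff by blast
        have "a k y \<in> ?V" using elim y by blast
        then have "real_phi \<phi> (a k y) > real_phi \<phi> (G x) - 1" by simp
        then have "exp (- real_phi \<phi> (a k y)) \<le> exp (1 - real_phi \<phi> (G x))" by simp
        with 1 show "cmod (b k y) \<le> exp (1 - real_phi \<phi> (G x))" by linarith
      qed
    qed
    then show ?thesis using U by (intro exI [of _ U] exI [of _ "exp (1 - real_phi \<phi> (G x))"] conjI)
  qed
  have SA: "?S \<subseteq> points A" by (auto simp: conv_set_def)
  have Slim: "\<exists>p w. (p, w) \<in> hartogs_set X \<phi> \<and> limitin (mtop X) (\<lambda>k. a k x) p sequentially \<and> (\<lambda>k. b k x) \<longlonglongrightarrow> w" if "x \<in> ?S" for x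
  proof -
    obtain y where "limitin (mtop ?Y) (\<lambda>k. f k x) y sequentially" using \<open>x \<in> ?S\<close> unfolding conv_set_def by blast
    then have "limitin (mtop ?Y) (\<lambda>k. (a k x, b k x)) (fst y, snd y) sequentially" by (simp only: fab prod.collapse)
    then show ?thesis unfolding limitin_hartogs_iff by blast
  qed
  have Sconv: "convergent (\<lambda>k. b k x)" if "x \<in> ?S" for x using Slim [OF that] unfolding convergent_def by blast
  have "\<exists>L. mholomorphic A complex_plane L \<and>
      (\<forall>x\<in>points A. \<forall>e>0. \<exists>U. openin (mtop A) U \<and> x \<in> U \<and> (\<forall>\<^sub>F k in sequentially. \<forall>y\<in>U. cmod (b k y - L x) < e)) \<and>
      (\<forall>x\<in>points A. (\<lambda>k. b k x) \<longlonglongrightarrow> L x)"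
  proof (rule Vitali_bounded [OF A mb bd SA uniq Sconv])
    fix L assume "mholomorphic A complex_plane L"
      "\<And>x e. x \<in> points A \<Longrightarrow> e > 0 \<Longrightarrow> \<exists>U. openin (mtop A) U \<and> x \<in> U \<and> (\<forall>\<^sub>F k in sequentially. \<forall>y\<in>U. cmod (b k y - L x) < e)"
      "\<And>x. x \<in> points A \<Longrightarrow> (\<lambda>k. b k x) \<longlonglongrightarrow> L x"
    then show ?thesis by (intro exI [of _ L] conjI ballI allI impI)
  qed
  then obtain L where mL: "mholomorphic A complex_plane L"
    and Lall: "\<forall>x\<in>points A. \<forall>e>0. \<exists>U. openin (mtop A) U \<and> x \<in> U \<and> (\<forall>\<^sub>F k in sequentially. \<forall>y\<in>U. cmod (b k y - L x) < e)"
    and Llim': "\<forall>x\<in>points A. (\<lambda>k. b k x) \<longlonglongrightarrow> L x"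
    by (elim exE conjE)
  note Lloc = Lall [rule_format] and Llim = Llim' [rule_format]
  let ?v = "\<lambda>x. cmod (L x) * exp (real_phi \<phi> (G x))"
  \<comment> \<open>Only the weak inequality passes to the limit; excluding equality is the task of
    the maximum principle.\<close>
  have vle: "?v x \<le> 1" if x: "x \<in> points A" for x
  proof -
    have "(\<lambda>k. real_phi \<phi> (a k x)) \<longlonglongrightarrow> real_phi \<phi> (G x)"
      using continuous_map_limit [OF real_phi_cont alim [OF x]] by (simp add: o_def)
    then have "(\<lambda>k. cmod (b k x) * exp (real_phi \<phi> (a k x))) \<longlonglongrightarrow> ?v x"
      by (intro tendsto_intros Llim [OF x])
    moreover have "cmod (b k x) * exp (real_phi \<phi> (a k x)) \<le> 1" for k
    proof -
      have "(a k x, b k x) \<in> hartogs_set X \<phi>" using fH [of k] fab x by auto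
      then have "cmod (b k x) < exp (- real_phi \<phi> (a k x))" using in_hartogs_iff by blast
      then show ?thesis by (simp add: exp_minus field_simps)
    qed
    ultimately show ?thesis by (intro LIMSEQ_le_const2) auto
  qed
  have cv: "continuous_map (mtop A) euclideanreal ?v"
  proof -
    have 1: "continuous_map (mtop A) euclideanreal (\<lambda>x. cmod (L x))"
      using mL by (auto simp: mholomorphic_def intro: continuous_map_norm)
    have "continuous_map (mtop A) euclideanreal (real_phi \<phi> \<circ> G)" by (rule continuous_map_compose [OF cG real_phi_cont])
    moreover have "continuous_map euclideanreal euclideanreal exp" by (simp add: continuous_on_exp)
    ultimately have "continuous_map (mtop A) euclideanreal (exp \<circ> (real_phi \<phi> \<circ> G))" by (rule continuous_map_compose)
    from continuous_map_real_mult [OF 1 this] show ?thesis by (simp add: o_def)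
  qed
  \<comment> \<open>The set where the limit pair lies on the boundary of the Hartogs domain. It is
    closed by continuity, open by the local maximum principle, and misses all points of
    convergence.\<close>
  define T where "T = {x \<in> points A. ?v x \<in> {1}}"
  have "closedin (mtop A) T"
    unfolding T_def by (rule closedin_continuous_map_preimage [OF cv]) simp
  moreover have "openin (mtop A) T"
  proof (subst openin_subopen, intro ballI)
    fix x assume "x \<in> T"
    then have x: "x \<in> points A" "?v x = 1" by (auto simp: T_def)
    from max_principle_local [OF AA mG mL vle x]
    obtain U where U: "openin (mtop A) U" "x \<in> U" "\<forall>y\<in>U. ?v y = 1" by blast
    then show "\<exists>U. openin (mtop A) U \<and> x \<in> U \<and> U \<subseteq> T"
      using openin_subset [OF U(1)] by (intro exI [of _ U]) (auto simp: T_def)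
  qed
  moreover have "T \<noteq> points A"
  proof -
    \<comment> \<open>The uniqueness set lies in the closure of the convergence set, so the latter
      cannot be empty; at its points the limit belongs to the Hartogs domain.\<close>
    have "?S \<noteq> {}" using uniq by (auto simp: uniq_set_def)
    then obtain x where x: "x \<in> ?S" by blast
    then obtain p w where pw: "(p, w) \<in> hartogs_set X \<phi>" "limitin (mtop X) (\<lambda>k. a k x) p sequentially" "(\<lambda>k. b k x) \<longlonglongrightarrow> w"
      using Slim by blast
    have xA: "x \<in> points A" using x SA by blast
    have "p = G x" by (rule limitin_Hausdorff_unique [OF pw(2) alim [OF xA] sequentially_bot X.Hausdorff])
    moreover have "w = L x" by (rule LIMSEQ_unique [OF pw(3) Llim [OF xA]])
    ultimately have "cmod (L x) < exp (- real_phi \<phi> (G x))" using pw(1) in_hartogs_iff by blast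
    then have "?v x \<noteq> 1" by (simp add: exp_minus field_simps)
    then show ?thesis using xA by (auto simp: T_def)
  qed
  ultimately have "T = {}" using A.connected unfolding connected_space_clopen_in by blast
  then have vlt: "?v x < 1" if "x \<in> points A" for x using vle [OF that] that by (force simp: T_def)
  have GLH: "(G x, L x) \<in> hartogs_set X \<phi>" if "x \<in> points A" for x
    using vlt [OF that] GX [OF that] in_hartogs_iff by (simp add: exp_minus field_simps)
  define F where "F = restrict (\<lambda>x. (G x, L x)) (points A)"
  have "mholomorphic A X (fst \<circ> F)"
    by (rule mholomorphic_cong [OF AA X.chart_target mG]) (simp add: F_def)
  moreover have "mholomorphic A complex_plane (snd \<circ> F)"
    by (rule mholomorphic_cong [OF AA atlas_manifold.chart_target [OF atlas_manifold_complex_plane] mL]) (simp add: F_def)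
  moreover have "F \<in> points A \<rightarrow> hartogs_set X \<phi>" using GLH by (simp add: F_def)
  ultimately have "F \<in> Hol A ?Y"
    using mholomorphic_hartogs_iff [OF AA XA usc, of F] by (simp add: Hol_def F_def)
  moreover have "locally_converges A ?Y f F"
    unfolding locally_converges_def
  proof (intro ballI allI impI)
    fix x V assume x: "x \<in> points A" and V: "openin (mtop ?Y) V" "F x \<in> V"
    have oV: "openin (prod_topology (mtop X) euclidean) V"
      using V(1) openin_open_subtopology [OF openin_hartogs_set [OF usc]] by simp
    have GLV: "(G x, L x) \<in> V" using V(2) x by (simp add: F_def)
    obtain V1 V2 where V12: "openin (mtop X) V1" "open V2" "G x \<in> V1" "L x \<in> V2" "V1 \<times> V2 \<subseteq> V"
      using oV [unfolded openin_prod_topology_alt, rule_format, OF GLV] by (elim exE conjE) simp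
    obtain U1 where U1: "openin (mtop A) U1" "x \<in> U1" "\<forall>\<^sub>F k in sequentially. a k ` U1 \<subseteq> V1"
      using aloc [OF x V12(1,3)] by (elim exE conjE)
    obtain e where e: "e > 0" "ball (L x) e \<subseteq> V2" using V12(2,4) by (meson openE)
    obtain U2 where U2: "openin (mtop A) U2" "x \<in> U2" "\<forall>\<^sub>F k in sequentially. \<forall>y\<in>U2. cmod (b k y - L x) < e"
      using Lloc [OF x e(1)] by (elim exE conjE)
    have "\<forall>\<^sub>F k in sequentially. f k ` (U1 \<inter> U2) \<subseteq> V"
      using U1(3) U2(3)
    proof eventually_elim
      case (elim k)
      show ?case
      proof
        fix q assume "q \<in> f k ` (U1 \<inter> U2)"
        then obtain y where y: "y \<in> U1" "y \<in> U2" "q = f k y" by blast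
        have "a k y \<in> V1" using elim(1) y by blast
        moreover have "b k y \<in> ball (L x) e" using elim(2) y by (simp add: dist_norm norm_minus_commute)
        ultimately show "q \<in> V" using V12(5) e(2) y(3) fab by auto
      qed
    qed
    then show "\<exists>U. openin (mtop A) U \<and> x \<in> U \<and> (\<forall>\<^sub>F k in sequentially. f k ` U \<subseteq> V)"
      using U1 U2 by (intro exI [of _ "U1 \<inter> U2"]) auto
  qed
  ultimately have "limitin (compact_open A ?Y) f F sequentially" by (intro limitin_compact_openI f)
  then show ?thesis by (rule exI [of _ F])
qed

end

section \<open>The projection to X and the zero section\<close>

lemma conv_set_hartogs_subset:
  assumes A: "banach_manifold A"
  shows "conv_set A (hartogs_domain X \<phi>) f \<subseteq> conv_set A X (\<lambda>k. restrict (fst \<circ> f k) (points A))"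
proof
  fix x assume "x \<in> conv_set A (hartogs_domain X \<phi>) f"
  then obtain y where x: "x \<in> points A" and "limitin (mtop (hartogs_domain X \<phi>)) (\<lambda>k. f k x) y sequentially"
    unfolding conv_set_def by blast
  then have "limitin (mtop X) (\<lambda>k. restrict (fst \<circ> f k) (points A) x) (fst y) sequentially"
    by (simp add: limitin_subtopology limitin_pairwise o_def)
  then show "x \<in> conv_set A X (\<lambda>k. restrict (fst \<circ> f k) (points A))" using x by (auto simp: conv_set_def)
qed

lemma Hol_fst_hartogs:
  assumes A: "atlas_manifold A" and X: "atlas_manifold X" and usc: "usc (mtop X) \<phi>" and f: "f \<in> Hol A (hartogs_domain X \<phi>)"
  shows "restrict (fst \<circ> f) (points A) \<in> Hol A X"
proof -
  have "mholomorphic A X (fst \<circ> f)" using f mholomorphic_hartogs_iff [OF A X usc] by (simp add: Hol_def)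
  then have "mholomorphic A X (restrict (fst \<circ> f) (points A))"
    by (rule mholomorphic_cong [OF A atlas_manifold.chart_target [OF X]]) simp
  then show ?thesis by (simp add: Hol_def)
qed

text \<open>X sits in the Hartogs domain as its zero section, and the projection is a left inverse.
  Lifting a sequence preserves its points of convergence, so the Vitali hypothesis carries over, and
  a limit projects back.\<close>

lemma zero_section_convergence:
  assumes A: "banach_manifold A" and X: "banach_manifold X" and usc: "usc (mtop X) \<phi>" and f: "\<And>k. f k \<in> Hol A X"
  defines "f0 \<equiv> \<lambda>k. restrict (\<lambda>x. (f k x, 0)) (points A)"
  shows "f0 k \<in> Hol A (hartogs_domain X \<phi>)" "conv_set A X f \<subseteq> conv_set A (hartogs_domain X \<phi>) f0"
    "limitin (compact_open A (hartogs_domain X \<phi>)) f0 F sequentially \<Longrightarrow> \<exists>g. limitin (compact_open A X) f g sequentially"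
proof -
  note AA = banach_manifold.atlas_manifold [OF A] and XA = banach_manifold.atlas_manifold [OF X]
  have fX: "f k x \<in> points X" if "x \<in> points A" for k x by (rule Hol_points [OF f that])
  have zH: "(f k x, 0) \<in> hartogs_set X \<phi>" if "x \<in> points A" for k x by (rule zero_in_hartogs_set [OF usc fX [OF that]])
  show f0: "f0 k \<in> Hol A (hartogs_domain X \<phi>)" for k
  proof -
    have "mholomorphic A X (f k)" using f by (simp add: Hol_def)
    then have "mholomorphic A X (fst \<circ> f0 k)"
      by (rule mholomorphic_cong [OF AA atlas_manifold.chart_target [OF XA]]) (simp add: f0_def)
    moreover have "mholomorphic A complex_plane (\<lambda>_. 0)"
      by (rule mholomorphic_const [OF AA atlas_manifold_complex_plane]) simp
    then have "mholomorphic A complex_plane (snd \<circ> f0 k)"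
      by (rule mholomorphic_cong [OF AA atlas_manifold.chart_target [OF atlas_manifold_complex_plane]]) (simp add: f0_def)
    moreover have "f0 k \<in> points A \<rightarrow> hartogs_set X \<phi>" using zH by (simp add: f0_def)
    ultimately show ?thesis using mholomorphic_hartogs_iff [OF AA XA usc, of "f0 k"] by (simp add: Hol_def f0_def)
  qed
  show "conv_set A X f \<subseteq> conv_set A (hartogs_domain X \<phi>) f0"
  proof
    fix x assume "x \<in> conv_set A X f"
    then obtain y where x: "x \<in> points A" and y: "limitin (mtop X) (\<lambda>k. f k x) y sequentially"
      unfolding conv_set_def by blast
    have "limitin (mtop (hartogs_domain X \<phi>)) (\<lambda>k. (f k x, 0)) (y, 0) sequentially"
      unfolding limitin_hartogs_iff using y zH [OF x] zero_in_hartogs_set [OF usc limitin_topspace [OF y]] by simp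
    then have "limitin (mtop (hartogs_domain X \<phi>)) (\<lambda>k. f0 k x) (y, 0) sequentially" using x by (simp add: f0_def)
    then show "x \<in> conv_set A (hartogs_domain X \<phi>) f0" using x by (auto simp: conv_set_def simp del: mtop_hartogs)
  qed
  assume F: "limitin (compact_open A (hartogs_domain X \<phi>)) f0 F sequentially"
  have FH: "F \<in> Hol A (hartogs_domain X \<phi>)" and loc: "locally_converges A (hartogs_domain X \<phi>) f0 F"
    using limitin_compact_openD [OF AA F] by auto
  let ?g = "restrict (fst \<circ> F) (points A)"
  have "locally_converges A X f ?g"
    unfolding locally_converges_def
  proof (intro ballI allI impI)
    fix x V assume x: "x \<in> points A" and V: "openin (mtop X) V" "?g x \<in> V"
    let ?W = "(V \<times> UNIV) \<inter> hartogs_set X \<phi>"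
    have oW: "openin (mtop (hartogs_domain X \<phi>)) ?W"
      using V(1) by (simp add: openin_subtopology_Int openin_prod_Times_iff)
    have FW: "F x \<in> ?W"
      using V(2) x Hol_points [OF FH x] unfolding points_hartogs by (simp add: mem_Times_iff)
    obtain U where U: "openin (mtop A) U" "x \<in> U" "\<forall>\<^sub>F k in sequentially. f0 k ` U \<subseteq> ?W"
      using loc [unfolded locally_converges_def, THEN bspec, OF x, THEN spec, THEN mp, OF oW, THEN mp, OF FW]
      by (elim exE conjE)
    from U(3) have "\<forall>\<^sub>F k in sequentially. f k ` U \<subseteq> V"
    proof eventually_elim
      case (elim k)
      show ?case
      proof
        fix q assume "q \<in> f k ` U"
        then obtain y where y: "y \<in> U" "q = f k y" by blast
        then have "f0 k y \<in> ?W" using elim by blast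
        then show "q \<in> V" using y openin_subset [OF U(1)] by (auto simp: f0_def)
      qed
    qed
    then show "\<exists>U. openin (mtop A) U \<and> x \<in> U \<and> (\<forall>\<^sub>F k in sequentially. f k ` U \<subseteq> V)"
      by (intro exI [of _ U] conjI U)
  qed
  then have "limitin (compact_open A X) f ?g sequentially"
    by (intro limitin_compact_openI f Hol_fst_hartogs [OF AA XA usc FH])
  then show "\<exists>g. limitin (compact_open A X) f g sequentially" by (rule exI [of _ ?g])
qed

theorem proposition4p5:
  fixes X :: "('x, 'v) banach_mfd" and \<phi> :: "'x \<Rightarrow> ereal"
  assumes "banach_manifold X"
    and "usc (mtop X) \<phi>"
    and "\<exists>emb :: complex \<Rightarrow> 'u. inj emb"
  shows "(strong_vitali TYPE('u) (hartogs_domain X \<phi>) \<longleftrightarrow>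
            (continuous_real X \<phi> \<and> plurisubharmonic X \<phi>) \<and> strong_vitali TYPE('u) X) \<and>
         (weak_vitali TYPE('u) (hartogs_domain X \<phi>) \<longleftrightarrow>
            (continuous_real X \<phi> \<and> plurisubharmonic X \<phi>) \<and> weak_vitali TYPE('u) X)"
proof -
  note X = assms(1) and usc = assms(2)
  obtain emb :: "complex \<Rightarrow> 'u" where inj: "inj emb" using assms(3) by blast
  let ?Y = "hartogs_domain X \<phi>"
  note XA = banach_manifold.atlas_manifold [OF X]
  \<comment> \<open>The weak property suffices here; since it follows from the strong one, both
    equivalences use this fact.\<close>
  have necessary: "continuous_real X \<phi> \<and> plurisubharmonic X \<phi>" if "weak_vitali TYPE('u) ?Y"
    using continuous_real_hartogs [OF X usc inj that] plurisubharmonic_hartogs [OF X usc inj that] by blast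
  have strong_X: "strong_vitali TYPE('u) X" if S: "strong_vitali TYPE('u) ?Y"
    unfolding strong_vitali_def
  proof (intro allI impI, elim conjE)
    fix A :: "('u, 'u) banach_mfd" and f
    assume A: "banach_manifold A" and f: "\<forall>k. f k \<in> Hol A X" and u: "uniq_set A (conv_set A X f) \<noteq> {}"
    let ?f0 = "\<lambda>k. restrict (\<lambda>x. (f k x, 0)) (points A)"
    have fk: "f k \<in> Hol A X" for k using f by blast
    note z = zero_section_convergence [of A X \<phi> f, OF A X usc fk]
    have "uniq_set A (conv_set A ?Y ?f0) \<noteq> {}" using u uniq_set_mono [OF z(2)] by blast
    then obtain F where "limitin (compact_open A ?Y) ?f0 F sequentially"
      using S [unfolded strong_vitali_def, THEN spec [of _ A], THEN spec [of _ ?f0]] A z(1) by (elim impE exE) simp_all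
    then show "\<exists>g. limitin (compact_open A X) f g sequentially" by (rule z(3))
  qed
  have weak_X: "weak_vitali TYPE('u) X" if S: "weak_vitali TYPE('u) ?Y"
    unfolding weak_vitali_def
  proof (intro allI impI, elim conjE)
    fix A :: "('u, 'u) banach_mfd" and f
    assume A: "banach_manifold A" and f: "\<forall>k. f k \<in> Hol A X" and u: "conv_set A X f \<inter> uniq_set A (conv_set A X f) \<noteq> {}"
    let ?f0 = "\<lambda>k. restrict (\<lambda>x. (f k x, 0)) (points A)"
    have fk: "f k \<in> Hol A X" for k using f by blast
    note z = zero_section_convergence [of A X \<phi> f, OF A X usc fk]
    have "conv_set A ?Y ?f0 \<inter> uniq_set A (conv_set A ?Y ?f0) \<noteq> {}" using u z(2) uniq_set_mono [OF z(2)] by blast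
    then obtain F where "limitin (compact_open A ?Y) ?f0 F sequentially"
      using S [unfolded weak_vitali_def, THEN spec [of _ A], THEN spec [of _ ?f0]] A z(1) by (elim impE exE) simp_all
    then show "\<exists>g. limitin (compact_open A X) f g sequentially" by (rule z(3))
  qed
  have strong_Y: "strong_vitali TYPE('u) ?Y"
    if c: "continuous_real X \<phi>" "plurisubharmonic X \<phi>" and S: "strong_vitali TYPE('u) X"
    unfolding strong_vitali_def
  proof (intro allI impI, elim conjE)
    fix A :: "('u, 'u) banach_mfd" and f
    assume A: "banach_manifold A" and f: "\<forall>k. f k \<in> Hol A ?Y" and u: "uniq_set A (conv_set A ?Y f) \<noteq> {}"
    let ?f1 = "\<lambda>k. restrict (fst \<circ> f k) (points A)"
    have fk: "f k \<in> Hol A ?Y" for k using f by blast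
    have f1: "?f1 k \<in> Hol A X" for k by (rule Hol_fst_hartogs [OF banach_manifold.atlas_manifold [OF A] XA usc fk])
    have "uniq_set A (conv_set A X ?f1) \<noteq> {}"
      using u uniq_set_mono [OF conv_set_hartogs_subset [OF A, of X \<phi> f]] by blast
    then obtain G where "limitin (compact_open A X) ?f1 G sequentially"
      using S [unfolded strong_vitali_def, THEN spec [of _ A], THEN spec [of _ ?f1]] A f1 by (elim impE exE) simp_all
    then show "\<exists>F. limitin (compact_open A ?Y) f F sequentially"
      by (rule hartogs_convergent [OF X usc c A fk u])
  qed
  have weak_Y: "weak_vitali TYPE('u) ?Y"
    if c: "continuous_real X \<phi>" "plurisubharmonic X \<phi>" and S: "weak_vitali TYPE('u) X"
    unfolding weak_vitali_def
  proof (intro allI impI, elim conjE)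
    fix A :: "('u, 'u) banach_mfd" and f
    assume A: "banach_manifold A" and f: "\<forall>k. f k \<in> Hol A ?Y" and u: "conv_set A ?Y f \<inter> uniq_set A (conv_set A ?Y f) \<noteq> {}"
    let ?f1 = "\<lambda>k. restrict (fst \<circ> f k) (points A)"
    have fk: "f k \<in> Hol A ?Y" for k using f by blast
    have f1: "?f1 k \<in> Hol A X" for k by (rule Hol_fst_hartogs [OF banach_manifold.atlas_manifold [OF A] XA usc fk])
    note sub = conv_set_hartogs_subset [OF A, of X \<phi> f]
    have "conv_set A X ?f1 \<inter> uniq_set A (conv_set A X ?f1) \<noteq> {}"
      using u sub uniq_set_mono [OF sub] by blast
    then obtain G where G: "limitin (compact_open A X) ?f1 G sequentially"
      using S [unfolded weak_vitali_def, THEN spec [of _ A], THEN spec [of _ ?f1]] A f1 by (elim impE exE) simp_all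
    have "uniq_set A (conv_set A ?Y f) \<noteq> {}" using u by blast
    from hartogs_convergent [OF X usc c A fk this G]
    show "\<exists>F. limitin (compact_open A ?Y) f F sequentially" .
  qed
  show ?thesis
    using necessary strong_imp_weak_vitali [of ?Y] strong_X weak_X strong_Y weak_Y by blast
qed

end
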